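(* Let $m\ge 1$ and let $a_1,\dots,a_m>-1$ be fixed (independent of $N$). For $u\in\mathbb{C}\setminus\{0\}$ let $\rho=\frac{1}{\sqrt m}|u|^{-(m-1)/m}$ and introduce rescaled variables $$z_k=u+\frac{v_k}{\rho\sqrt N},\qquad k=1,\dots,n.$$ (Bulk) If $0<|u|<1$, then $$\lim_{N\to\infty}N^{n(m-1)}\rho^{-2n}R_{N,n}\big(N^{m/2}z_1,\dots,N^{m/2}z_n\big)=\det\Big(\frac1\pi e^{-\frac12(|v_k|^2+|v_j|^2-2v_k\overline{v_j})}\Big)_{1\le k,j\le n}.$$ (Edge) If $u=e^{i\phi}$ with $0\le\phi<2\pi$, then $$\lim_{N\to\infty}N^{n(m-1)}\rho^{-2n}R_{N,n}\big(N^{m/2}z_1,\dots,N^{m/2}z_n\big)=\det\Big(\frac1{2\pi}e^{-\frac12(|v_k|^2+|v_j|^2-2v_k\overline{v_j})}\,\mathrm{erfc}\Big(\frac{e^{i\phi}\overline{v_j}+e^{-i\phi}v_k}{\sqrt2}\Big)\Big)_{1\le k,j\le n}.$$ Both limits hold uniformly for $v_1,\dots,v_n$ in any compact subset of $\mathbb{C}$.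
   Context: $R_{N,n}$ is the $n$-point eigenvalue correlation function of the product $X_mX_{m-1}\cdots X_1$ of independent $N\times N$ matrices, $X_k$ having density proportional to $(\det X_k^*X_k)^{a_k}e^{-\mathrm{tr}(X_k^*X_k)}$ (induced complex Ginibre ensemble). It is given explicitly by $R_{N,n}(z_1,\dots,z_n)=\det\big(K_N(z_j,z_k)\big)_{1\le j,k\le n}$, where $$K_N(z,z')=\sqrt{w_m(z)w_m(\overline{z'})}\sum_{l=0}^{N-1}\prod_{k=1}^m\frac{\Gamma(a_k+1)}{\Gamma(a_k+l+1)}(z\overline{z'})^l,$$ $$w_m(z)=|z|^{2a_m}\frac{2^{m-1}}{\pi}\prod_{k=1}^m\frac1{\Gamma(a_k+1)}\int_{\mathbb{R}_+^{m-1}}\exp\Big\{-\sum_{k=1}^{m-1}r_k^2-\frac{|z|^2}{r_1^2\cdots r_{m-1}^2}\Big\}\prod_{k=1}^{m-1}r_k^{2(a_k-a_m)-1}\,d^{m-1}r$$ (for $m=1$ the integral is read as $e^{-|z|^2}$). Here $\mathrm{erfc}=1-\mathrm{erf}$ is the (entire) complementary error function. *)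

theory Defs
  imports "HOL-Complex_Analysis.Complex_Analysis"
begin

(* The entire function erf z = 2 / sqrt pi * integral of exp (-t^2) from 0 to z, taken along
   the straight segment (the choice of path is irrelevant). *)
definition cerf :: "complex \<Rightarrow> complex" where
  "cerf z = 2 / of_real (sqrt pi) * contour_integral (linepath 0 z) (\<lambda>t. exp (- (t\<^sup>2)))"

definition cerfc :: "complex \<Rightarrow> complex" where
  "cerfc z = 1 - cerf z"

(* The parameters are a 1, ..., a m; other values of a are irrelevant.  The integration variable r
   ranges over (0,\<infinity>)^(m-1), with coordinates indexed by 1, ..., m-1.  For m = 1 the measure
   is the unit point mass on the single function of empty domain, so the integral equals
   exp (- |z|^2).  Pitfall: at z = 0 the library value 0 powr x = 0 applies (also for x = 0);
   the formula is meant for z \<noteq> 0. *)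
definition ginibre_weight :: "nat \<Rightarrow> (nat \<Rightarrow> real) \<Rightarrow> complex \<Rightarrow> real" where
  "ginibre_weight m a z =
     cmod z powr (2 * a m) * (2 ^ (m - 1) / pi) * (\<Prod>k=1..m. 1 / Gamma (a k + 1)) *
     (LINT r : (\<Pi>\<^sub>E k\<in>{1..<m}. {0<..}) | (\<Pi>\<^sub>M k\<in>{1..<m}. lborel).
        exp (- (\<Sum>k=1..<m. (r k)\<^sup>2) - (cmod z)\<^sup>2 / (\<Prod>k=1..<m. (r k)\<^sup>2)) *
        (\<Prod>k=1..<m. r k powr (2 * (a k - a m) - 1)))"

definition ginibre_kernel ::
    "nat \<Rightarrow> (nat \<Rightarrow> real) \<Rightarrow> nat \<Rightarrow> complex \<Rightarrow> complex \<Rightarrow> complex" where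
  "ginibre_kernel m a N z z' =
     of_real (sqrt (ginibre_weight m a z * ginibre_weight m a (cnj z'))) *
     (\<Sum>l<N. of_real (\<Prod>k=1..m. Gamma (a k + 1) / Gamma (a k + real l + 1)) * (z * cnj z') ^ l)"

(* The n-point eigenvalue correlation function of X_m ... X_1 for independent N x N matrices
   X_k with density proportional to det (X_k^* X_k) ^ a_k * exp (- tr (X_k^* X_k)), through its
   explicit determinantal form; n is CARD('n). *)
definition ginibre_corr ::
    "nat \<Rightarrow> (nat \<Rightarrow> real) \<Rightarrow> nat \<Rightarrow> complex ^ 'n \<Rightarrow> complex" where
  "ginibre_corr m a N z = det (\<chi> j k. ginibre_kernel m a N (z $ j) (z $ k))"

definition ginibre_rho :: "nat \<Rightarrow> complex \<Rightarrow> real" where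
  "ginibre_rho m u = 1 / sqrt (real m) * cmod u powr (- (real m - 1) / real m)"

(* N^(n(m-1)) rho^(-2n) R_{N,n}(N^(m/2) z_1, ..., N^(m/2) z_n) with z_k = u + v_k / (rho sqrt N). *)
definition rescaled_corr ::
    "nat \<Rightarrow> (nat \<Rightarrow> real) \<Rightarrow> complex \<Rightarrow> nat \<Rightarrow> complex ^ 'n \<Rightarrow> complex" where
  "rescaled_corr m a u N v =
     of_real (real N ^ (CARD('n) * (m - 1)) * (1 / ginibre_rho m u ^ (2 * CARD('n)))) *
     ginibre_corr m a N
       (\<chi> k. of_real (real N powr (real m / 2)) *
              (u + v $ k / of_real (ginibre_rho m u * sqrt (real N))))"

end

(* The product of the weight with the monomial |z|^(2l), divided by the Gamma factors of the kernel,
   is (up to a Jacobian) the density at log |z|^2 of a sum of m independent logarithms of Gamma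
   variables with parameters a_k + l + 1.  Up to phases, the kernel is therefore a sum over l < N of
   geometric means of two such densities.  A local limit theorem turns each density into a Gaussian
   of width of order sqrt N in l, uniformly dominated because the densities are log-concave in l;
   the sum converges to a Gaussian integral over the whole line in the bulk, and over the half line
   cut off by l < N at the edge.  The remaining phases have the form theta_j - theta_k and cancel in the
   determinant. *)
theory Submission
  imports Defs "HOL-Probability.Probability" "HOL-Real_Asymp.Real_Asymp"
begin

subsection \<open>The logarithm of a Gamma variable\<close>

text \<open>Uniformity on compact sets comes from continuous convergence: it suffices that the
  correlation functions converge along every convergent sequence of points. This is why the limit
  statements let the points move with N and record only what survives of them: the deviation of ln
  |z|^2 from m ln (lam N) and that of the argument from \<open>Arg u\<close>, both of order 1 / sqrt
  N. The number lam = |u|^(2/m) marks the peak of the terms: a product of m Gamma variables of shape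
  about l concentrates near l^m, and |z|^2 is about N^m |u|^2. At the edge lam = 1, so the peak
  meets the last index. The local limit theorem is dominated convergence on explicit unnormalised
  densities, one convolution at a time; Stirling's formula supplies the normalisation and rests on
  the same estimate. Two dominations are needed: in the convolution variable for fixed l, and in l
  for fixed z. One family of phases has frequency lam N and no limit, so it must be removed before N
  tends to infinity; another is left over by completing the square in the Gaussian integral.\<close>

lemma nn_integral_exp_substitution:
  fixes f :: "real \<Rightarrow> ennreal" and c d :: real
  assumes [measurable]: "f \<in> borel_measurable borel" and "c > 0" "d > 0"
  shows "(\<integral>\<^sup>+x. f x * indicator {0<..} x \<partial>lborel) =
         (\<integral>\<^sup>+t. f (c * exp (d * t)) * ennreal (c * d * exp (d * t)) \<partial>lborel)"
proof -
  define g where "g = (\<lambda>t. c * exp (d * t))"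
  define A where "A = (\<lambda>n::nat. {g (- real (Suc n))..g (real (Suc n))})"
  define B where "B = (\<lambda>n::nat. {- real (Suc n)..real (Suc n)})"
  have A_mono: "incseq A"
    using assms by (intro monoI) (auto simp: A_def g_def intro: order_trans)
  have B_mono: "incseq B"
    by (intro monoI) (auto simp: B_def)
  have UA: "(\<Union>n. A n) = {0<..}"
  proof (intro equalityI subsetI)
    fix x assume "x \<in> (\<Union>n. A n)"
    then show "x \<in> {0<..}"
      using assms by (auto simp: A_def g_def elim!: order.strict_trans2[rotated])
  next
    fix x :: real assume x: "x \<in> {0<..}"
    obtain n :: nat where n: "real n > \<bar>ln (x / c) / d\<bar>"
      using reals_Archimedean2 by blast
    have "- real (Suc n) \<le> ln (x / c) / d" "ln (x / c) / d \<le> real (Suc n)"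
      using n unfolding of_nat_Suc by linarith+
    then have "d * - real (Suc n) \<le> ln (x / c)" "ln (x / c) \<le> d * real (Suc n)"
      using assms by (auto simp: field_simps)
    then have "exp (d * - real (Suc n)) \<le> x / c" "x / c \<le> exp (d * real (Suc n))"
      using x assms exp_ln[of "x / c"] by (metis exp_le_cancel_iff divide_pos_pos greaterThan_iff)+
    then have "x \<in> A n"
      using assms by (auto simp: A_def g_def field_simps)
    then show "x \<in> (\<Union>n. A n)" by blast
  qed
  have UB: "(\<Union>n. B n) = UNIV"
  proof -
    have "x \<in> (\<Union>n. B n)" for x :: real
    proof -
      obtain n :: nat where "real n > \<bar>x\<bar>" using reals_Archimedean2 by blast
      then have "x \<in> B n" by (auto simp: B_def)
      then show ?thesis by blast
    qed
    then show ?thesis by blast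
  qed
  \<comment> \<open>The substitution rule is available on compact intervals only; both integrals are
    therefore exhausted by [-(n+1), n+1] and its image, and monotone convergence removes the
    cut-off.\<close>
  have fin: "(\<integral>\<^sup>+x. f x * indicator (A n) x \<partial>lborel) =
      (\<integral>\<^sup>+t. f (g t) * ennreal (c * d * exp (d * t)) * indicator (B n) t \<partial>lborel)" for n
    unfolding A_def B_def
    by (rule nn_integral_substitution_aux)
       (use assms in \<open>auto simp: g_def intro!: derivative_eq_intros continuous_intros\<close>)
  have [measurable]: "g \<in> borel_measurable borel"
    unfolding g_def by measurable
  have [measurable]: "A n \<in> sets borel" "B n \<in> sets borel" for n
    by (auto simp: A_def B_def)
  have SUP_ind: "(SUP n. h * indicator (C n) x) = h * indicator (\<Union>n. C n) x"
    for C :: "nat \<Rightarrow> real set" and h :: ennreal and x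
  proof (rule antisym)
    show "(SUP n. h * indicator (C n) x) \<le> h * indicator (\<Union>n. C n) x"
      by (rule SUP_least) (auto split: split_indicator)
    show "h * indicator (\<Union>n. C n) x \<le> (SUP n. h * indicator (C n) x)"
    proof (cases "x \<in> (\<Union>n. C n)")
      case True
      then obtain n where "x \<in> C n" by blast
      then show ?thesis by (intro SUP_upper2[of n]) (auto split: split_indicator)
    qed auto
  qed
  note 1 = SUP_ind[of _ A, unfolded UA] and 2 = SUP_ind[of _ B, unfolded UB, simplified]
  have mono: "incseq C \<Longrightarrow> incseq (\<lambda>n x. h x * indicator (C n) x :: ennreal)" for C :: "nat \<Rightarrow> real set" and h
    by (auto simp: incseq_def le_fun_def intro!: mult_left_mono split: split_indicator)
  let ?h = "\<lambda>t. f (g t) * ennreal (c * d * exp (d * t))"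
  have "(\<integral>\<^sup>+x. f x * indicator {0<..} x \<partial>lborel) = (\<integral>\<^sup>+x. (SUP n. f x * indicator (A n) x) \<partial>lborel)"
    by (simp only: 1)
  also have "\<dots> = (SUP n. \<integral>\<^sup>+x. f x * indicator (A n) x \<partial>lborel)"
    by (rule nn_integral_monotone_convergence_SUP) (auto intro!: mono A_mono)
  also have "\<dots> = (SUP n. \<integral>\<^sup>+t. ?h t * indicator (B n) t \<partial>lborel)"
    by (simp only: fin)
  also have "\<dots> = (\<integral>\<^sup>+t. (SUP n. ?h t * indicator (B n) t) \<partial>lborel)"
    by (rule nn_integral_monotone_convergence_SUP[symmetric]) (auto intro!: mono B_mono)
  also have "\<dots> = (\<integral>\<^sup>+t. ?h t \<partial>lborel)"
    by (simp only: 2)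
  finally show ?thesis by (simp add: g_def)
qed

text \<open>Up to its normalising constant, the density of \<open>sqrt l * (ln X - ln l)\<close> for a Gamma variable
  \<open>X\<close> with shape parameter \<open>l + a\<close>.\<close>

definition log_gamma_density :: "real \<Rightarrow> real \<Rightarrow> real \<Rightarrow> real" where
  "log_gamma_density a l s =
     exp (a * s / sqrt l - l * (exp (s / sqrt l) - 1 - s / sqrt l))"

lemma log_gamma_density_pos: "log_gamma_density a l s > 0"
  by (simp add: log_gamma_density_def)

lemma borel_measurable_log_gamma_density [measurable]:
  "log_gamma_density a l \<in> borel_measurable borel"
  unfolding log_gamma_density_def by measurable

text \<open>Since exp x - 1 - x is asymptotic to x^2 / 2 at 0, the curvature term tends to s^2 / 2,
  while the tilt a s / sqrt l by the fixed shift vanishes. The argument moves with the index because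
  it becomes S n - t inside a convolution.\<close>

lemma log_gamma_density_tendsto:
  assumes L: "filterlim L at_top F" and S: "(S \<longlongrightarrow> s) F"
  shows "((\<lambda>n. log_gamma_density a (L n) (S n)) \<longlongrightarrow> exp (- s\<^sup>2 / 2)) F"
proof -
  \<comment> \<open>Filling the removable singularity at 0 makes \<open>h\<close> continuous there
    and covers the indices with \<open>S n = 0\<close>.\<close>
  define h where "h = (\<lambda>x::real. if x = 0 then 1/2 else (exp x - 1 - x) / x\<^sup>2)"
  have "((\<lambda>x::real. (exp x - 1 - x) / x\<^sup>2) \<longlongrightarrow> 1/2) (at 0)"
    by real_asymp
  then have "(h \<longlongrightarrow> 1/2) (at 0)"
    by (rule Lim_transform_eventually) (auto simp: eventually_at_filter h_def)
  then have "isCont h 0"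
    by (simp add: isCont_def h_def)
  have sq: "filterlim (\<lambda>n. sqrt (L n)) at_top F"
    by (rule filterlim_compose[OF sqrt_at_top L])
  have q: "((\<lambda>n. S n / sqrt (L n)) \<longlongrightarrow> 0) F"
    by (rule real_tendsto_divide_at_top[OF S sq])
  have "((\<lambda>n. h (S n / sqrt (L n))) \<longlongrightarrow> 1/2) F"
    using isCont_tendsto_compose[OF \<open>isCont h 0\<close> q] by (simp add: h_def)
  then have "((\<lambda>n. exp (a * (S n / sqrt (L n)) - (S n)\<^sup>2 * h (S n / sqrt (L n)))) \<longlongrightarrow> exp (a * 0 - s\<^sup>2 * (1/2))) F"
    by (intro tendsto_intros q S)
  moreover have "\<forall>\<^sub>F n in F. log_gamma_density a (L n) (S n) =
      exp (a * (S n / sqrt (L n)) - (S n)\<^sup>2 * h (S n / sqrt (L n)))"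
    using filterlim_at_top_dense[THEN iffD1, OF L, rule_format, of 0]
  proof eventually_elim
    case (elim n)
    then have "(S n)\<^sup>2 = L n * (S n / sqrt (L n))\<^sup>2"
      by (simp add: power_divide)
    then have "L n * (exp (S n / sqrt (L n)) - 1 - S n / sqrt (L n)) = (S n)\<^sup>2 * h (S n / sqrt (L n))"
      by (simp add: h_def)
    then show ?case by (simp add: log_gamma_density_def)
  qed
  ultimately show ?thesis by (simp add: tendsto_cong)
qed

text \<open>Convexity: the graph of exp x - 1 - x lies above its tangents at 3 / sqrt l and -3 /
  sqrt l, which after scaling have slopes at least 2 in absolute value. Slope 2 is chosen to beat a
  tilt of slope 1 and still leave exponential decay.\<close>

lemma exp_line_bound:
  fixes l s :: real
  assumes "l \<ge> 36"
  shows "l * (exp (s / sqrt l) - 1 - s / sqrt l) \<ge> 2 * (\<bar>s\<bar> - 3)"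
proof -
  define e where "e = sqrt l"
  have e: "e \<ge> 6" "l = e\<^sup>2"
    using assms by (auto simp: e_def intro: real_le_rsqrt)
  have tangent: "exp x \<ge> exp y * (1 + (x - y))" for x y :: real
  proof -
    have "exp (x - y) \<ge> 1 + (x - y)" by (rule exp_ge_add_one_self)
    then have "exp y * exp (x - y) \<ge> exp y * (1 + (x - y))" by simp
    then show ?thesis by (simp flip: exp_add)
  qed
  consider "s \<ge> 3" | "s \<le> - 3" | "\<bar>s\<bar> \<le> 3" by linarith
  then show ?thesis
  proof cases
    case 1
    define d where "d = 3 / e"
    have d: "exp d \<ge> 1 + d" by (rule exp_ge_add_one_self)
    have "exp (s / e) \<ge> exp d * (1 + (s / e - d))" by (rule tangent)
    also have "exp d * (1 + (s / e - d)) \<ge> (1 + d) * (1 + (s / e - d))"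
      using 1 e by (intro mult_right_mono d) (auto simp: d_def field_simps)
    finally have "exp (s / e) - 1 - s / e \<ge> d * (s / e - d)"
      by (simp add: algebra_simps add_divide_distrib)
    then have "e\<^sup>2 * (exp (s / e) - 1 - s / e) \<ge> e\<^sup>2 * (d * (s / e - d))"
      using e by (intro mult_left_mono) auto
    also have "e\<^sup>2 * (d * (s / e - d)) = 3 * (s - 3)"
      using e by (simp add: d_def field_simps power2_eq_square)
    finally show ?thesis using 1 by (simp add: e(2) flip: e_def) (use e in auto)
  next
    case 2
    define d where "d = 3 / e"
    have d0: "d > 0" "d \<le> 1 / 2" using e by (auto simp: d_def field_simps)
    have "exp (- d) \<le> 1 / (1 + d)"
      using exp_ge_add_one_self[of d] d0 by (simp add: exp_minus field_simps)
    \<comment> \<open>For positive \<open>d\<close> this is equivalent to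
      \<open>d \<le> 1 / 2\<close>, which is the origin of the bound 36 for
      \<open>l\<close>.\<close>
    also have "\<dots> \<le> 1 - 2 / 3 * d"
      using d0 by (simp add: field_simps)
    finally have d: "exp (- d) \<le> 1 - 2 / 3 * d" .
    have "exp (s / e) \<ge> exp (- d) * (1 + (s / e + d))" using tangent[of "- d" "s / e"] by simp
    moreover have "exp (- d) \<ge> 1 - d" using exp_ge_add_one_self[of "- d"] by simp
    moreover have "exp (- d) * (s / e + d) \<ge> (1 - 2 / 3 * d) * (s / e + d)"
      using 2 e by (intro mult_right_mono_neg d) (auto simp: d_def field_simps)
    ultimately have "exp (s / e) - 1 - s / e \<ge> - (2 / 3 * d * (s / e + d))"
      by (simp add: algebra_simps add_divide_distrib)
    then have "e\<^sup>2 * (exp (s / e) - 1 - s / e) \<ge> e\<^sup>2 * - (2 / 3 * d * (s / e + d))"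
      using e by (intro mult_left_mono) auto
    also have "e\<^sup>2 * - (2 / 3 * d * (s / e + d)) = 2 * (- s - 3)"
      using e by (simp add: d_def field_simps power2_eq_square)
    finally show ?thesis using 2 by (simp add: e(2) flip: e_def) (use e in auto)
  next
    case 3
    have "exp (s / e) - 1 - s / e \<ge> 0" using exp_ge_add_one_self[of "s / e"] by linarith
    then have "l * (exp (s / e) - 1 - s / e) \<ge> 0"
      using assms by (intro mult_nonneg_nonneg) auto
    then show ?thesis using 3 by (simp add: e_def)
  qed
qed

text \<open>The bound \<open>l \<ge> a\<^sup>2\<close> keeps the tilt below |s|, which uses up half
  of the slope 2 in \<open>exp_line_bound\<close>; the constant 6 is 2 times the offset 3
  there.\<close>

lemma log_gamma_density_le:
  assumes "l \<ge> 36" "l \<ge> a\<^sup>2"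
  shows "log_gamma_density a l s \<le> exp 6 * exp (- \<bar>s\<bar>)"
proof -
  have "\<bar>a\<bar> \<le> sqrt l" using assms(2) real_le_rsqrt[of "\<bar>a\<bar>" l] by simp
  then have "\<bar>a / sqrt l\<bar> \<le> 1" using assms by (simp add: field_simps)
  then have "\<bar>(a / sqrt l) * s\<bar> \<le> 1 * \<bar>s\<bar>" unfolding abs_mult by (intro mult_right_mono) auto
  then have "(a / sqrt l) * s \<le> \<bar>s\<bar>" by linarith
  then have "a * s / sqrt l \<le> \<bar>s\<bar>" by simp
  with exp_line_bound[OF assms(1), of s] show ?thesis
    unfolding log_gamma_density_def exp_add[symmetric] by simp
qed

text \<open>Up to normalisation, the density of a sum of j + 1 independent rescaled logarithms of
  Gamma variables. The parameter \<open>b\<close> belongs to the factor that is determined by |z|^2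
  and the integration variables of the weight; the others are integrated one by one. Values in
  \<open>ennreal\<close> let the convolutions be formed before any finiteness is known.\<close>

primrec log_gamma_conv :: "(nat \<Rightarrow> real) \<Rightarrow> real \<Rightarrow> real \<Rightarrow> nat \<Rightarrow> real \<Rightarrow> ennreal" where
  "log_gamma_conv a b l 0 = (\<lambda>s. ennreal (log_gamma_density b l s))"
| "log_gamma_conv a b l (Suc j) = (\<lambda>s. \<integral>\<^sup>+t. log_gamma_conv a b l j (s - t) *
     ennreal (log_gamma_density (a (Suc j)) l t) \<partial>lborel)"

lemma borel_measurable_log_gamma_conv [measurable]:
  "log_gamma_conv a b l j \<in> borel_measurable borel"
proof (induction j)
  case (Suc j)
  note [measurable] = Suc
  show ?case by simp
qed simp

lemma nn_integral_exp_abs: "(\<integral>\<^sup>+t. ennreal (exp (- \<bar>t::real\<bar>)) \<partial>lborel) < \<infinity>"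
proof -
  have "(\<integral>\<^sup>+t. ennreal (exp (- \<bar>t::real\<bar>)) \<partial>lborel) \<le>
    (\<integral>\<^sup>+t. ennreal (exp (- t)) * indicator {0..} t + ennreal (exp t) * indicator {..0} t \<partial>lborel)"
    by (intro nn_integral_mono) (auto split: split_indicator)
  also have "\<dots> = (\<integral>\<^sup>+t. ennreal (exp (- t)) * indicator {0..} t \<partial>lborel) + (\<integral>\<^sup>+t. ennreal (exp t) * indicator {..0} t \<partial>lborel)"
    by (intro nn_integral_add) auto
  also have "(\<integral>\<^sup>+t. ennreal (exp t) * indicator {..0} t \<partial>lborel) = (\<integral>\<^sup>+t. ennreal (exp (- t)) * indicator {0..} t \<partial>lborel)"
    by (subst nn_integral_real_affine[where c = "-1" and t = 0])
       (auto intro!: nn_integral_cong split: split_indicator)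
  also have "(\<integral>\<^sup>+t. ennreal (exp (- t)) * indicator {0..} t \<partial>lborel) = ennreal (0 - (- exp (- 0)))"
  proof (intro nn_integral_FTC_atLeast)
    show "((\<lambda>t::real. - exp (- t)) \<longlongrightarrow> 0) at_top" by real_asymp
  qed (auto intro!: derivative_eq_intros)
  also have "ennreal (0 - (- exp (- 0))) + ennreal (0 - (- exp (- 0))) < \<infinity>"
    by (simp add: ennreal_add_less_top)
  finally show ?thesis .
qed

text \<open>A bound uniform in s is preserved under convolution: it is multiplied by the total mass
  of the majorant exp (6 - |t|). It serves as one half of the majorant in the next limit, whose
  other half is the decay of the new factor.\<close>

lemma log_gamma_conv_bounded:
  "\<exists>C<\<infinity>. \<forall>\<^sub>F l in at_top. \<forall>s. log_gamma_conv a b l j s \<le> C"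
proof (induction j)
  case 0
  show ?case
  proof (intro exI conjI)
    show "\<forall>\<^sub>F l in at_top. \<forall>s. log_gamma_conv a b l 0 s \<le> ennreal (exp 6)"
      using eventually_ge_at_top[of 36] eventually_ge_at_top[of "b\<^sup>2"]
    proof eventually_elim
      case (elim l)
      have "log_gamma_density b l s \<le> exp 6" for s
        using log_gamma_density_le[OF elim, of s] by (rule order_trans) auto
      then show ?case by simp
    qed
  qed simp
next
  case (Suc j)
  then obtain C where C: "C < \<infinity>" "\<forall>\<^sub>F l in at_top. \<forall>s. log_gamma_conv a b l j s \<le> C" by blast
  let ?I = "\<integral>\<^sup>+t. ennreal (exp 6) * ennreal (exp (- \<bar>t::real\<bar>)) \<partial>lborel"
  have "?I < \<infinity>"
    using nn_integral_exp_abs by (simp add: nn_integral_cmult ennreal_mult_less_top)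
  show ?case
  proof (intro exI conjI)
    show "C * ?I < \<infinity>" using C \<open>?I < \<infinity>\<close> by (simp add: ennreal_mult_less_top)
    show "\<forall>\<^sub>F l in at_top. \<forall>s. log_gamma_conv a b l (Suc j) s \<le> C * ?I"
      using C(2) eventually_ge_at_top[of 36] eventually_ge_at_top[of "(a (Suc j))\<^sup>2"]
    proof eventually_elim
      case (elim l)
      show ?case
      proof
        fix s
        have q: "ennreal (log_gamma_density (a (Suc j)) l t) \<le> ennreal (exp 6) * ennreal (exp (- \<bar>t\<bar>))" for t
          using log_gamma_density_le[OF elim(2,3), of t] by (simp flip: ennreal_mult)
        have "log_gamma_conv a b l (Suc j) s \<le> (\<integral>\<^sup>+t. C * (ennreal (exp 6) * ennreal (exp (- \<bar>t::real\<bar>))) \<partial>lborel)"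
          unfolding log_gamma_conv.simps
          by (intro nn_integral_mono mult_mono q elim(1)[rule_format]) auto
        also have "\<dots> = C * ?I" by (rule nn_integral_cmult) simp
        finally show "log_gamma_conv a b l (Suc j) s \<le> C * ?I" .
      qed
    qed
  qed
qed

text \<open>The local limit theorem, by dominated convergence in each convolution; normal densities
  convolve by adding variances, and every unnormalised factor contributes sqrt (2 pi). The induction
  needs arbitrary convergent arguments, since the inner density is evaluated at
  \<open>S n - t\<close>.\<close>

lemma log_gamma_conv_tendsto:
  fixes L :: "nat \<Rightarrow> real"
  assumes L: "filterlim L at_top sequentially" and S: "S \<longlonglongrightarrow> s"
  shows "(\<lambda>n. log_gamma_conv a b (L n) j (S n)) \<longlonglongrightarrow>
    ennreal (sqrt (2 * pi) ^ (j + 1) * normal_density 0 (sqrt (real j + 1)) s)"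
  using S
proof (induction j arbitrary: S s)
  case 0
  have "sqrt (2 * pi) * normal_density 0 1 s = exp (- s\<^sup>2 / 2)"
    by (simp add: normal_density_def)
  then show ?case
    using log_gamma_density_tendsto[OF L 0, of b] by (simp add: tendsto_ennrealI)
next
  case (Suc j)
  obtain C where C: "C < \<infinity>" "\<forall>\<^sub>F l in at_top. \<forall>s. log_gamma_conv a b l j s \<le> C"
    using log_gamma_conv_bounded by blast
  let ?G = "\<lambda>j s. ennreal (sqrt (2 * pi) ^ (j + 1) * normal_density 0 (sqrt (real j + 1)) s)"
  let ?q = "\<lambda>n t. ennreal (log_gamma_density (a (Suc j)) (L n) t)"
  let ?w = "\<lambda>t. C * (ennreal (exp 6) * ennreal (exp (- \<bar>t::real\<bar>)))"
  have "\<forall>\<^sub>F n in sequentially. (\<forall>s. log_gamma_conv a b (L n) j s \<le> C) \<and> (\<forall>t. ?q n t \<le> ennreal (exp 6) * ennreal (exp (- \<bar>t::real\<bar>)))"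
    using L[THEN filterlim_iff[THEN iffD1], rule_format, OF C(2)]
      filterlim_at_top[THEN iffD1, OF L, rule_format, of 36]
      filterlim_at_top[THEN iffD1, OF L, rule_format, of "(a (Suc j))\<^sup>2"]
    by eventually_elim (simp add: log_gamma_density_le flip: ennreal_mult)
  then obtain n0 where n0: "\<And>n. n \<ge> n0 \<Longrightarrow> (\<forall>s. log_gamma_conv a b (L n) j s \<le> C) \<and> (\<forall>t. ?q n t \<le> ennreal (exp 6) * ennreal (exp (- \<bar>t::real\<bar>)))"
    unfolding eventually_sequentially by blast
  \<comment> \<open>The majorant holds only from \<open>n0\<close> on, so the sequence is shifted;
    \<open>LIMSEQ_offset\<close> undoes the shift afterwards.\<close>
  have "(\<lambda>n. \<integral>\<^sup>+t. log_gamma_conv a b (L (n + n0)) j (S (n + n0) - t) * ?q (n + n0) t \<partial>lborel)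
    \<longlonglongrightarrow> (\<integral>\<^sup>+t. ?G j (s - t) * ennreal (exp (- t\<^sup>2 / 2)) \<partial>lborel)"
  proof (rule nn_integral_dominated_convergence[where w = ?w])
    show "AE t in lborel. log_gamma_conv a b (L (n + n0)) j (S (n + n0) - t) * ?q (n + n0) t \<le> ?w t" for n
      using n0[of "n + n0"] by (auto intro!: mult_mono)
    show "(\<integral>\<^sup>+t. ?w t \<partial>lborel) < \<infinity>"
      using nn_integral_exp_abs C(1) by (simp add: nn_integral_cmult ennreal_mult_less_top)
    show "AE t in lborel. (\<lambda>n. log_gamma_conv a b (L (n + n0)) j (S (n + n0) - t) * ?q (n + n0) t)
       \<longlonglongrightarrow> ?G j (s - t) * ennreal (exp (- t\<^sup>2 / 2))"
    proof (intro AE_I2)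
      fix t :: real
      have "(\<lambda>n. log_gamma_conv a b (L n) j (S n - t)) \<longlonglongrightarrow> ?G j (s - t)"
        by (intro Suc.IH tendsto_intros Suc.prems)
      moreover have "(\<lambda>n. ?q n t) \<longlonglongrightarrow> ennreal (exp (- t\<^sup>2 / 2))"
        by (intro tendsto_ennrealI log_gamma_density_tendsto L tendsto_const)
      ultimately have "(\<lambda>n. log_gamma_conv a b (L n) j (S n - t) * ?q n t) \<longlonglongrightarrow> ?G j (s - t) * ennreal (exp (- t\<^sup>2 / 2))"
        by (intro tendsto_mult_ennreal) auto
      then show "(\<lambda>n. log_gamma_conv a b (L (n + n0)) j (S (n + n0) - t) * ?q (n + n0) t)
         \<longlonglongrightarrow> ?G j (s - t) * ennreal (exp (- t\<^sup>2 / 2))"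
        by (rule LIMSEQ_ignore_initial_segment)
    qed
  qed auto
  then have "(\<lambda>n. log_gamma_conv a b (L n) (Suc j) (S n)) \<longlonglongrightarrow> (\<integral>\<^sup>+t. ?G j (s - t) * ennreal (exp (- t\<^sup>2 / 2)) \<partial>lborel)"
    by (simp add: LIMSEQ_offset[of _ n0])
  also have "(\<integral>\<^sup>+t. ?G j (s - t) * ennreal (exp (- t\<^sup>2 / 2)) \<partial>lborel) =
    (\<integral>\<^sup>+t. ennreal (sqrt (2 * pi) ^ (j + 2)) * ennreal (normal_density 0 (sqrt (real j + 1)) (s - t) * normal_density 0 1 t) \<partial>lborel)"
    by (intro nn_integral_cong)
       (simp add: ennreal_mult[symmetric] normal_density_nonneg, simp add: normal_density_def field_simps)
  also have "\<dots> = ennreal (sqrt (2 * pi) ^ (j + 2)) * (\<integral>\<^sup>+t. ennreal (normal_density 0 (sqrt (real j + 1)) (s - t) * normal_density 0 1 t) \<partial>lborel)"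
    by (rule nn_integral_cmult) simp
  also have "(\<integral>\<^sup>+t. ennreal (normal_density 0 (sqrt (real j + 1)) (s - t) * normal_density 0 1 t) \<partial>lborel) =
     ennreal (normal_density 0 (sqrt ((sqrt (real j + 1))\<^sup>2 + 1\<^sup>2)) s)"
    by (rule fun_cong[OF conv_normal_density_zero_mean]) auto
  finally show ?case
    by (simp add: ennreal_mult[symmetric] normal_density_nonneg add_ac)
qed

lemma log_gamma_density_eq:
  "log_gamma_density a l t =
     exp l * exp ((a + l) * (t / sqrt l)) * exp (- (l * exp (t / sqrt l)))"
proof -
  define u where "u = t / sqrt l"
  have "a * t / sqrt l = a * u" by (simp add: u_def)
  then show ?thesis
    unfolding log_gamma_density_def exp_add[symmetric] u_def[symmetric]
    by (simp add: algebra_simps)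
qed

text \<open>The substitution x = l exp (t / sqrt l) in Euler's integral centres the integrand at its
  peak on the Gaussian scale. Its Jacobian contributes a further factor exp (t / sqrt l), which
  raises the shift from \<open>a\<close> to \<open>a + 1\<close>.\<close>

lemma Gamma_log_gamma:
  assumes "l > 0" "a + l + 1 > 0"
  shows "ennreal (Gamma (a + l + 1)) = ennreal (l powr (a + l + 1 / 2) * exp (- l)) *
    (\<integral>\<^sup>+t. ennreal (log_gamma_density (a + 1) l t) \<partial>lborel)"
proof -
  have "ennreal (Gamma (a + l + 1)) = (\<integral>\<^sup>+x. ennreal (x powr (a + l) * exp (- x)) * indicator {0<..} x \<partial>lborel)"
  proof -
    have "((\<lambda>t. t powr (a + l + 1 - 1) / exp t) has_integral Gamma (a + l + 1)) {0..}"
      by (rule Gamma_integral_real) (use assms in simp)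
    then have "(\<integral>\<^sup>+x. ennreal (x powr (a + l) / exp x) * indicator {0..} x \<partial>lborel) = ennreal (Gamma (a + l + 1))"
      by (intro nn_integral_has_integral_lebesgue') auto
    also have "(\<integral>\<^sup>+x. ennreal (x powr (a + l) / exp x) * indicator {0..} x \<partial>lborel) =
       (\<integral>\<^sup>+x. ennreal (x powr (a + l) * exp (- x)) * indicator {0<..} x \<partial>lborel)"
      by (intro nn_integral_cong_AE AE_I[where N = "{0}"])
         (auto split: split_indicator simp: exp_minus field_simps)
    finally show ?thesis by simp
  qed
  also have "\<dots> = (\<integral>\<^sup>+t. ennreal ((l * exp ((1 / sqrt l) * t)) powr (a + l) * exp (- (l * exp ((1 / sqrt l) * t)))) *
     ennreal (l * (1 / sqrt l) * exp ((1 / sqrt l) * t)) \<partial>lborel)"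
    using assms by (intro nn_integral_exp_substitution) auto
  also have "\<dots> = (\<integral>\<^sup>+t. ennreal (l powr (a + l + 1 / 2) * exp (- l)) * ennreal (log_gamma_density (a + 1) l t) \<partial>lborel)"
  proof (intro nn_integral_cong)
    fix t :: real
    have "(l * exp (t / sqrt l)) powr (a + l) * exp (- (l * exp (t / sqrt l))) * (l * (1 / sqrt l) * exp (t / sqrt l)) =
       l powr (a + l + 1 / 2) * exp (- l) * log_gamma_density (a + 1) l t"
    proof -
      have "(l * exp (t / sqrt l)) powr (a + l) = l powr (a + l) * exp ((a + l) * (t / sqrt l))"
        using assms by (simp add: powr_def ln_mult algebra_simps flip: exp_add)
      moreover have "l * (1 / sqrt l) = l powr (1 / 2)"
        using assms by (simp add: powr_half_sqrt real_div_sqrt)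
      moreover have "log_gamma_density (a + 1) l t =
          exp l * (exp ((a + l) * (t / sqrt l)) * exp (t / sqrt l)) * exp (- (l * exp (t / sqrt l)))"
        unfolding log_gamma_density_eq exp_add[symmetric]
        by (rule arg_cong[where f = exp]) (simp add: algebra_simps add_divide_distrib)
      moreover have "exp (- l) * exp l = 1"
        by (simp flip: exp_add)
      ultimately show ?thesis
        unfolding powr_add by algebra
    qed
    then show "ennreal ((l * exp ((1 / sqrt l) * t)) powr (a + l) * exp (- (l * exp ((1 / sqrt l) * t)))) *
     ennreal (l * (1 / sqrt l) * exp ((1 / sqrt l) * t)) = ennreal (l powr (a + l + 1 / 2) * exp (- l)) * ennreal (log_gamma_density (a + 1) l t)"
      using assms log_gamma_density_pos[of "a + 1" l t] by (simp add: ennreal_mult[symmetric])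
  qed
  also have "\<dots> = ennreal (l powr (a + l + 1 / 2) * exp (- l)) * (\<integral>\<^sup>+t. ennreal (log_gamma_density (a + 1) l t) \<partial>lborel)"
    by (rule nn_integral_cmult) simp
  finally show ?thesis .
qed

text \<open>Stirling's formula by Laplace's method, with the majorant already used for the
  convolutions. The power of l is left with the shift \<open>a\<close> in it because the weight
  integral produces the same powers, so that they cancel exactly.\<close>

lemma Gamma_asymptotic:
  fixes L :: "nat \<Rightarrow> real"
  assumes L: "filterlim L at_top sequentially"
  shows "(\<lambda>n. Gamma (a + L n + 1) / (L n powr (a + L n + 1 / 2) * exp (- L n))) \<longlonglongrightarrow> sqrt (2 * pi)"
proof -
  let ?q = "\<lambda>n t. ennreal (log_gamma_density (a + 1) (L n) t)"
  let ?w = "\<lambda>t. ennreal (exp 6) * ennreal (exp (- \<bar>t::real\<bar>))"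
  have "\<forall>\<^sub>F n in sequentially. (\<forall>t. ?q n t \<le> ?w t)"
    using filterlim_at_top[THEN iffD1, OF L, rule_format, of 36]
      filterlim_at_top[THEN iffD1, OF L, rule_format, of "(a + 1)\<^sup>2"]
    by eventually_elim (simp add: log_gamma_density_le flip: ennreal_mult)
  then obtain n0 where n0: "\<And>n. n \<ge> n0 \<Longrightarrow> \<forall>t. ?q n t \<le> ?w t"
    unfolding eventually_sequentially by blast
  have "(\<lambda>n. \<integral>\<^sup>+t. ?q (n + n0) t \<partial>lborel) \<longlonglongrightarrow> (\<integral>\<^sup>+t. ennreal (exp (- t\<^sup>2 / 2)) \<partial>lborel)"
  proof (rule nn_integral_dominated_convergence[where w = ?w])
    show "AE t in lborel. ?q (n + n0) t \<le> ?w t" for n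
      using n0[of "n + n0"] by auto
    show "(\<integral>\<^sup>+t. ?w t \<partial>lborel) < \<infinity>"
      using nn_integral_exp_abs by (simp add: nn_integral_cmult ennreal_mult_less_top)
    show "AE t in lborel. (\<lambda>n. ?q (n + n0) t) \<longlonglongrightarrow> ennreal (exp (- t\<^sup>2 / 2))"
      using LIMSEQ_ignore_initial_segment[OF tendsto_ennrealI[OF log_gamma_density_tendsto[OF L tendsto_const]]]
      by (intro AE_I2)
  qed auto
  then have 1: "(\<lambda>n. \<integral>\<^sup>+t. ?q n t \<partial>lborel) \<longlonglongrightarrow> (\<integral>\<^sup>+t. ennreal (exp (- t\<^sup>2 / 2)) \<partial>lborel)"
    by (rule LIMSEQ_offset)
  have "(\<integral>\<^sup>+t. ennreal (exp (- t\<^sup>2 / 2)) \<partial>lborel) = (\<integral>\<^sup>+t. ennreal (sqrt (2 * pi)) * ennreal (normal_density 0 1 t) \<partial>lborel)"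
    by (intro nn_integral_cong) (simp add: normal_density_def flip: ennreal_mult)
  also have "\<dots> = ennreal (sqrt (2 * pi)) * (\<integral>\<^sup>+t. ennreal (normal_density 0 1 t) \<partial>lborel)"
    by (rule nn_integral_cmult) simp
  also have "(\<integral>\<^sup>+t. ennreal (normal_density 0 1 t) \<partial>lborel) = 1"
    by (subst nn_integral_eq_integral) auto
  finally have 2: "(\<integral>\<^sup>+t. ennreal (exp (- t\<^sup>2 / 2)) \<partial>lborel) = ennreal (sqrt (2 * pi))" by simp
  have ev: "\<forall>\<^sub>F n in sequentially. ennreal (Gamma (a + L n + 1) / (L n powr (a + L n + 1 / 2) * exp (- L n))) = (\<integral>\<^sup>+t. ?q n t \<partial>lborel) \<and> Gamma (a + L n + 1) > 0"
    using filterlim_at_top_dense[THEN iffD1, OF L, rule_format, of 0]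
      filterlim_at_top_dense[THEN iffD1, OF L, rule_format, of "- a"]
  proof eventually_elim
    case (elim n)
    define D where "D = L n powr (a + L n + 1 / 2) * exp (- L n)"
    have "D > 0" using elim by (simp add: D_def)
    have pos: "Gamma (a + L n + 1) > 0" using elim by (intro Gamma_real_pos) auto
    have "ennreal (Gamma (a + L n + 1)) = ennreal D * (\<integral>\<^sup>+t. ?q n t \<partial>lborel)"
      unfolding D_def by (rule Gamma_log_gamma) (use elim in auto)
    then have "ennreal (1 / D) * ennreal (Gamma (a + L n + 1)) = (ennreal (1 / D) * ennreal D) * (\<integral>\<^sup>+t. ?q n t \<partial>lborel)"
      by (simp add: mult.assoc)
    also have "ennreal (1 / D) * ennreal D = 1" using \<open>D > 0\<close> by (simp flip: ennreal_mult)
    finally show ?case using \<open>D > 0\<close> pos by (simp flip: ennreal_mult D_def)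
  qed
  have "(\<lambda>n. ennreal (Gamma (a + L n + 1) / (L n powr (a + L n + 1 / 2) * exp (- L n)))) \<longlonglongrightarrow> ennreal (sqrt (2 * pi))"
    by (rule Lim_transform_eventually[OF 1[unfolded 2]]) (use ev in \<open>auto elim: eventually_mono\<close>)
  then show ?thesis
    by (subst (asm) tendsto_ennreal_iff) (use ev in \<open>auto elim!: eventually_mono\<close>)
qed

subsection \<open>The weight function\<close>

text \<open>The integrand of the weight at \<open>\<bar>z\<bar>\<^sup>2 = x\<close>, with the factors \<open>x powr b\<close> and \<open>x powr l\<close> absorbed;
  in this form the variables \<open>r k\<close> can be integrated out one at a time.\<close>

definition weight_integrand :: "(nat \<Rightarrow> real) \<Rightarrow> real \<Rightarrow> real \<Rightarrow> nat \<Rightarrow> real \<Rightarrow> (nat \<Rightarrow> real) \<Rightarrow> real" where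
  "weight_integrand a b l j x r =
     (x / (\<Prod>k=1..<Suc j. (r k)\<^sup>2)) powr (l + b) * exp (- (x / (\<Prod>k=1..<Suc j. (r k)\<^sup>2))) *
     (\<Prod>k=1..<Suc j. 2 * r k powr (2 * (l + a k) - 1) * exp (- (r k)\<^sup>2) * indicator {0<..} (r k))"

lemma weight_integrand_nonneg: "weight_integrand a b l j x r \<ge> 0"
  unfolding weight_integrand_def by (intro mult_nonneg_nonneg prod_nonneg) auto

lemma borel_measurable_weight_integrand [measurable]:
  "weight_integrand a b l j x \<in> borel_measurable (\<Pi>\<^sub>M k\<in>{1..<Suc j}. lborel)"
  unfolding weight_integrand_def by measurable

lemma borel_measurable_weight_integrand2 [measurable]:
  "(\<lambda>(y, r). weight_integrand a b l j (x / y\<^sup>2) r) \<in>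
     borel_measurable (lborel \<Otimes>\<^sub>M (\<Pi>\<^sub>M k\<in>{1..<Suc j}. lborel))"
  unfolding weight_integrand_def by measurable

text \<open>The last variable enters only through its own factor and through x / y^2, so integrating
  it out is a multiplicative convolution; in logarithmic coordinates this is the recursion of
  \<open>log_gamma_conv\<close>.\<close>

lemma weight_integrand_Suc:
  "weight_integrand a b l (Suc j) x (r(Suc j := y)) = weight_integrand a b l j (x / y\<^sup>2) r *
     (2 * y powr (2 * (l + a (Suc j)) - 1) * exp (- y\<^sup>2) * indicator {0<..} y)"
proof -
  have eq: "{1..<Suc (Suc j)} = insert (Suc j) {1..<Suc j}" by auto
  have [simp]: "(\<Prod>k=1..<Suc j. g (if k = Suc j then y else r k) k) = (\<Prod>k=1..<Suc j. g (r k) k)"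
    for g :: "real \<Rightarrow> nat \<Rightarrow> real"
    by (intro prod.cong) auto
  have 1: "(\<Prod>k=1..<Suc (Suc j). ((r(Suc j := y)) k)\<^sup>2) = y\<^sup>2 * (\<Prod>k=1..<Suc j. (r k)\<^sup>2)"
    unfolding eq by (subst prod.insert) (auto simp: fun_upd_def)
  have 2: "(\<Prod>k=1..<Suc (Suc j). 2 * (r(Suc j := y)) k powr (2 * (l + a k) - 1) * exp (- ((r(Suc j := y)) k)\<^sup>2) *
      indicator {0<..} ((r(Suc j := y)) k)) = (2 * y powr (2 * (l + a (Suc j)) - 1) * exp (- y\<^sup>2) * indicator {0<..} y) *
      (\<Prod>k=1..<Suc j. 2 * r k powr (2 * (l + a k) - 1) * exp (- (r k)\<^sup>2) * indicator {0<..} (r k))"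
    unfolding eq by (subst prod.insert) (auto simp: fun_upd_def intro!: prod.cong)
  show ?thesis
    unfolding weight_integrand_def 1 2 by (simp add: mult_ac)
qed

lemma nn_integral_weight_integrand:
  assumes l: "l > 0"
  shows "(\<integral>\<^sup>+r. ennreal (weight_integrand a b l j (l ^ (j + 1) * exp (s / sqrt l)) r) \<partial>(\<Pi>\<^sub>M k\<in>{1..<Suc j}. lborel)) =
    ennreal (l powr (l + b) * exp (- l) * (\<Prod>k=1..<Suc j. l powr (l + a k - 1 / 2) * exp (- l))) *
    log_gamma_conv a b l j s"
proof (induction j arbitrary: s)
  case 0
  interpret product_sigma_finite "\<lambda>_::nat. lborel :: real measure" by standard
  have "(l * exp (s / sqrt l)) powr (l + b) = l powr (l + b) * exp ((b + l) * (s / sqrt l))"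
    using l by (simp add: powr_def ln_mult ring_distribs exp_add algebra_simps)
  moreover have "exp (- l) * exp l = 1" by (simp flip: exp_add)
  ultimately have "(l * exp (s / sqrt l)) powr (l + b) * exp (- (l * exp (s / sqrt l))) =
      l powr (l + b) * exp (- l) * log_gamma_density b l s"
    unfolding log_gamma_density_eq by algebra
  then show ?case
    \<comment> \<open>With no integration variables the product measure is the unit point
      mass.\<close>
    by (simp add: space_PiM_empty emeasure_PiM_empty weight_integrand_def log_gamma_density_pos less_imp_le ennreal_mult)
next
  case (Suc j)
  interpret product_sigma_finite "\<lambda>_::nat. lborel :: real measure" by standard
  define x where "x = l ^ (j + 2) * exp (s / sqrt l)"
  define C where "C = l powr (l + b) * exp (- l) * (\<Prod>k=1..<Suc j. l powr (l + a k - 1 / 2) * exp (- l))"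
  define h where "h = (\<lambda>y. 2 * y powr (2 * (l + a (Suc j)) - 1) * exp (- y\<^sup>2))"
  \<comment> \<open>With this substitution y^2 = l exp (t / sqrt l), so dividing x by y^2 removes
    one factor l and replaces s by s - t. The exponent carries 2 sqrt l since y, not y^2, is the
    variable of integration.\<close>
  define g where "g = (\<lambda>t. sqrt l * exp ((1 / (2 * sqrt l)) * t))"
  define M where "M = (\<Pi>\<^sub>M k\<in>{1..<Suc j}. lborel :: real measure)"
  interpret M: sigma_finite_measure M
    unfolding M_def by (intro sigma_finite) auto
  have [measurable]: "(\<lambda>(y, r). weight_integrand a b l j (x / y\<^sup>2) r) \<in> borel_measurable (lborel \<Otimes>\<^sub>M M)"
    unfolding M_def by measurable
  have [measurable]: "weight_integrand a b l j x' \<in> borel_measurable M" for x'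
    unfolding M_def by measurable
  have [measurable]: "h \<in> borel_measurable borel"
    unfolding h_def by measurable
  have h0: "h y \<ge> 0" for y by (auto simp: h_def)
  have C0: "C \<ge> 0" unfolding C_def by (auto intro!: mult_nonneg_nonneg prod_nonneg)
  have eq: "{1..<Suc (Suc j)} = insert (Suc j) {1..<Suc j}" by auto
  have "(\<integral>\<^sup>+r. ennreal (weight_integrand a b l (Suc j) x r) \<partial>(\<Pi>\<^sub>M k\<in>{1..<Suc (Suc j)}. lborel)) =
      (\<integral>\<^sup>+y. (\<integral>\<^sup>+r. ennreal (weight_integrand a b l (Suc j) x (r(Suc j := y))) \<partial>M) \<partial>lborel)"
    unfolding eq M_def
  proof (rule product_nn_integral_insert_rev)
    show "(\<lambda>r. ennreal (weight_integrand a b l (Suc j) x r))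
        \<in> borel_measurable (Pi\<^sub>M (insert (Suc j) {1..<Suc j}) (\<lambda>_. lborel))"
      unfolding eq[symmetric] by measurable
  qed auto
  also have "\<dots> = (\<integral>\<^sup>+y. (\<integral>\<^sup>+r. ennreal (weight_integrand a b l j (x / y\<^sup>2) r) \<partial>M) * ennreal (h y) * indicator {0<..} y \<partial>lborel)"
  proof (intro nn_integral_cong)
    fix y :: real
    have "(\<integral>\<^sup>+r. ennreal (weight_integrand a b l (Suc j) x (r(Suc j := y))) \<partial>M) =
       (\<integral>\<^sup>+r. ennreal (weight_integrand a b l j (x / y\<^sup>2) r) * ennreal (h y * indicator {0<..} y) \<partial>M)"
      by (intro nn_integral_cong)
        (simp add: weight_integrand_Suc h_def weight_integrand_nonneg ennreal_mult mult_ac)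
    also have "\<dots> = (\<integral>\<^sup>+r. ennreal (weight_integrand a b l j (x / y\<^sup>2) r) \<partial>M) * ennreal (h y * indicator {0<..} y)"
      by (rule nn_integral_multc) simp
    finally show "(\<integral>\<^sup>+r. ennreal (weight_integrand a b l (Suc j) x (r(Suc j := y))) \<partial>M) =
        (\<integral>\<^sup>+r. ennreal (weight_integrand a b l j (x / y\<^sup>2) r) \<partial>M) * ennreal (h y) * indicator {0<..} y"
      by (auto split: split_indicator)
  qed
  also have "\<dots> = (\<integral>\<^sup>+t. (\<integral>\<^sup>+r. ennreal (weight_integrand a b l j (x / (g t)\<^sup>2) r) \<partial>M) * ennreal (h (g t)) *
      ennreal (sqrt l * (1 / (2 * sqrt l)) * exp ((1 / (2 * sqrt l)) * t)) \<partial>lborel)"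
    unfolding g_def by (intro nn_integral_exp_substitution) (use l in auto)
  also have "\<dots> = (\<integral>\<^sup>+t. ennreal (C * (l powr (l + a (Suc j) - 1 / 2) * exp (- l))) *
      (log_gamma_conv a b l j (s - t) * ennreal (log_gamma_density (a (Suc j)) l t)) \<partial>lborel)"
  proof (intro nn_integral_cong)
    fix t :: real
    define A where "A = l + a (Suc j)"
    have gpos: "g t > 0" using l by (simp add: g_def)
    have g2: "(g t)\<^sup>2 = l * exp (t / sqrt l)"
      using l by (simp add: g_def power_mult_distrib exp_double[symmetric])
    have "x / (g t)\<^sup>2 = l ^ (j + 1) * exp ((s - t) / sqrt l)"
      using l by (simp add: x_def g2 diff_divide_distrib exp_diff)
    then have 1: "(\<integral>\<^sup>+r. ennreal (weight_integrand a b l j (x / (g t)\<^sup>2) r) \<partial>M) = ennreal C * log_gamma_conv a b l j (s - t)"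
      using Suc.IH[of "s - t"] by (simp add: M_def C_def)
    have g': "sqrt l * (1 / (2 * sqrt l)) * exp ((1 / (2 * sqrt l)) * t) = g t / (2 * sqrt l)"
      using l by (simp add: g_def)
    have "(g t) powr (2 * A - 1) * g t = ((g t)\<^sup>2) powr A"
      using gpos by (simp add: powr_diff powr_powr flip: powr_numeral)
    also have "\<dots> = l powr A * exp ((a (Suc j) + l) * (t / sqrt l))"
      using l unfolding g2 by (simp add: powr_def ln_mult ring_distribs exp_add A_def algebra_simps)
    finally have gA: "(g t) powr (2 * A - 1) * g t = l powr A * exp ((a (Suc j) + l) * (t / sqrt l))" .
    have lA: "l powr (A - 1 / 2) * sqrt l = l powr A"
      using l by (simp add: powr_half_sqrt[symmetric] flip: powr_add)
    have e1: "exp (- l) * exp l = 1" by (simp flip: exp_add)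
    have "h (g t) * (g t / (2 * sqrt l)) = ((g t) powr (2 * A - 1) * g t) * exp (- (l * exp (t / sqrt l))) / sqrt l"
      by (simp add: h_def g2 A_def)
    also have "\<dots> = (l powr (A - 1 / 2) * sqrt l / sqrt l) * exp ((a (Suc j) + l) * (t / sqrt l)) * exp (- (l * exp (t / sqrt l)))"
      unfolding gA lA by simp
    also have "\<dots> = l powr (A - 1 / 2) * exp ((a (Suc j) + l) * (t / sqrt l)) * exp (- (l * exp (t / sqrt l)))"
      using l by simp
    also have "\<dots> = l powr (A - 1 / 2) * exp (- l) * log_gamma_density (a (Suc j)) l t"
      unfolding log_gamma_density_eq using e1 by algebra
    finally have 2: "ennreal (h (g t)) * ennreal (g t / (2 * sqrt l)) =
        ennreal (l powr (A - 1 / 2) * exp (- l) * log_gamma_density (a (Suc j)) l t)"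
      using l gpos h0 by (simp flip: ennreal_mult)
    have 3: "ennreal (l powr (A - 1 / 2) * exp (- l) * log_gamma_density (a (Suc j)) l t) =
      ennreal (l powr (A - 1 / 2) * exp (- l)) * ennreal (log_gamma_density (a (Suc j)) l t)"
      by (rule ennreal_mult) (auto simp: log_gamma_density_pos less_imp_le)
    have 4: "ennreal (C * (l powr (A - 1 / 2) * exp (- l))) = ennreal C * ennreal (l powr (A - 1 / 2) * exp (- l))"
      using C0 by (intro ennreal_mult) auto
    show "(\<integral>\<^sup>+r. ennreal (weight_integrand a b l j (x / (g t)\<^sup>2) r) \<partial>M) * ennreal (h (g t)) *
      ennreal (sqrt l * (1 / (2 * sqrt l)) * exp ((1 / (2 * sqrt l)) * t)) =
      ennreal (C * (l powr (l + a (Suc j) - 1 / 2) * exp (- l))) *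
      (log_gamma_conv a b l j (s - t) * ennreal (log_gamma_density (a (Suc j)) l t))"
      (is "?X * ?H * ?G = ?R")
    proof -
      have "?X * ?H * ?G = ?X * (?H * ?G)" by (simp only: mult.assoc)
      also have "?H * ?G = ennreal (l powr (A - 1 / 2) * exp (- l)) * ennreal (log_gamma_density (a (Suc j)) l t)"
        unfolding g' 2 3 ..
      also have "?X * \<dots> = ?R"
        unfolding 1 A_def[symmetric] 4 by (simp only: mult_ac)
      finally show ?thesis .
    qed
  qed
  also have "\<dots> = ennreal (C * (l powr (l + a (Suc j) - 1 / 2) * exp (- l))) * log_gamma_conv a b l (Suc j) s"
    unfolding log_gamma_conv.simps by (rule nn_integral_cmult) simp
  also have "C * (l powr (l + a (Suc j) - 1 / 2) * exp (- l)) =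
     l powr (l + b) * exp (- l) * (\<Prod>k=1..<Suc (Suc j). l powr (l + a k - 1 / 2) * exp (- l))"
    unfolding C_def eq by (subst prod.insert) (auto simp: mult_ac)
  finally show ?case by (simp only: x_def add_2_eq_Suc' add_Suc_right add_0_right Suc_eq_plus1)
qed

text \<open>As a function of |z|^2 this is the density of a product of m independent Gamma variables
  with shapes a_k + l + 1. It is also pi times the l-th term of the kernel on the diagonal.\<close>

definition ginibre_radial :: "nat \<Rightarrow> (nat \<Rightarrow> real) \<Rightarrow> nat \<Rightarrow> complex \<Rightarrow> real" where
  "ginibre_radial m a l z = pi * ginibre_weight m a z *
     (\<Prod>k=1..m. Gamma (a k + 1) / Gamma (a k + real l + 1)) * (cmod z)\<^sup>2 ^ l"

lemma ginibre_weight_nonneg: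
  assumes "\<And>k. k \<in> {1..m} \<Longrightarrow> a k > -1"
  shows "ginibre_weight m a z \<ge> 0"
proof -
  have "(\<Prod>k=1..m. 1 / Gamma (a k + 1)) \<ge> 0"
    using assms by (intro prod_nonneg divide_nonneg_nonneg Gamma_real_pos less_imp_le) force+
  then show ?thesis
    unfolding ginibre_weight_def set_lebesgue_integral_def
    by (intro mult_nonneg_nonneg integral_nonneg_AE AE_I2)
       (auto intro!: mult_nonneg_nonneg prod_nonneg)
qed

text \<open>Absorbing |z|^(2 (a_m + l)) into a power of x / (r_1 ... r_(m-1))^2 turns the exponents
  2 (a_k - a_m) - 1 of the weight into 2 (l + a_k) - 1, so that all m parameters play the same
  part.\<close>

lemma ginibre_weight_eq:
  assumes m: "m \<ge> 1" and z: "z \<noteq> 0"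
  shows "ginibre_weight m a z * (cmod z)\<^sup>2 ^ l = (1 / pi) * (\<Prod>k=1..m. 1 / Gamma (a k + 1)) *
     enn2real (\<integral>\<^sup>+r. ennreal (weight_integrand a (a m) (real l) (m - 1) ((cmod z)\<^sup>2) r)
        \<partial>(\<Pi>\<^sub>M k\<in>{1..<m}. lborel))"
proof -
  define x where "x = (cmod z)\<^sup>2"
  have x: "x > 0" using z by (simp add: x_def)
  have Suc: "Suc (m - 1) = m" using m by simp
  define M where "M = (\<Pi>\<^sub>M k\<in>{1..<m}. lborel :: real measure)"
  define F where "F = (\<lambda>r. indicator (\<Pi>\<^sub>E k\<in>{1..<m}. {0<..}) r *
     (exp (- (\<Sum>k=1..<m. (r k)\<^sup>2) - (cmod z)\<^sup>2 / (\<Prod>k=1..<m. (r k)\<^sup>2)) *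
        (\<Prod>k=1..<m. r k powr (2 * (a k - a m) - 1))) :: real)"
  define c where "c = x powr (real l + a m) * 2 ^ (m - 1)"
  have FW: "c * F r = weight_integrand a (a m) (real l) (m - 1) x r" if r: "r \<in> space M" for r
  proof (cases "\<forall>k\<in>{1..<m}. r k > 0")
    case True
    define p where "p = (\<Prod>k=1..<m. (r k)\<^sup>2)"
    have p: "p > 0" unfolding p_def using True by (intro prod_pos zero_less_power) auto
    have "r \<in> (\<Pi>\<^sub>E k\<in>{1..<m}. {0<..})"
      using r True by (auto simp: M_def space_PiM PiE_iff)
    then have "F r = exp (- (\<Sum>k=1..<m. (r k)\<^sup>2)) * exp (- (x / p)) * (\<Prod>k=1..<m. r k powr (2 * (a k - a m) - 1))"
      by (simp add: F_def x_def p_def flip: exp_add)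
    moreover have "exp (- (\<Sum>k=1..<m. (r k)\<^sup>2)) = (\<Prod>k=1..<m. exp (- (r k)\<^sup>2))"
      by (simp add: exp_sum flip: sum_negf)
    moreover have "(\<Prod>k=1..<m. r k powr (2 * (a k - a m) - 1)) =
       p powr - (real l + a m) * (\<Prod>k=1..<m. r k powr (2 * (real l + a k) - 1))"
    proof -
      have "p powr - (real l + a m) = (\<Prod>k=1..<m. ((r k)\<^sup>2) powr - (real l + a m))"
        unfolding p_def by (rule prod_powr_distrib)
      moreover have "(\<Prod>k=1..<m. r k powr (2 * (a k - a m) - 1)) =
         (\<Prod>k=1..<m. ((r k)\<^sup>2) powr - (real l + a m) * r k powr (2 * (real l + a k) - 1))"
      proof (intro prod.cong refl)
        fix k assume "k \<in> {1..<m}"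
        then have k: "r k > 0" using True by auto
        have "((r k)\<^sup>2) powr - (real l + a m) = r k powr (- 2 * (real l + a m))"
          using k by (simp add: powr_powr flip: powr_numeral)
        then show "r k powr (2 * (a k - a m) - 1) = ((r k)\<^sup>2) powr - (real l + a m) * r k powr (2 * (real l + a k) - 1)"
          by (simp add: algebra_simps flip: powr_add)
      qed
      ultimately show ?thesis by (simp add: prod.distrib)
    qed
    moreover have "(x / p) powr (real l + a m) = x powr (real l + a m) * p powr - (real l + a m)"
      using x p by (subst powr_minus_divide) (simp add: powr_divide)
    moreover have "(\<Prod>k=1..<m. 2 * r k powr (2 * (real l + a k) - 1) * exp (- (r k)\<^sup>2) * indicator {0<..} (r k)) =
       2 ^ (m - 1) * (\<Prod>k=1..<m. r k powr (2 * (real l + a k) - 1)) * (\<Prod>k=1..<m. exp (- (r k)\<^sup>2))"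
    proof -
      have "(\<Prod>k=1..<m. 2 * r k powr (2 * (real l + a k) - 1) * exp (- (r k)\<^sup>2) * indicator {0<..} (r k)) =
        (\<Prod>k=1..<m. 2 * r k powr (2 * (real l + a k) - 1) * exp (- (r k)\<^sup>2))"
        using True by (intro prod.cong) auto
      then show ?thesis by (simp add: prod.distrib)
    qed
    ultimately show ?thesis
      unfolding weight_integrand_def Suc c_def p_def[symmetric] by (simp only: mult_ac)
  next
    case False
    then obtain k where k: "k \<in> {1..<m}" "r k \<le> 0" by force
    then have "r \<notin> (\<Pi>\<^sub>E k\<in>{1..<m}. {0<..})" by (force simp: PiE_iff)
    moreover have "(\<Prod>k=1..<m. 2 * r k powr (2 * (real l + a k) - 1) * exp (- (r k)\<^sup>2) * indicator {0<..} (r k)) = 0"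
      using k by (intro prod_zero bexI[of _ k]) auto
    ultimately show ?thesis
      unfolding weight_integrand_def Suc by (simp add: F_def)
  qed
  have F0: "F r \<ge> 0" for r unfolding F_def by (auto intro!: mult_nonneg_nonneg prod_nonneg)
  have c0: "c > 0" using x by (simp add: c_def)
  have Fm [measurable]: "F \<in> borel_measurable M"
  proof -
    have [measurable]: "weight_integrand a (a m) (real l) (m - 1) x \<in> borel_measurable M"
      using borel_measurable_weight_integrand[of a "a m" "real l" "m - 1" x] unfolding Suc M_def .
    have "(\<lambda>r. weight_integrand a (a m) (real l) (m - 1) x r / c) \<in> borel_measurable M"
      by measurable
    then show ?thesis
      by (rule measurable_cong[THEN iffD1, rotated]) (use FW c0 in \<open>auto simp: field_simps\<close>)
  qed
  have "(LINT r : (\<Pi>\<^sub>E k\<in>{1..<m}. {0<..}) | M.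
        exp (- (\<Sum>k=1..<m. (r k)\<^sup>2) - (cmod z)\<^sup>2 / (\<Prod>k=1..<m. (r k)\<^sup>2)) *
        (\<Prod>k=1..<m. r k powr (2 * (a k - a m) - 1))) = (LINT r | M. F r)"
    unfolding set_lebesgue_integral_def F_def real_scaleR_def ..
  \<comment> \<open>A divergent integral would give 0 on both sides: by default for the Bochner
    integral, through \<open>enn2real\<close> on the right.\<close>
  also have "\<dots> = enn2real (\<integral>\<^sup>+r. ennreal (F r) \<partial>M)"
    by (rule integral_eq_nn_integral) (use F0 in auto)
  finally have I: "ginibre_weight m a z = cmod z powr (2 * a m) * (2 ^ (m - 1) / pi) *
      (\<Prod>k=1..m. 1 / Gamma (a k + 1)) * enn2real (\<integral>\<^sup>+r. ennreal (F r) \<partial>M)"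
    unfolding ginibre_weight_def M_def by simp
  have "c = x powr a m * x ^ l * 2 ^ (m - 1)"
    using x by (simp add: c_def powr_add powr_realpow)
  also have "x powr a m = cmod z powr (2 * a m)"
    using z by (simp add: x_def powr_powr flip: powr_numeral)
  finally have c: "c = cmod z powr (2 * a m) * x ^ l * 2 ^ (m - 1)" .
  have "c * enn2real (\<integral>\<^sup>+r. ennreal (F r) \<partial>M) = enn2real (ennreal c * (\<integral>\<^sup>+r. ennreal (F r) \<partial>M))"
    using c0 by (simp add: enn2real_mult)
  also have "ennreal c * (\<integral>\<^sup>+r. ennreal (F r) \<partial>M) = (\<integral>\<^sup>+r. ennreal c * ennreal (F r) \<partial>M)"
    by (rule nn_integral_cmult[symmetric]) simp
  also have "\<dots> = (\<integral>\<^sup>+r. ennreal (weight_integrand a (a m) (real l) (m - 1) x r) \<partial>M)"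
    using c0 F0 FW by (intro nn_integral_cong) (simp flip: ennreal_mult)
  finally show ?thesis
    unfolding I M_def[symmetric] x_def[symmetric] c by (simp add: mult_ac)
qed

text \<open>The power m - 1/2 is the Jacobian between |z|^2 and the rescaled logarithm s: from |z|^2
  = l^m exp (s / sqrt l) the derivative in s is |z|^2 / sqrt l, of order l^(m - 1/2).\<close>

theorem ginibre_radial_tendsto:
  fixes L :: "nat \<Rightarrow> nat" and z :: "nat \<Rightarrow> complex"
  assumes m: "m \<ge> 1" and a: "\<And>k. k \<in> {1..m} \<Longrightarrow> a k > -1"
    and L: "filterlim L at_top sequentially" and z: "\<And>n. z n \<noteq> 0"
    and S: "(\<lambda>n. sqrt (real (L n)) * (ln ((cmod (z n))\<^sup>2) - real m * ln (real (L n)))) \<longlonglongrightarrow> s"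
  shows "(\<lambda>n. real (L n) powr (real m - 1 / 2) * ginibre_radial m a (L n) (z n)) \<longlonglongrightarrow> normal_density 0 (sqrt (real m)) s"
proof -
  define S where "S = (\<lambda>n. sqrt (real (L n)) * (ln ((cmod (z n))\<^sup>2) - real m * ln (real (L n))))"
  define D where "D = (\<lambda>k n. real (L n) powr (a k + real (L n) + 1 / 2) * exp (- real (L n)))"
  have Lr: "filterlim (\<lambda>n. real (L n)) at_top sequentially"
    by (rule filterlim_compose[OF filterlim_real_sequentially L])
  have "(\<lambda>n. log_gamma_conv a (a m) (L n) (m - 1) (S n)) \<longlonglongrightarrow>
    ennreal (sqrt (2 * pi) ^ (m - 1 + 1) * normal_density 0 (sqrt (real (m - 1) + 1)) s)"
    using S unfolding S_def by (intro log_gamma_conv_tendsto Lr)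
  then have conv: "(\<lambda>n. enn2real (log_gamma_conv a (a m) (L n) (m - 1) (S n))) \<longlonglongrightarrow>
      sqrt (2 * pi) ^ m * normal_density 0 (sqrt (real m)) s"
    using m by (intro tendsto_enn2real) (auto simp: normal_density_nonneg)
  have "(\<lambda>n. 1 / (Gamma (a k + real (L n) + 1) / D k n)) \<longlonglongrightarrow> 1 / sqrt (2 * pi)" for k
    unfolding D_def by (intro tendsto_divide tendsto_const Gamma_asymptotic Lr) auto
  then have "(\<lambda>n. \<Prod>k=1..m. 1 / (Gamma (a k + real (L n) + 1) / D k n)) \<longlonglongrightarrow> (\<Prod>k=1..m. 1 / sqrt (2 * pi))"
    by (intro tendsto_prod)
  from tendsto_mult[OF this conv]
  have lim: "(\<lambda>n. (\<Prod>k=1..m. 1 / (Gamma (a k + real (L n) + 1) / D k n)) *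
      enn2real (log_gamma_conv a (a m) (L n) (m - 1) (S n))) \<longlonglongrightarrow> normal_density 0 (sqrt (real m)) s"
    by (simp add: power_one_over power_divide)
  have "\<forall>\<^sub>F n in sequentially. (\<Prod>k=1..m. 1 / (Gamma (a k + real (L n) + 1) / D k n)) *
      enn2real (log_gamma_conv a (a m) (L n) (m - 1) (S n)) = real (L n) powr (real m - 1 / 2) * ginibre_radial m a (L n) (z n)"
    using filterlim_at_top_dense[THEN iffD1, OF Lr, rule_format, of 0]
  proof eventually_elim
    case (elim n)
    define l where "l = real (L n)"
    define x where "x = (cmod (z n))\<^sup>2"
    have l: "l > 0" using elim by (simp add: l_def)
    have x: "x > 0" using z by (simp add: x_def)
    have Suc: "Suc (m - 1) = m" using m by simp
    have "l ^ m * exp (S n / sqrt l) = x"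
    proof -
      have "S n / sqrt l = ln x - real m * ln l" using l by (simp add: S_def x_def l_def)
      then show ?thesis using l x by (simp add: exp_diff ln_realpow[symmetric])
    qed
    then have "(\<integral>\<^sup>+r. ennreal (weight_integrand a (a m) l (m - 1) x r) \<partial>(\<Pi>\<^sub>M k\<in>{1..<m}. lborel)) =
      ennreal (l powr (l + a m) * exp (- l) * (\<Prod>k=1..<m. l powr (l + a k - 1 / 2) * exp (- l))) *
      log_gamma_conv a (a m) l (m - 1) (S n)"
      using nn_integral_weight_integrand[OF l, where a = a and b = "a m" and j = "m - 1" and s = "S n"] m by simp
    moreover have "l powr (l + a m) * exp (- l) * (\<Prod>k=1..<m. l powr (l + a k - 1 / 2) * exp (- l)) =
      l powr - (real m - 1 / 2) * (\<Prod>k=1..m. D k n)"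
    proof -
      have "(\<Prod>k=1..<m. l powr (l + a k - 1 / 2) * exp (- l)) = (\<Prod>k=1..<m. l powr - 1 * D k n)"
      proof (intro prod.cong refl)
        fix k
        have "l powr - 1 * l powr (a k + l + 1 / 2) = l powr (l + a k - 1 / 2)"
          unfolding powr_add[symmetric] by (simp add: algebra_simps)
        then show "l powr (l + a k - 1 / 2) * exp (- l) = l powr - 1 * D k n"
          unfolding D_def l_def[symmetric] by (simp only: mult_ac)
      qed
      also have "\<dots> = l powr - (real m - 1) * (\<Prod>k=1..<m. D k n)"
      proof -
        have "(\<Prod>k=1..<m. l powr - 1) = (l powr - 1) ^ (m - 1)"
          by (simp only: prod_constant card_atLeastLessThan)
        also have "\<dots> = l powr - (real m - 1)"
          by (subst powr_power) (use l m in \<open>auto simp: of_nat_diff\<close>)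
        finally show ?thesis unfolding prod.distrib by (simp only:)
      qed
      finally have 1: "(\<Prod>k=1..<m. l powr (l + a k - 1 / 2) * exp (- l)) = l powr - (real m - 1) * (\<Prod>k=1..<m. D k n)" .
      have 2: "l powr (l + a m) * exp (- l) = l powr (- 1 / 2) * D m n"
        unfolding D_def l_def[symmetric] by (simp add: algebra_simps flip: powr_add)
      have 3: "(\<Prod>k=1..m. D k n) = (\<Prod>k=1..<m. D k n) * D m n"
        using m by (cases m) (auto simp: atLeastLessThanSuc_atLeastAtMost)
      have 4: "l powr (- 1 / 2) * l powr - (real m - 1) = l powr - (real m - 1 / 2)"
        using m by (simp add: of_nat_diff flip: powr_add)
      show ?thesis unfolding 1 2 3 4[symmetric] by (simp only: mult_ac)
    qed
    moreover have D0: "(\<Prod>k=1..m. D k n) > 0" using l by (auto intro!: prod_pos simp: D_def l_def)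
    ultimately have I: "enn2real (\<integral>\<^sup>+r. ennreal (weight_integrand a (a m) l (m - 1) x r) \<partial>(\<Pi>\<^sub>M k\<in>{1..<m}. lborel)) =
      l powr - (real m - 1 / 2) * (\<Prod>k=1..m. D k n) * enn2real (log_gamma_conv a (a m) l (m - 1) (S n))"
      by (simp add: enn2real_mult)
    have G: "(\<Prod>k=1..m. 1 / Gamma (a k + 1)) * (\<Prod>k=1..m. Gamma (a k + 1) / Gamma (a k + real (L n) + 1)) =
       (\<Prod>k=1..m. 1 / Gamma (a k + real (L n) + 1))"
    proof -
      have "Gamma (a k + 1) \<noteq> 0" if "k \<in> {1..m}" for k
      proof -
        have "a k + 1 > 0" using a[OF that] by linarith
        from Gamma_real_pos[OF this] show ?thesis by linarith
      qed
      then show ?thesis unfolding prod.distrib[symmetric] by (intro prod.cong) auto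
    qed
    have "ginibre_radial m a (L n) (z n) = pi * (ginibre_weight m a (z n) * (cmod (z n))\<^sup>2 ^ L n) *
        (\<Prod>k=1..m. Gamma (a k + 1) / Gamma (a k + real (L n) + 1))"
      by (simp add: ginibre_radial_def mult_ac)
    also have "\<dots> = (\<Prod>k=1..m. 1 / Gamma (a k + real (L n) + 1)) * (l powr - (real m - 1 / 2) * (\<Prod>k=1..m. D k n) *
        enn2real (log_gamma_conv a (a m) l (m - 1) (S n)))"
    proof -
      have "ginibre_weight m a (z n) * (cmod (z n))\<^sup>2 ^ L n = (1 / pi) * (\<Prod>k=1..m. 1 / Gamma (a k + 1)) *
          (l powr - (real m - 1 / 2) * (\<Prod>k=1..m. D k n) * enn2real (log_gamma_conv a (a m) l (m - 1) (S n)))"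
        using ginibre_weight_eq[OF m z[of n], of a "L n"] I unfolding l_def x_def by (simp only:)
      then show ?thesis unfolding G[symmetric] by simp
    qed
    finally have "l powr (real m - 1 / 2) * ginibre_radial m a (L n) (z n) = (l powr (real m - 1 / 2) * l powr - (real m - 1 / 2)) *
        ((\<Prod>k=1..m. 1 / Gamma (a k + real (L n) + 1)) * (\<Prod>k=1..m. D k n)) *
        enn2real (log_gamma_conv a (a m) l (m - 1) (S n))"
      by (simp only: mult_ac)
    also have "l powr (real m - 1 / 2) * l powr - (real m - 1 / 2) = 1"
      using l by (simp flip: powr_add)
    also have "(\<Prod>k=1..m. 1 / Gamma (a k + real (L n) + 1)) * (\<Prod>k=1..m. D k n) =
        (\<Prod>k=1..m. 1 / (Gamma (a k + real (L n) + 1) / D k n))"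
      by (simp flip: prod.distrib)
    finally show ?case by (simp add: l_def)
  qed
  with lim show ?thesis by (rule Lim_transform_eventually)
qed

subsection \<open>Local limit theorem along the summation index\<close>

text \<open>The delta method. Caratheodory's factorisation f z - f p = g z (z - p) avoids dividing
  by \<open>r n - p\<close>, which may vanish.\<close>

lemma scaled_derivative_tendsto:
  fixes f :: "'a::real_normed_field \<Rightarrow> 'a"
  assumes f: "(f has_field_derivative D) (at p)" and r: "r \<longlonglongrightarrow> p"
    and c: "(\<lambda>n. c n * (r n - p)) \<longlonglongrightarrow> d"
  shows "(\<lambda>n. c n * (f (r n) - f p)) \<longlonglongrightarrow> D * d"
proof -
  obtain g where g: "\<And>z. f z - f p = g z * (z - p)" "isCont g p" "g p = D"
    using f unfolding CARAT_DERIV by blast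
  have "(\<lambda>n. g (r n) * (c n * (r n - p))) \<longlonglongrightarrow> D * d"
    using isCont_tendsto_compose[OF g(2) r] c unfolding g(3) by (intro tendsto_mult)
  then show ?thesis by (simp add: g(1) mult_ac)
qed

lemma LIMSEQ_sqrt_scaled_imp:
  fixes r :: "nat \<Rightarrow> 'a::real_normed_field"
  assumes "(\<lambda>n. of_real (sqrt (real n)) * (r n - p)) \<longlonglongrightarrow> d"
  shows "r \<longlonglongrightarrow> p"
proof -
  have "(\<lambda>n. of_real (1 / sqrt (real n)) :: 'a) \<longlonglongrightarrow> of_real 0"
    by (intro tendsto_of_real) real_asymp
  from tendsto_mult[OF this assms]
  have "(\<lambda>n. of_real (1 / sqrt (real n)) * (of_real (sqrt (real n)) * (r n - p))) \<longlonglongrightarrow> 0" by simp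
  moreover have "\<forall>\<^sub>F n in sequentially. of_real (1 / sqrt (real n)) * (of_real (sqrt (real n)) * (r n - p)) = r n - p"
    using eventually_gt_at_top[of 0] by eventually_elim (simp flip: of_real_mult mult.assoc)
  ultimately have "(\<lambda>n. r n - p) \<longlonglongrightarrow> 0" by (simp add: tendsto_cong)
  then show ?thesis by (rule LIM_zero_cancel)
qed

lemma sqrt_ln_tendsto:
  fixes r :: "nat \<Rightarrow> real"
  assumes "(\<lambda>n. sqrt (real n) * (r n - 1)) \<longlonglongrightarrow> d"
  shows "(\<lambda>n. sqrt (real n) * ln (r n)) \<longlonglongrightarrow> d"
proof -
  have "(ln has_field_derivative 1) (at (1::real))"
    by (auto intro!: derivative_eq_intros)
  from scaled_derivative_tendsto[OF this _ assms] LIMSEQ_sqrt_scaled_imp[of r 1 d] assms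
  show ?thesis by simp
qed

text \<open>The floor lets an integral over y run through each index on an interval of length 1 /
  sqrt N. Negative positions are all sent to 0 by \<open>nat\<close>; they are excluded wherever the
  index is used.\<close>

definition bulk_index :: "real \<Rightarrow> nat \<Rightarrow> real \<Rightarrow> nat" where
  "bulk_index lam N y = nat \<lfloor>lam * real N + y * sqrt (real N)\<rfloor>"

lemma bulk_index_bounds:
  assumes "lam * real N + y * sqrt (real N) \<ge> 0"
  shows "real (bulk_index lam N y) \<le> lam * real N + y * sqrt (real N)"
    "lam * real N + y * sqrt (real N) - 1 \<le> real (bulk_index lam N y)"
  using assms by (auto simp: bulk_index_def)

lemma eventually_index_nonneg:
  assumes "lam > 0"
  shows "\<forall>\<^sub>F N in sequentially. lam * real N + y * sqrt (real N) \<ge> 0"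
  using assms by real_asymp

text \<open>Rounding and the constant \<open>c\<close> change the numerator by a bounded amount,
  hence the scaled ratio by order 1 / sqrt N. The constant allows for the shifts a_k + 1.\<close>

lemma bulk_index_ratio:
  assumes lam: "lam > 0"
  shows "(\<lambda>N. sqrt (real N) * ((c + real (bulk_index lam N y)) / (lam * real N) - 1)) \<longlonglongrightarrow> y / lam"
proof (rule real_tendsto_sandwich)
  show "\<forall>\<^sub>F N in sequentially. sqrt (real N) * ((c + (lam * real N + y * sqrt (real N) - 1)) / (lam * real N) - 1)
      \<le> sqrt (real N) * ((c + real (bulk_index lam N y)) / (lam * real N) - 1)"
    using eventually_index_nonneg[OF lam, of y]
    by eventually_elim
      (use lam bulk_index_bounds in \<open>auto intro!: mult_left_mono divide_right_mono\<close>)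
  show "\<forall>\<^sub>F N in sequentially. sqrt (real N) * ((c + real (bulk_index lam N y)) / (lam * real N) - 1)
      \<le> sqrt (real N) * ((c + (lam * real N + y * sqrt (real N))) / (lam * real N) - 1)"
    using eventually_index_nonneg[OF lam, of y]
    by eventually_elim
      (use lam bulk_index_bounds in \<open>auto intro!: mult_left_mono divide_right_mono\<close>)
  show "(\<lambda>N. sqrt (real N) * ((c + (lam * real N + y * sqrt (real N) - 1)) / (lam * real N) - 1)) \<longlonglongrightarrow> y / lam"
    unfolding divide_inverse[of y lam] using lam by real_asymp
  show "(\<lambda>N. sqrt (real N) * ((c + (lam * real N + y * sqrt (real N))) / (lam * real N) - 1)) \<longlonglongrightarrow> y / lam"
    unfolding divide_inverse[of y lam] using lam by real_asymp
qed

lemma bulk_index_at_top: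
  assumes lam: "lam > 0"
  shows "filterlim (\<lambda>N. bulk_index lam N y) at_top sequentially"
proof -
  have "filterlim (\<lambda>N. lam * real N + y * sqrt (real N) - 1) at_top sequentially"
    using lam by real_asymp
  then have "filterlim (\<lambda>N. real (bulk_index lam N y)) at_top sequentially"
    by (rule filterlim_at_top_mono)
      (use eventually_index_nonneg[OF lam, of y] in \<open>auto elim!: eventually_mono dest: bulk_index_bounds\<close>)
  then show "filterlim (\<lambda>N. bulk_index lam N y) at_top sequentially"
    by (simp add: filterlim_sequentially_iff_filterlim_real)
qed

text \<open>The centring m ln l is exchanged for m ln (lam N), common to all indices; the difference
  m ln (l / (lam N)) contributes m y / lam on the scale 1 / sqrt N. The powers of lam arise from
  replacing l by N in the prefactor and in the square root.\<close>

lemma ginibre_radial_bulk_tendsto: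
  fixes z :: "nat \<Rightarrow> complex"
  assumes m: "m \<ge> 1" and a: "\<And>k. k \<in> {1..m} \<Longrightarrow> a k > -1"
    and lam: "lam > 0" and z: "\<And>N. z N \<noteq> 0"
    and kappa: "(\<lambda>N. sqrt (real N) * (ln ((cmod (z N))\<^sup>2) - real m * ln (lam * real N))) \<longlonglongrightarrow> \<kappa>"
  shows "(\<lambda>N. real N powr (real m - 1 / 2) * ginibre_radial m a (bulk_index lam N y) (z N)) \<longlonglongrightarrow>
    lam powr (1 / 2 - real m) * normal_density 0 (sqrt (real m)) (sqrt lam * (\<kappa> - real m * y / lam))"
proof -
  define L where "L = (\<lambda>N. bulk_index lam N y)"
  have Lt: "filterlim L at_top sequentially"
    unfolding L_def by (rule bulk_index_at_top[OF lam])
  then have Lr: "filterlim (\<lambda>N. real (L N)) at_top sequentially"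
    by (simp add: filterlim_sequentially_iff_filterlim_real)
  have r: "(\<lambda>N. sqrt (real N) * (real (L N) / (lam * real N) - 1)) \<longlonglongrightarrow> y / lam"
    using bulk_index_ratio[OF lam, of 0 y] by (simp add: L_def)
  have r1: "(\<lambda>N. real (L N) / (lam * real N)) \<longlonglongrightarrow> 1"
    using LIMSEQ_sqrt_scaled_imp[of "\<lambda>N. real (L N) / (lam * real N)" 1] r by simp
  have "(\<lambda>N. lam * (real (L N) / (lam * real N))) \<longlonglongrightarrow> lam * 1"
    by (intro tendsto_intros r1)
  then have r2: "(\<lambda>N. real (L N) / real N) \<longlonglongrightarrow> lam" using lam by simp
  have "(\<lambda>N. sqrt (real (L N) / real N) * (sqrt (real N) * (ln ((cmod (z N))\<^sup>2) - real m * ln (lam * real N)) -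
     real m * (sqrt (real N) * ln (real (L N) / (lam * real N))))) \<longlonglongrightarrow> sqrt lam * (\<kappa> - real m * (y / lam))"
    by (intro tendsto_intros kappa r2 sqrt_ln_tendsto r)
  moreover have pos: "\<forall>\<^sub>F N in sequentially. N > 0 \<and> L N > 0"
    using eventually_gt_at_top[of 0] filterlim_at_top_dense[THEN iffD1, OF Lr, rule_format, of 0]
    by eventually_elim simp
  moreover have "\<forall>\<^sub>F N in sequentially. sqrt (real (L N) / real N) * (sqrt (real N) * (ln ((cmod (z N))\<^sup>2) - real m * ln (lam * real N)) -
     real m * (sqrt (real N) * ln (real (L N) / (lam * real N)))) = sqrt (real (L N)) * (ln ((cmod (z N))\<^sup>2) - real m * ln (real (L N)))"
    using pos
  proof eventually_elim
    case (elim N)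
    then show ?case using lam
      by (simp add: ln_div real_sqrt_divide ring_distribs field_simps)
  qed
  ultimately have S: "(\<lambda>N. sqrt (real (L N)) * (ln ((cmod (z N))\<^sup>2) - real m * ln (real (L N)))) \<longlonglongrightarrow> sqrt lam * (\<kappa> - real m * y / lam)"
    by (simp add: tendsto_cong)
  note lim = ginibre_radial_tendsto[OF m a Lt z S]
  have "(\<lambda>N. (real (L N) / real N) powr (1 / 2 - real m) * (real (L N) powr (real m - 1 / 2) * ginibre_radial m a (L N) (z N))) \<longlonglongrightarrow>
    lam powr (1 / 2 - real m) * normal_density 0 (sqrt (real m)) (sqrt lam * (\<kappa> - real m * y / lam))"
    by (intro tendsto_intros r2 lim) (use lam in auto)
  moreover have "\<forall>\<^sub>F N in sequentially. (real (L N) / real N) powr (1 / 2 - real m) * (real (L N) powr (real m - 1 / 2) * ginibre_radial m a (L N) (z N)) =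
     real N powr (real m - 1 / 2) * ginibre_radial m a (L N) (z N)"
    using pos
  proof eventually_elim
    case (elim N)
    have "(real (L N) / real N) powr (1 / 2 - real m) = real (L N) powr (1 / 2 - real m) * real N powr (real m - 1 / 2)"
      using elim powr_minus_divide[of "real N" "1 / 2 - real m"] by (simp add: powr_divide)
    moreover have "real (L N) powr (1 / 2 - real m) * real (L N) powr (real m - 1 / 2) = 1"
      using elim by (simp flip: powr_add)
    ultimately show ?case by algebra
  qed
  ultimately show ?thesis
    unfolding L_def by (rule Lim_transform_eventually)
qed

section \<open>Log-concavity in the summation index and exponential domination\<close>

definition radial_ratio :: "nat \<Rightarrow> (nat \<Rightarrow> real) \<Rightarrow> nat \<Rightarrow> complex \<Rightarrow> real" where
  "radial_ratio m a l z = (cmod z)\<^sup>2 / (\<Prod>k=1..m. a k + real l + 1)"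

context
  fixes m :: nat and a :: "nat \<Rightarrow> real"
  assumes a: "\<And>k. k \<in> {1..m} \<Longrightarrow> a k > -1"
begin

lemma Gamma_param_pos: "k \<in> {1..m} \<Longrightarrow> Gamma (a k + real l + 1) > 0"
  using a[of k] by (intro Gamma_real_pos) simp

lemma ginibre_radial_nonneg: "ginibre_radial m a l z \<ge> 0"
proof -
  have "(\<Prod>k=1..m. Gamma (a k + 1) / Gamma (a k + real l + 1)) \<ge> 0"
    using Gamma_param_pos[of _ 0] Gamma_param_pos[of _ l] by (intro prod_nonneg) (auto simp: less_imp_le)
  then show ?thesis
    unfolding ginibre_radial_def using ginibre_weight_nonneg[OF a] by simp
qed

text \<open>The weight does not depend on l, so the functional equation of Gamma leaves an explicit
  quotient of consecutive terms. That this quotient decreases in l is the log-concavity of the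
  sequence.\<close>

lemma ginibre_radial_Suc: "ginibre_radial m a (Suc l) z = ginibre_radial m a l z * radial_ratio m a l z"
proof -
  have "(\<Prod>k=1..m. Gamma (a k + 1) / Gamma (a k + real (Suc l) + 1)) =
     (\<Prod>k=1..m. Gamma (a k + 1) / Gamma (a k + real l + 1) * (1 / (a k + real l + 1)))"
  proof (intro prod.cong refl)
    fix k assume k: "k \<in> {1..m}"
    have "Gamma (a k + real l + 1 + 1) = (a k + real l + 1) * Gamma (a k + real l + 1)"
      using a[OF k] by (intro Gamma_plus1) (auto simp: nonpos_Ints_def)
    then show "Gamma (a k + 1) / Gamma (a k + real (Suc l) + 1) =
        Gamma (a k + 1) / Gamma (a k + real l + 1) * (1 / (a k + real l + 1))"
      by (simp add: add_ac)
  qed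
  also have "\<dots> = (\<Prod>k=1..m. Gamma (a k + 1) / Gamma (a k + real l + 1)) * (1 / (\<Prod>k=1..m. a k + real l + 1))"
    unfolding prod.distrib by (simp only: prod_dividef prod.neutral_const)
  finally show ?thesis
    unfolding ginibre_radial_def radial_ratio_def by simp
qed

lemma radial_ratio_antimono:
  assumes "l \<le> L"
  shows "radial_ratio m a L z \<le> radial_ratio m a l z"
  unfolding radial_ratio_def
proof (intro divide_left_mono prod_mono mult_pos_pos prod_pos)
  fix k assume "k \<in> {1..m}"
  from a[OF this] assms show "0 \<le> a k + real l + 1 \<and> a k + real l + 1 \<le> a k + real L + 1" by auto
qed (use a in force)+

lemma radial_ratio_pos: "z \<noteq> 0 \<Longrightarrow> radial_ratio m a l z > 0"
  unfolding radial_ratio_def by (intro divide_pos_pos prod_pos) (use a in force)+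

text \<open>The sequence is log-concave in \<open>l\<close>, hence its logarithm lies below every supporting line.\<close>

lemma ginibre_radial_le_supporting_line:
  assumes z: "z \<noteq> 0"
  shows "ginibre_radial m a l z \<le> ginibre_radial m a L z * radial_ratio m a L z powr (real l - real L)"
proof (cases "l \<ge> L")
  case True
  then show ?thesis
  proof (induction l rule: dec_induct)
    case base
    show ?case using radial_ratio_pos[OF z, of L] by simp
  next
    case (step l)
    have "ginibre_radial m a (Suc l) z \<le>
        (ginibre_radial m a L z * radial_ratio m a L z powr (real l - real L)) * radial_ratio m a L z"
      unfolding ginibre_radial_Suc
      by (intro mult_mono step.IH radial_ratio_antimono step.hyps mult_nonneg_nonneg ginibre_radial_nonneg)
        (use radial_ratio_pos[OF z] less_imp_le in auto)
    also have "\<dots> = ginibre_radial m a L z * radial_ratio m a L z powr ((real l - real L) + 1)"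
      unfolding powr_add using radial_ratio_pos[OF z, of L] by simp
    finally show ?case by (simp add: algebra_simps)
  qed
next
  case False
  then have "l \<le> L" by simp
  then show ?thesis
  proof (induction l rule: inc_induct)
    case base
    show ?case using radial_ratio_pos[OF z, of L] by simp
  next
    case (step l)
    let ?r = "radial_ratio m a L z"
    have r: "?r > 0" "radial_ratio m a l z > 0" by (rule radial_ratio_pos[OF z])+
    have "ginibre_radial m a l z * ?r \<le> ginibre_radial m a l z * radial_ratio m a l z"
      using step.hyps by (intro mult_left_mono radial_ratio_antimono ginibre_radial_nonneg) auto
    also have "\<dots> \<le> ginibre_radial m a L z * ?r powr (real (Suc l) - real L)"
      using step.IH unfolding ginibre_radial_Suc .
    also have "\<dots> = ginibre_radial m a L z * ?r powr ((real l - real L) + 1)"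
      by (simp add: algebra_simps)
    also have "\<dots> = (ginibre_radial m a L z * ?r powr (real l - real L)) * ?r"
      unfolding powr_add using r by simp
    finally show ?case using r by simp
  qed
qed

text \<open>The limit is the logarithmic derivative in y of the Gaussian profile found in
  \<open>ginibre_radial_bulk_tendsto\<close>: the slopes of the supporting lines converge to the
  slope of the limit.\<close>

lemma radial_ratio_bulk_tendsto:
  fixes z :: "nat \<Rightarrow> complex"
  assumes lam: "lam > 0" and z: "\<And>N. z N \<noteq> 0"
    and kappa: "(\<lambda>N. sqrt (real N) * (ln ((cmod (z N))\<^sup>2) - real m * ln (lam * real N))) \<longlonglongrightarrow> \<kappa>"
  shows "(\<lambda>N. sqrt (real N) * ln (radial_ratio m a (bulk_index lam N y) (z N))) \<longlonglongrightarrow> \<kappa> - real m * y / lam"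
proof -
  have "(\<lambda>N. sqrt (real N) * (ln ((cmod (z N))\<^sup>2) - real m * ln (lam * real N)) -
     (\<Sum>k=1..m. sqrt (real N) * ln ((a k + 1 + real (bulk_index lam N y)) / (lam * real N))))
     \<longlonglongrightarrow> \<kappa> - (\<Sum>k=1..m. y / lam)"
    by (intro tendsto_intros kappa sqrt_ln_tendsto bulk_index_ratio lam)
  moreover have "\<forall>\<^sub>F N in sequentially. sqrt (real N) * (ln ((cmod (z N))\<^sup>2) - real m * ln (lam * real N)) -
     (\<Sum>k=1..m. sqrt (real N) * ln ((a k + 1 + real (bulk_index lam N y)) / (lam * real N))) =
     sqrt (real N) * ln (radial_ratio m a (bulk_index lam N y) (z N))"
    using eventually_gt_at_top[of 0]
  proof eventually_elim
    case (elim N)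
    define L where "L = bulk_index lam N y"
    have ln_quot: "ln (x / y) = ln x - ln y" if "x > 0" "y > 0" for x y :: real
      using that by (simp add: ln_div)
    have pos: "a k + real L + 1 > 0" if "k \<in> {1..m}" for k using a[OF that] by simp
    then have "ln (radial_ratio m a L (z N)) = ln ((cmod (z N))\<^sup>2) - (\<Sum>k=1..m. ln (a k + real L + 1))"
    proof -
      have "(\<Prod>k=1..m. a k + real L + 1) > 0" by (intro prod_pos pos)
      then have "ln (radial_ratio m a L (z N)) = ln ((cmod (z N))\<^sup>2) - ln (\<Prod>k=1..m. a k + real L + 1)"
        unfolding radial_ratio_def using z[of N] by (intro ln_quot) auto
      also have "ln (\<Prod>k=1..m. a k + real L + 1) = (\<Sum>k=1..m. ln (a k + real L + 1))"
        by (rule ln_prod) (use pos in force)+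
      finally show ?thesis .
    qed
    moreover have "(\<Sum>k=1..m. sqrt (real N) * ln ((a k + 1 + real L) / (lam * real N))) =
       sqrt (real N) * ((\<Sum>k=1..m. ln (a k + real L + 1)) - real m * ln (lam * real N))"
    proof -
      have "(\<Sum>k=1..m. sqrt (real N) * ln ((a k + 1 + real L) / (lam * real N))) =
        (\<Sum>k=1..m. sqrt (real N) * (ln (a k + real L + 1) - ln (lam * real N)))"
      proof (intro sum.cong refl)
        fix k assume "k \<in> {1..m}"
        from pos[OF this] have "ln ((a k + real L + 1) / (lam * real N)) = ln (a k + real L + 1) - ln (lam * real N)"
          using lam elim by (intro ln_quot) auto
        then show "sqrt (real N) * ln ((a k + 1 + real L) / (lam * real N)) = sqrt (real N) * (ln (a k + real L + 1) - ln (lam * real N))"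
          by (simp add: add_ac)
      qed
      then show ?thesis by (simp add: sum_subtractf sum_distrib_left[symmetric])
    qed
    ultimately show ?case unfolding L_def[symmetric] by algebra
  qed
  ultimately show ?thesis by (simp add: tendsto_cong)
qed

text \<open>A supporting line whose scaled slope is close to -1 or 1 dominates all terms on one
  side, however far away. Only the height and the slope at the single base point \<open>Y\<close>
  have to be controlled, and both converge.\<close>

lemma ginibre_radial_half_bound:
  fixes z :: "nat \<Rightarrow> complex" and \<sigma> :: real
  assumes m: "m \<ge> 1" and lam: "lam > 0" and z: "\<And>N. z N \<noteq> 0"
    and kappa: "(\<lambda>N. sqrt (real N) * (ln ((cmod (z N))\<^sup>2) - real m * ln (lam * real N))) \<longlonglongrightarrow> \<kappa>"
    and \<sigma>: "\<sigma> = 1 \<or> \<sigma> = - 1"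
  shows "\<exists>C. \<forall>\<^sub>F N in sequentially. \<forall>y. \<sigma> * y \<ge> 0 \<longrightarrow> lam * real N + y * sqrt (real N) \<ge> 0 \<longrightarrow>
     real N powr (real m - 1 / 2) * ginibre_radial m a (bulk_index lam N y) (z N) \<le> C * exp (- (\<sigma> * y) / 2)"
proof -
  \<comment> \<open>Chosen as the point where the limiting slope equals
    \<open>- \<sigma>\<close>.\<close>
  define Y where "Y = (\<kappa> + \<sigma>) * lam / real m"
  have Y: "\<kappa> - real m * Y / lam = - \<sigma>" using m lam by (simp add: Y_def)
  define M where "M = lam powr (1 / 2 - real m) * normal_density 0 (sqrt (real m)) (sqrt lam * (\<kappa> - real m * Y / lam)) + 1"
  have M: "M > 0" unfolding M_def by (simp add: add_nonneg_pos normal_density_nonneg)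
  define d where "d = (\<lambda>N. sqrt (real N) * ln (radial_ratio m a (bulk_index lam N Y) (z N)))"
  have "d \<longlonglongrightarrow> - \<sigma>"
    using radial_ratio_bulk_tendsto[OF lam z kappa, where y = Y] unfolding d_def Y .
  then have "(\<lambda>N. - (\<sigma> * d N)) \<longlonglongrightarrow> - (\<sigma> * - \<sigma>)" by (intro tendsto_intros)
  then have d: "(\<lambda>N. - (\<sigma> * d N)) \<longlonglongrightarrow> 1" using \<sigma> by auto
  have "\<forall>\<^sub>F N in sequentially. real N powr (real m - 1 / 2) * ginibre_radial m a (bulk_index lam N Y) (z N) < M"
    by (rule order_tendstoD(2)[OF ginibre_radial_bulk_tendsto[OF m a lam z kappa, where y = Y]]) (auto simp: M_def)
  then have "\<forall>\<^sub>F N in sequentially. \<forall>y. \<sigma> * y \<ge> 0 \<longrightarrow> lam * real N + y * sqrt (real N) \<ge> 0 \<longrightarrow>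
     real N powr (real m - 1 / 2) * ginibre_radial m a (bulk_index lam N y) (z N) \<le> (M * exp (3 / 2 * (\<bar>Y\<bar> + 1))) * exp (- (\<sigma> * y) / 2)"
    using order_tendstoD(1)[OF d, of "1/2", simplified] order_tendstoD(2)[OF d, of "3/2", simplified]
      eventually_index_nonneg[OF lam, of Y] eventually_gt_at_top[of 0]
  proof eventually_elim
    case (elim N)
    show ?case
    proof (intro allI impI)
      fix y assume y: "\<sigma> * y \<ge> 0" "lam * real N + y * sqrt (real N) \<ge> 0"
      let ?l = "bulk_index lam N y" and ?L = "bulk_index lam N Y"
      let ?r = "radial_ratio m a ?L (z N)"
      define \<tau> where "\<tau> = (real ?l - real ?L) / sqrt (real N)"
      have N: "sqrt (real N) \<ge> 1" "real N > 0" using elim by auto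
      \<comment> \<open>Both indices are rounded down by at most 1, so the rounding errors differ by
        at most 1; this is the 1 in \<open>\<bar>Y\<bar> + 1\<close>.\<close>
      have "\<bar>(real ?l - real ?L) - (y - Y) * sqrt (real N)\<bar> \<le> 1"
        using bulk_index_bounds[OF y(2)] bulk_index_bounds[OF elim(4)] by (simp add: algebra_simps abs_le_iff)
      also have "\<dots> \<le> sqrt (real N)" by fact
      finally have "\<bar>\<tau> - (y - Y)\<bar> \<le> 1"
        using N by (simp add: \<tau>_def field_simps abs_le_iff)
      then have "\<bar>\<sigma> * \<tau> - \<sigma> * (y - Y)\<bar> \<le> 1" using \<sigma> by (auto simp: algebra_simps abs_le_iff)
      moreover have "\<sigma> * Y \<le> \<bar>Y\<bar>" using \<sigma> by auto
      ultimately have \<tau>: "\<sigma> * \<tau> \<ge> \<sigma> * y - (\<bar>Y\<bar> + 1)" by (simp add: algebra_simps abs_le_iff)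
      have "?r powr (real ?l - real ?L) = exp (d N * \<tau>)"
        using radial_ratio_pos[OF z, of ?L N] N by (simp add: powr_def d_def \<tau>_def)
      \<comment> \<open>The scaled slope \<open>- (\<sigma> * d N)\<close> lies between 1/2 and 3/2:
        the lower bound gives the decay in y, the upper bound the price of moving the base point
        from \<open>Y\<close> to 0.\<close>
      also have "d N * \<tau> = - (- (\<sigma> * d N) * (\<sigma> * \<tau>))" using \<sigma> by auto
      also have "\<dots> \<le> - (- (\<sigma> * d N) * (\<sigma> * y - (\<bar>Y\<bar> + 1)))"
        using elim(2) \<tau> by (intro le_imp_neg_le mult_left_mono) auto
      also have "\<dots> = - (- (\<sigma> * d N) * (\<sigma> * y)) + - (\<sigma> * d N) * (\<bar>Y\<bar> + 1)" by (simp add: algebra_simps)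
      also have "\<dots> \<le> - (1 / 2 * (\<sigma> * y)) + 3 / 2 * (\<bar>Y\<bar> + 1)"
        using elim(2,3) y(1) by (intro add_mono le_imp_neg_le mult_right_mono) auto
      finally have r: "?r powr (real ?l - real ?L) \<le> exp (3 / 2 * (\<bar>Y\<bar> + 1)) * exp (- (\<sigma> * y) / 2)"
        by (simp flip: exp_add)
      have "real N powr (real m - 1 / 2) * ginibre_radial m a ?l (z N) \<le>
          real N powr (real m - 1 / 2) * (ginibre_radial m a ?L (z N) * ?r powr (real ?l - real ?L))"
        by (intro mult_left_mono ginibre_radial_le_supporting_line z) auto
      also have "\<dots> = (real N powr (real m - 1 / 2) * ginibre_radial m a ?L (z N)) * ?r powr (real ?l - real ?L)"
        by simp
      also have "\<dots> \<le> M * (exp (3 / 2 * (\<bar>Y\<bar> + 1)) * exp (- (\<sigma> * y) / 2))"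
        using elim(1) M by (intro mult_mono r) auto
      finally show "real N powr (real m - 1 / 2) * ginibre_radial m a ?l (z N) \<le> (M * exp (3 / 2 * (\<bar>Y\<bar> + 1))) * exp (- (\<sigma> * y) / 2)"
        by (simp add: mult_ac)
    qed
  qed
  then show ?thesis by blast
qed

lemma ginibre_radial_bound:
  fixes z :: "nat \<Rightarrow> complex"
  assumes m: "m \<ge> 1" and lam: "lam > 0" and z: "\<And>N. z N \<noteq> 0"
    and kappa: "(\<lambda>N. sqrt (real N) * (ln ((cmod (z N))\<^sup>2) - real m * ln (lam * real N))) \<longlonglongrightarrow> \<kappa>"
  shows "\<exists>C. \<forall>\<^sub>F N in sequentially. \<forall>y. lam * real N + y * sqrt (real N) \<ge> 0 \<longrightarrow>
     real N powr (real m - 1 / 2) * ginibre_radial m a (bulk_index lam N y) (z N) \<le> C * exp (- \<bar>y\<bar> / 2)"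
proof -
  from ginibre_radial_half_bound[OF m lam z kappa, of 1] obtain C1 where C1:
    "\<forall>\<^sub>F N in sequentially. \<forall>y. 1 * y \<ge> 0 \<longrightarrow> lam * real N + y * sqrt (real N) \<ge> 0 \<longrightarrow>
     real N powr (real m - 1 / 2) * ginibre_radial m a (bulk_index lam N y) (z N) \<le> C1 * exp (- (1 * y) / 2)" by auto
  from ginibre_radial_half_bound[OF m lam z kappa, of "- 1"] obtain C2 where C2:
    "\<forall>\<^sub>F N in sequentially. \<forall>y. - 1 * y \<ge> 0 \<longrightarrow> lam * real N + y * sqrt (real N) \<ge> 0 \<longrightarrow>
     real N powr (real m - 1 / 2) * ginibre_radial m a (bulk_index lam N y) (z N) \<le> C2 * exp (- (- 1 * y) / 2)" by auto
  have "\<forall>\<^sub>F N in sequentially. \<forall>y. lam * real N + y * sqrt (real N) \<ge> 0 \<longrightarrow>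
     real N powr (real m - 1 / 2) * ginibre_radial m a (bulk_index lam N y) (z N) \<le> max C1 C2 * exp (- \<bar>y\<bar> / 2)"
    using C1 C2
  proof eventually_elim
    case (elim N)
    show ?case
    proof (intro allI impI)
      fix y assume y: "lam * real N + y * sqrt (real N) \<ge> 0"
      let ?f = "real N powr (real m - 1 / 2) * ginibre_radial m a (bulk_index lam N y) (z N)"
      have "?f \<le> C1 * exp (- \<bar>y\<bar> / 2) \<or> ?f \<le> C2 * exp (- \<bar>y\<bar> / 2)"
      proof (cases "y \<ge> 0")
        case True
        then show ?thesis using elim(1)[rule_format, of y] y by simp
      next
        case False
        then show ?thesis using elim(2)[rule_format, of y] y by simp
      qed
      moreover have "C1 * exp (- \<bar>y\<bar> / 2) \<le> max C1 C2 * exp (- \<bar>y\<bar> / 2)" "C2 * exp (- \<bar>y\<bar> / 2) \<le> max C1 C2 * exp (- \<bar>y\<bar> / 2)"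
        by (intro mult_right_mono; simp)+
      ultimately show "?f \<le> max C1 C2 * exp (- \<bar>y\<bar> / 2)" by linarith
    qed
  qed
  then show ?thesis by blast
qed

end

subsection \<open>Gaussian integrals and the complex error function\<close>

text \<open>An entire function has a primitive on the whole plane, so the segment integral is a
  difference of two of its values.\<close>

lemma cerf_has_field_derivative:
  "(cerf has_field_derivative 2 / of_real (sqrt pi) * exp (- (z\<^sup>2))) (at z)"
proof -
  define f where "f = (\<lambda>t::complex. exp (- (t\<^sup>2)))"
  obtain G where "\<And>x. x \<in> UNIV \<Longrightarrow> (G has_field_derivative f x) (at x within UNIV)"
  proof (rule holomorphic_convex_primitive[of UNIV "{}" f])
    show "f field_differentiable at x" for x
      unfolding f_def by (intro holomorphic_on_imp_differentiable_at[of _ UNIV] holomorphic_intros) auto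
  qed (auto simp: f_def intro!: continuous_intros)
  then have G: "\<And>x. (G has_field_derivative f x) (at x)" by simp
  have "cerf w = 2 / of_real (sqrt pi) * (G w - G 0)" for w
  proof -
    have "(f has_contour_integral (G (pathfinish (linepath 0 w)) - G (pathstart (linepath 0 w)))) (linepath 0 w)"
      by (rule contour_integral_primitive[where S = UNIV, OF _ valid_path_linepath]) (use G in auto)
    then have "contour_integral (linepath 0 w) f = G w - G 0"
      by (simp add: contour_integral_unique)
    then show ?thesis by (simp add: cerf_def f_def)
  qed
  then have eq: "cerf = (\<lambda>w. 2 / of_real (sqrt pi) * (G w - G 0))" by blast
  have "((\<lambda>w. 2 / of_real (sqrt pi) * (G w - G 0)) has_field_derivative 2 / of_real (sqrt pi) * (f z - 0)) (at z)"
    by (intro DERIV_cmult DERIV_diff G DERIV_const)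
  then show ?thesis
    unfolding eq f_def diff_zero .
qed

lemma cerf_0 [simp]: "cerf 0 = 0"
  by (simp add: cerf_def)

lemma cerf_minus: "cerf (- z) = - cerf z"
proof -
  have "((\<lambda>z. cerf z + cerf (- z)) has_field_derivative 0) (at x)" for x
  proof -
    have "((\<lambda>z. cerf (- z)) has_field_derivative (2 / of_real (sqrt pi) * exp (- ((- x)\<^sup>2))) * (- 1)) (at x)"
      by (rule DERIV_chain2[OF cerf_has_field_derivative]) (auto intro!: derivative_eq_intros)
    from DERIV_add[OF cerf_has_field_derivative[of x] this] show ?thesis by simp
  qed
  then obtain c where "\<And>z. cerf z + cerf (- z) = c"
    using has_field_derivative_zero_constant[of UNIV "\<lambda>z. cerf z + cerf (- z)"] by auto
  from this[of z] this[of 0] show ?thesis by (simp add: add_eq_0_iff)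
qed

lemma integrable_gaussian_linear:
  "integrable lborel (\<lambda>t::real. exp (of_real (- t\<^sup>2 / 2) + of_real t * c :: complex))"
proof (rule Bochner_Integration.integrable_bound)
  show "integrable lborel (\<lambda>t. sqrt (2 * pi) * exp ((Re c)\<^sup>2 / 2) * normal_density (Re c) 1 t)"
    by (intro integrable_mult_right) simp
  show "AE t in lborel. norm (exp (of_real (- t\<^sup>2 / 2) + of_real t * c :: complex))
      \<le> norm (sqrt (2 * pi) * exp ((Re c)\<^sup>2 / 2) * normal_density (Re c) 1 t)"
  proof (intro AE_I2)
    fix t :: real
    have "sqrt (2 * pi) * exp ((Re c)\<^sup>2 / 2) * normal_density (Re c) 1 t = exp ((Re c)\<^sup>2 / 2) * exp (- (t - Re c)\<^sup>2 / 2)"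
      by (simp add: normal_density_def)
    also have "\<dots> = exp (- t\<^sup>2 / 2 + t * Re c)"
      unfolding exp_add[symmetric] by (simp add: power2_eq_square field_simps)
    finally show "norm (exp (of_real (- t\<^sup>2 / 2) + of_real t * c :: complex))
      \<le> norm (sqrt (2 * pi) * exp ((Re c)\<^sup>2 / 2) * normal_density (Re c) 1 t)"
      by simp
  qed
qed measurable

lemma cerf_real_tendsto: "(\<lambda>n. cerf (of_real (d * real n))) \<longlonglongrightarrow> 1" if "d > 0"
proof -
  let ?f = "\<lambda>t::real. 2 / of_real (sqrt pi) * exp (- ((of_real t)\<^sup>2)) :: complex"
  have hb: "has_bochner_integral lborel (\<lambda>t. 2 / sqrt pi * (indicator {0..} t *\<^sub>R exp (- t\<^sup>2))) (2 / sqrt pi * (sqrt pi / 2))"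
    by (intro has_bochner_integral_mult_right gaussian_moment_0)
  have "(\<lambda>t::real. of_real (2 / sqrt pi * (indicator {0..} t *\<^sub>R exp (- t\<^sup>2))) :: complex) = (\<lambda>t. indicator {0..} t *\<^sub>R ?f t)"
    by (auto simp: fun_eq_iff exp_of_real[symmetric] split: split_indicator)
  then have hb': "has_bochner_integral lborel (\<lambda>t. indicator {0..} t *\<^sub>R ?f t) 1"
    using has_bochner_integral_of_real[OF hb, where 'a = complex] by simp
  have FTC: "(\<integral>t. indicator {0..d * real n} t *\<^sub>R ?f t \<partial>lborel) = cerf (of_real (d * real n)) - cerf (of_real 0)" for n
  proof (rule integral_FTC_Icc)
    show "((\<lambda>x. cerf (of_real x)) has_vector_derivative ?f x) (at x within {0..d * real n})" for x
      by (rule has_vector_derivative_real_field[OF cerf_has_field_derivative])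
    show "continuous_on {0..d * real n} ?f"
      by (intro continuous_intros) auto
  qed (use that in auto)
  have "(\<lambda>n. \<integral>t. indicator {0..d * real n} t *\<^sub>R ?f t \<partial>lborel) \<longlonglongrightarrow> (\<integral>t. indicator {0..} t *\<^sub>R ?f t \<partial>lborel)"
  proof (rule integral_dominated_convergence[where w = "\<lambda>t. norm (indicator {0..} t *\<^sub>R ?f t)"])
    show "AE t in lborel. (\<lambda>n. indicator {0..d * real n} t *\<^sub>R ?f t) \<longlonglongrightarrow> indicator {0..} t *\<^sub>R ?f t"
    proof (intro AE_I2)
      fix t :: real
      have "\<forall>\<^sub>F n in sequentially. d * real n \<ge> t"
        using that by real_asymp
      then have "\<forall>\<^sub>F n in sequentially. indicator {0..d * real n} t *\<^sub>R ?f t = indicator {0..} t *\<^sub>R ?f t"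
        by eventually_elim (auto split: split_indicator)
      then show "(\<lambda>n. indicator {0..d * real n} t *\<^sub>R ?f t) \<longlonglongrightarrow> indicator {0..} t *\<^sub>R ?f t"
        by (rule tendsto_eventually)
    qed
    show "integrable lborel (\<lambda>t. norm (indicator {0..} t *\<^sub>R ?f t))"
      using hb' by (intro integrable_norm) (auto simp: has_bochner_integral_iff)
  qed (auto split: split_indicator)
  then show ?thesis
    unfolding FTC using hb' by (simp add: has_bochner_integral_iff)
qed

text \<open>On the segment from x = d n to x + w one has Re (z^2) \<ge> (x - |w|)^2 - |w|^2 as soon
  as x \<ge> |w|. The derivative of \<open>cerf\<close> is thus negligible there, and the limit
  along the real axis carries over to the shifted line.\<close>

lemma cerf_shift_tendsto:
  assumes "d > 0"
  shows "(\<lambda>n. cerf (of_real (d * real n) + w)) \<longlonglongrightarrow> 1"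
proof -
  define B where "B = (\<lambda>n. 2 / sqrt pi * exp ((cmod w)\<^sup>2 - (d * real n - cmod w)\<^sup>2) * cmod w)"
  have "B \<longlonglongrightarrow> 0"
    unfolding B_def using assms by real_asymp
  moreover have "\<forall>\<^sub>F n in sequentially. norm (cerf (of_real (d * real n) + w) - cerf (of_real (d * real n))) \<le> B n"
  proof -
    have "\<forall>\<^sub>F n in sequentially. d * real n \<ge> cmod w"
      using assms by real_asymp
    then show ?thesis
    proof eventually_elim
      case (elim n)
      let ?x = "of_real (d * real n) :: complex"
      have "norm (cerf (?x + w) - cerf ?x) \<le> (2 / sqrt pi * exp ((cmod w)\<^sup>2 - (d * real n - cmod w)\<^sup>2)) * norm ((?x + w) - ?x)"
      proof (rule field_differentiable_bound[where S = "closed_segment ?x (?x + w)"])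
        fix z assume "z \<in> closed_segment ?x (?x + w)"
        then obtain s where s: "0 \<le> s" "s \<le> 1" "z = ?x + of_real s * w"
          by (auto simp: in_segment scaleR_conv_of_real algebra_simps)
        show "(cerf has_field_derivative 2 / of_real (sqrt pi) * exp (- (z\<^sup>2))) (at z within closed_segment ?x (?x + w))"
          by (rule has_field_derivative_at_within[OF cerf_has_field_derivative])
        have sw: "\<bar>s * Re w\<bar> \<le> cmod w" "\<bar>s * Im w\<bar> \<le> cmod w"
          using s abs_Re_le_cmod[of w] abs_Im_le_cmod[of w] mult_mono[of s 1 "\<bar>Re w\<bar>" "cmod w"] mult_mono[of s 1 "\<bar>Im w\<bar>" "cmod w"]
          by (auto simp: abs_mult)
        have "d * real n - cmod w \<le> d * real n + s * Re w" using sw by (simp add: abs_le_iff)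
        then have "(d * real n - cmod w)\<^sup>2 \<le> (d * real n + s * Re w)\<^sup>2"
          using elim by (intro power_mono) auto
        moreover have "(s * Im w)\<^sup>2 \<le> (cmod w)\<^sup>2"
          using sw abs_le_square_iff[of "s * Im w" "cmod w"] by simp
        moreover have "Re (- (z\<^sup>2)) = (s * Im w)\<^sup>2 - (d * real n + s * Re w)\<^sup>2"
          by (simp add: s(3) power2_eq_square)
        ultimately have "Re (- (z\<^sup>2)) \<le> (cmod w)\<^sup>2 - (d * real n - cmod w)\<^sup>2" by linarith
        then have "cmod (exp (- (z\<^sup>2))) \<le> exp ((cmod w)\<^sup>2 - (d * real n - cmod w)\<^sup>2)"
          unfolding norm_exp_eq_Re by simp
        then show "norm (2 / of_real (sqrt pi) * exp (- (z\<^sup>2))) \<le> 2 / sqrt pi * exp ((cmod w)\<^sup>2 - (d * real n - cmod w)\<^sup>2)"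
          unfolding norm_mult by (intro mult_mono) (auto simp: norm_divide)
      qed auto
      then show ?case by (simp add: B_def)
    qed
  qed
  ultimately have "(\<lambda>n. cerf (of_real (d * real n) + w) - cerf (of_real (d * real n))) \<longlonglongrightarrow> 0"
    by (rule Lim_null_comparison[rotated])
  from tendsto_add[OF this cerf_real_tendsto[OF assms]] show ?thesis by simp
qed

context
  fixes c :: complex
begin

text \<open>A primitive of exp (- t^2 / 2 + t c), found by completing the square: the exponent is
  c^2 / 2 - (t - c)^2 / 2.\<close>

definition gaussian_primitive :: "real \<Rightarrow> complex" where
  "gaussian_primitive t = of_real (sqrt (pi / 2)) * exp (c\<^sup>2 / 2) * cerf ((of_real t - c) / of_real (sqrt 2))"

lemma gaussian_primitive_FTC:
  assumes "A \<le> B"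
  shows "(\<integral>t. indicator {A..B} t *\<^sub>R exp (of_real (- t\<^sup>2 / 2) + of_real t * c) \<partial>lborel) = gaussian_primitive B - gaussian_primitive A"
proof (rule integral_FTC_Icc[OF assms])
  fix t :: real
  define s where "s = complex_of_real (sqrt 2)"
  have s: "s\<^sup>2 = 2" "s \<noteq> 0" by (simp_all add: s_def flip: of_real_power)
  have "((\<lambda>w. (w - c) / s) has_field_derivative 1 / s) (at (of_real t))"
    using s by (auto intro!: derivative_eq_intros)
  from DERIV_chain2[OF cerf_has_field_derivative this]
  have "((\<lambda>w. of_real (sqrt (pi / 2)) * exp (c\<^sup>2 / 2) * cerf ((w - c) / s)) has_field_derivative
     of_real (sqrt (pi / 2)) * exp (c\<^sup>2 / 2) * (2 / of_real (sqrt pi) * exp (- (((of_real t - c) / s)\<^sup>2)) * (1 / s))) (at (of_real t))"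
    by (rule DERIV_cmult)
  also have "of_real (sqrt (pi / 2)) * exp (c\<^sup>2 / 2) * (2 / of_real (sqrt pi) * exp (- (((of_real t - c) / s)\<^sup>2)) * (1 / s)) =
     exp (of_real (- t\<^sup>2 / 2) + of_real t * c)"
  proof -
    have "of_real (sqrt (pi / 2)) * (2 / of_real (sqrt pi) * (1 / s)) = 1"
      using s by (simp add: real_sqrt_divide s_def[symmetric] power2_eq_square)
    moreover have "exp (c\<^sup>2 / 2) * exp (- (((of_real t - c) / s)\<^sup>2)) = exp (of_real (- t\<^sup>2 / 2) + of_real t * c)"
      unfolding exp_add[symmetric] power_divide s(1) by (simp add: power2_eq_square field_simps)
    ultimately show ?thesis by algebra
  qed
  finally have "((\<lambda>w. of_real (sqrt (pi / 2)) * exp (c\<^sup>2 / 2) * cerf ((w - c) / s)) has_field_derivative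
     exp (of_real (- t\<^sup>2 / 2) + of_real t * c)) (at (of_real t))" .
  from has_vector_derivative_real_field[OF this]
  show "(gaussian_primitive has_vector_derivative exp (of_real (- t\<^sup>2 / 2) + of_real t * c)) (at t within {A..B})"
    unfolding gaussian_primitive_def s_def .
next
  show "continuous_on {A..B} (\<lambda>t. exp (of_real (- t\<^sup>2 / 2) + of_real t * c))"
    by (intro continuous_intros) auto
qed

lemma gaussian_primitive_at_top:
  "(\<lambda>n. gaussian_primitive (real n)) \<longlonglongrightarrow> of_real (sqrt (pi / 2)) * exp (c\<^sup>2 / 2)"
proof -
  have "(\<lambda>n. cerf (of_real (1 / sqrt 2 * real n) + (- c / of_real (sqrt 2)))) \<longlonglongrightarrow> 1"
    by (rule cerf_shift_tendsto) simp
  from tendsto_mult[OF tendsto_const[of "of_real (sqrt (pi / 2)) * exp (c\<^sup>2 / 2)"] this]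
  show ?thesis unfolding gaussian_primitive_def by (simp add: diff_divide_distrib)
qed

lemma gaussian_primitive_at_bot:
  "(\<lambda>n. gaussian_primitive (- real n)) \<longlonglongrightarrow> - of_real (sqrt (pi / 2)) * exp (c\<^sup>2 / 2)"
proof -
  have eq: "cerf ((of_real (- real n) - c) / of_real (sqrt 2)) = - cerf (of_real (1 / sqrt 2 * real n) + c / of_real (sqrt 2))" for n
    unfolding cerf_minus[symmetric] by (simp add: add_divide_distrib diff_divide_distrib)
  have "(\<lambda>n. cerf (of_real (1 / sqrt 2 * real n) + c / of_real (sqrt 2))) \<longlonglongrightarrow> 1"
    by (rule cerf_shift_tendsto) simp
  from tendsto_mult[OF tendsto_const[of "of_real (sqrt (pi / 2)) * exp (c\<^sup>2 / 2)"] tendsto_minus[OF this]]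
  show ?thesis unfolding gaussian_primitive_def eq by simp
qed

lemma gaussian_half_line_integral:
  "(\<integral>t. indicator {..<0} t *\<^sub>R exp (of_real (- t\<^sup>2 / 2) + of_real t * c) \<partial>lborel) =
     of_real (sqrt (pi / 2)) * exp (c\<^sup>2 / 2) * cerfc (c / of_real (sqrt 2))"
proof -
  let ?f = "\<lambda>t. exp (of_real (- t\<^sup>2 / 2) + of_real t * c)"
  have "(\<lambda>n. \<integral>t. indicator {- real n..0} t *\<^sub>R ?f t \<partial>lborel) \<longlonglongrightarrow> (\<integral>t. indicator {..<0} t *\<^sub>R ?f t \<partial>lborel)"
  proof (rule integral_dominated_convergence[where w = "\<lambda>t. norm (?f t)"])
    \<comment> \<open>The limit set is open at 0, as dictated by the strict bound l < N, while the
      fundamental theorem uses closed intervals; they differ by a null set.\<close>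
    have "AE t in lborel. t \<noteq> (0::real)" by (rule AE_lborel_singleton)
    then show "AE t in lborel. (\<lambda>n. indicator {- real n..0} t *\<^sub>R ?f t) \<longlonglongrightarrow> indicator {..<0} t *\<^sub>R ?f t"
    proof eventually_elim
      case (elim t)
      have "\<forall>\<^sub>F n in sequentially. - real n \<le> t" by real_asymp
      then have "\<forall>\<^sub>F n in sequentially. indicator {- real n..0} t *\<^sub>R ?f t = indicator {..<0} t *\<^sub>R ?f t"
        by eventually_elim (use elim in \<open>auto split: split_indicator\<close>)
      then show ?case by (rule tendsto_eventually)
    qed
    show "integrable lborel (\<lambda>t. norm (?f t))"
      by (intro integrable_norm integrable_gaussian_linear)
  qed (auto split: split_indicator)
  moreover have "(\<lambda>n. \<integral>t. indicator {- real n..0} t *\<^sub>R ?f t \<partial>lborel) \<longlonglongrightarrow> gaussian_primitive 0 - (- of_real (sqrt (pi / 2)) * exp (c\<^sup>2 / 2))"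
  proof -
    have FTC: "(\<integral>t. indicator {- real n..0} t *\<^sub>R ?f t \<partial>lborel) = gaussian_primitive 0 - gaussian_primitive (- real n)" for n
      by (rule gaussian_primitive_FTC) simp
    show ?thesis
      unfolding FTC by (rule tendsto_diff[OF tendsto_const gaussian_primitive_at_bot])
  qed
  ultimately have "(\<integral>t. indicator {..<0} t *\<^sub>R ?f t \<partial>lborel) = gaussian_primitive 0 - (- of_real (sqrt (pi / 2)) * exp (c\<^sup>2 / 2))"
    by (rule LIMSEQ_unique)
  then show ?thesis
    using cerf_minus[of "c / of_real (sqrt 2)"]
    by (simp add: gaussian_primitive_def cerfc_def algebra_simps)
qed

lemma gaussian_line_integral:
  "(\<integral>t. exp (of_real (- t\<^sup>2 / 2) + of_real t * c) \<partial>lborel) = of_real (sqrt (2 * pi)) * exp (c\<^sup>2 / 2)"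
proof -
  let ?f = "\<lambda>t. exp (of_real (- t\<^sup>2 / 2) + of_real t * c)"
  have "(\<lambda>n. \<integral>t. indicator {- real n..real n} t *\<^sub>R ?f t \<partial>lborel) \<longlonglongrightarrow> (\<integral>t. ?f t \<partial>lborel)"
  proof (rule integral_dominated_convergence[where w = "\<lambda>t. norm (?f t)"])
    show "AE t in lborel. (\<lambda>n. indicator {- real n..real n} t *\<^sub>R ?f t) \<longlonglongrightarrow> ?f t"
    proof (intro AE_I2)
      fix t :: real
      have "\<forall>\<^sub>F n in sequentially. - real n \<le> t" "\<forall>\<^sub>F n in sequentially. t \<le> real n" by real_asymp+
      then have "\<forall>\<^sub>F n in sequentially. indicator {- real n..real n} t *\<^sub>R ?f t = ?f t"
        by eventually_elim auto
      then show "(\<lambda>n. indicator {- real n..real n} t *\<^sub>R ?f t) \<longlonglongrightarrow> ?f t"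
        by (rule tendsto_eventually)
    qed
    show "integrable lborel (\<lambda>t. norm (?f t))"
      by (intro integrable_norm integrable_gaussian_linear)
  qed (auto split: split_indicator)
  moreover have "(\<lambda>n. \<integral>t. indicator {- real n..real n} t *\<^sub>R ?f t \<partial>lborel) \<longlonglongrightarrow>
      of_real (sqrt (pi / 2)) * exp (c\<^sup>2 / 2) - (- of_real (sqrt (pi / 2)) * exp (c\<^sup>2 / 2))"
  proof -
    have FTC: "(\<integral>t. indicator {- real n..real n} t *\<^sub>R ?f t \<partial>lborel) = gaussian_primitive (real n) - gaussian_primitive (- real n)" for n
      by (rule gaussian_primitive_FTC) simp
    show ?thesis
      unfolding FTC by (rule tendsto_diff[OF gaussian_primitive_at_top gaussian_primitive_at_bot])
  qed
  ultimately have "(\<integral>t. ?f t \<partial>lborel) = of_real (sqrt (pi / 2)) * exp (c\<^sup>2 / 2) - (- of_real (sqrt (pi / 2)) * exp (c\<^sup>2 / 2))"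
    by (rule LIMSEQ_unique)
  also have "\<dots> = of_real (2 * sqrt (pi / 2)) * exp (c\<^sup>2 / 2)" by simp
  also have "2 * sqrt (pi / 2) = sqrt (2 * pi)"
    by (simp add: real_sqrt_divide real_sqrt_mult real_div_sqrt field_simps)
  finally show ?thesis .
qed

end

subsection \<open>Asymptotics of the kernel\<close>

text \<open>Written as an integral, the sum admits an affine substitution and dominated convergence.
  The cut-off l < N survives as the indicator of a half-open interval, which decides between the
  whole line and the half line in the limit.\<close>

lemma sum_eq_integral_floor:
  fixes F :: "nat \<Rightarrow> complex"
  shows "(\<Sum>l<N. F l) = (\<integral>t. indicator {0..<real N} t *\<^sub>R F (nat \<lfloor>t\<rfloor>) \<partial>lborel)"
proof -
  have eq: "indicator {0..<real N} t *\<^sub>R F (nat \<lfloor>t\<rfloor>) = (\<Sum>l<N. indicator {real l..<real l + 1} t *\<^sub>R F l)" for t :: real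
  proof (cases "t \<in> {0..<real N}")
    case True
    define k where "k = nat \<lfloor>t\<rfloor>"
    have k: "k < N" "real k \<le> t" "t < real k + 1"
      using True by (auto simp: k_def) linarith+
    have "(\<Sum>l<N. indicator {real l..<real l + 1} t *\<^sub>R F l) = (\<Sum>l<N. if l = k then F k else 0)"
      using k by (intro sum.cong) (auto split: split_indicator)
    also have "\<dots> = F k" using k by simp
    finally show ?thesis using True by (simp add: k_def)
  next
    case False
    then have "indicator {real l..<real l + 1} t = (0::real)" if "l < N" for l
      using that by (auto split: split_indicator)
    then have "(\<Sum>l<N. indicator {real l..<real l + 1} t *\<^sub>R F l) = 0" by (intro sum.neutral) auto
    then show ?thesis using False by simp
  qed
  have "(\<integral>t. (\<Sum>l<N. indicator {real l..<real l + 1} t *\<^sub>R F l) \<partial>lborel) = (\<Sum>l<N. F l)"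
    by (subst Bochner_Integration.integral_sum) auto
  then show ?thesis by (simp add: eq)
qed

lemma integrable_exp_abs_half: "integrable lborel (\<lambda>y::real. C * exp (- \<bar>y\<bar> / 2))"
proof -
  have "integrable lborel (\<lambda>y::real. exp (- \<bar>y\<bar>))"
    by (rule integrableI_bounded) (use nn_integral_exp_abs in auto)
  from lborel_integrable_real_affine[OF this, of "1 / 2" 0]
  show ?thesis by (intro integrable_mult_right) (simp add: abs_mult)
qed

text \<open>The weight depends on the modulus only, so each term is a geometric mean of two radial
  densities times a phase. Arbitrary arguments are allowed instead of principal ones, so that they
  can later be chosen without jumps.\<close>

lemma ginibre_kernel_eq_sum:
  assumes a: "\<And>k. k \<in> {1..m} \<Longrightarrow> a k > -1"
    and z: "z = rcis (cmod z) \<psi>" and z': "z' = rcis (cmod z') \<psi>'"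
  shows "ginibre_kernel m a N z z' = of_real (1 / pi) *
    (\<Sum>l<N. of_real (sqrt (ginibre_radial m a l z) * sqrt (ginibre_radial m a l z')) * cis (real l * (\<psi> - \<psi>')))"
  unfolding ginibre_kernel_def sum_distrib_left
proof (intro sum.cong refl)
  fix l
  define P where "P = (\<Prod>k=1..m. Gamma (a k + 1) / Gamma (a k + real l + 1))"
  have "Gamma (a k + real l + 1) > 0" if "k \<in> {1..m}" for k l
    by (rule Gamma_param_pos[OF a that])
  from this[of _ 0] this[of _ l] have P: "P \<ge> 0"
    unfolding P_def by (intro prod_nonneg) (auto simp: less_imp_le)
  have w: "ginibre_weight m a (cnj z') = ginibre_weight m a z'"
    by (simp add: ginibre_weight_def)
  have "z * cnj z' = rcis (cmod z) \<psi> * cnj (rcis (cmod z') \<psi>')"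
    using z z' by simp
  also have "\<dots> = rcis (cmod z * cmod z') (\<psi> - \<psi>')"
    by (simp add: rcis_def cis_cnj cis_mult mult_ac)
  finally have pow: "(z * cnj z') ^ l = of_real ((cmod z * cmod z') ^ l) * cis (real l * (\<psi> - \<psi>'))"
    by (simp add: rcis_def power_mult_distrib Complex.DeMoivre)
  have "sqrt (ginibre_radial m a l z) * sqrt (ginibre_radial m a l z') =
    sqrt ((pi * P * (cmod z * cmod z') ^ l)\<^sup>2 * (ginibre_weight m a z * ginibre_weight m a z'))"
    unfolding ginibre_radial_def P_def[symmetric] real_sqrt_mult[symmetric]
    by (rule arg_cong[where f = sqrt]) (simp add: power2_eq_square power_mult_distrib mult_ac)
  also have "\<dots> = pi * P * (cmod z * cmod z') ^ l * sqrt (ginibre_weight m a z * ginibre_weight m a z')"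
    using P by (simp only: real_sqrt_mult[of "_\<^sup>2"] real_sqrt_abs) simp
  finally show "of_real (sqrt (ginibre_weight m a z * ginibre_weight m a (cnj z'))) *
      (of_real (\<Prod>k=1..m. Gamma (a k + 1) / Gamma (a k + real l + 1)) * (z * cnj z') ^ l) =
    of_real (1 / pi) * (of_real (sqrt (ginibre_radial m a l z) * sqrt (ginibre_radial m a l z')) * cis (real l * (\<psi> - \<psi>')))"
    unfolding w pow P_def[symmetric] by simp
qed

text \<open>With l = lam N + y sqrt N the phase l (\<psi> - \<psi>') splits into lam N (\<psi> -
  \<psi>'), which in general has no limit and is divided out, and a part tending to y \<delta>. Of
  the power N^(m - 1/2) that the radial densities need, sqrt N is supplied by the spacing of the
  indices, which leaves N^(m - 1). The condition l < N puts no bound on y if lam < 1 and becomes y <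
  0 if lam = 1.\<close>

theorem ginibre_kernel_tendsto:
  fixes z z' :: "nat \<Rightarrow> complex" and \<psi> \<psi>' :: "nat \<Rightarrow> real"
  assumes m: "m \<ge> 1" and a: "\<And>k. k \<in> {1..m} \<Longrightarrow> a k > -1" and lam: "lam > 0" "lam \<le> 1"
    and z: "\<And>N. z N \<noteq> 0" "\<And>N. z N = rcis (cmod (z N)) (\<psi> N)"
    and z': "\<And>N. z' N \<noteq> 0" "\<And>N. z' N = rcis (cmod (z' N)) (\<psi>' N)"
    and kappa: "(\<lambda>N. sqrt (real N) * (ln ((cmod (z N))\<^sup>2) - real m * ln (lam * real N))) \<longlonglongrightarrow> \<kappa>"
    and kappa': "(\<lambda>N. sqrt (real N) * (ln ((cmod (z' N))\<^sup>2) - real m * ln (lam * real N))) \<longlonglongrightarrow> \<kappa>'"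
    and delta: "(\<lambda>N. sqrt (real N) * (\<psi> N - \<psi>' N)) \<longlonglongrightarrow> \<delta>"
  defines "f \<equiv> \<lambda>\<kappa> y. lam powr (1 / 2 - real m) * normal_density 0 (sqrt (real m)) (sqrt lam * (\<kappa> - real m * y / lam))"
  shows "(\<lambda>N. of_real (real N ^ (m - 1)) * ginibre_kernel m a N (z N) (z' N) * cis (- (lam * real N * (\<psi> N - \<psi>' N))))
    \<longlonglongrightarrow> of_real (1 / pi) * (\<integral>y. indicator (if lam < 1 then UNIV else {..<0}) y *\<^sub>R
        (of_real (sqrt (f \<kappa> y) * sqrt (f \<kappa>' y)) * cis (y * \<delta>)) \<partial>lborel)"
proof -
  define B :: "real set" where "B = (if lam < 1 then UNIV else {..<0})"
  define g where "g = (\<lambda>z N l. real N powr (real m - 1 / 2) * ginibre_radial m a l (z N))"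
  define F where "F = (\<lambda>N l. of_real (sqrt (g z N l) * sqrt (g z' N l)) * cis ((real l - lam * real N) * (\<psi> N - \<psi>' N)))"
  define T where "T = (\<lambda>N y. indicator {0..<real N} (lam * real N + y * sqrt (real N)) *\<^sub>R F N (bulk_index lam N y))"
  have g0: "g z N l \<ge> 0" for z N l
    unfolding g_def using ginibre_radial_nonneg[OF a] by simp
  have kernel: "of_real (real N ^ (m - 1)) * ginibre_kernel m a N (z N) (z' N) * cis (- (lam * real N * (\<psi> N - \<psi>' N))) =
      of_real (1 / pi) * (\<integral>y. T N y \<partial>lborel)" if N: "N > 0" for N
  proof -
    have Fl: "F N l = of_real (real N ^ (m - 1) * sqrt (real N)) * (of_real (sqrt (ginibre_radial m a l (z N)) * sqrt (ginibre_radial m a l (z' N))) *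
        cis (real l * (\<psi> N - \<psi>' N))) * cis (- (lam * real N * (\<psi> N - \<psi>' N)))" for l
    proof -
      have "sqrt (g z N l) * sqrt (g z' N l) = sqrt ((real N powr (real m - 1 / 2))\<^sup>2) *
          (sqrt (ginibre_radial m a l (z N)) * sqrt (ginibre_radial m a l (z' N)))"
        unfolding g_def real_sqrt_mult[symmetric] by (simp add: power2_eq_square mult_ac)
      also have "sqrt ((real N powr (real m - 1 / 2))\<^sup>2) = real N powr (real (m - 1) + 1 / 2)"
        using m by (simp add: of_nat_diff)
      also have "\<dots> = real N ^ (m - 1) * sqrt (real N)"
        unfolding powr_add using N by (simp add: powr_realpow powr_half_sqrt)
      finally have 1: "sqrt (g z N l) * sqrt (g z' N l) = real N ^ (m - 1) * sqrt (real N) *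
          (sqrt (ginibre_radial m a l (z N)) * sqrt (ginibre_radial m a l (z' N)))" .
      have 2: "cis ((real l - lam * real N) * (\<psi> N - \<psi>' N)) = cis (real l * (\<psi> N - \<psi>' N)) * cis (- (lam * real N * (\<psi> N - \<psi>' N)))"
        unfolding cis_mult by (simp add: algebra_simps)
      show ?thesis unfolding F_def 1 2 by simp
    qed
    have K: "of_real pi * ginibre_kernel m a N (z N) (z' N) =
      (\<Sum>l<N. of_real (sqrt (ginibre_radial m a l (z N)) * sqrt (ginibre_radial m a l (z' N))) * cis (real l * (\<psi> N - \<psi>' N)))"
      by (subst ginibre_kernel_eq_sum[where a = a, OF a z(2)[of N] z'(2)[of N]]) auto
    have "(\<Sum>l<N. F N l) = \<bar>sqrt (real N)\<bar> *\<^sub>R (\<integral>y. indicator {0..<real N} (lam * real N + sqrt (real N) * y) *\<^sub>R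
        F N (nat \<lfloor>lam * real N + sqrt (real N) * y\<rfloor>) \<partial>lborel)"
      unfolding sum_eq_integral_floor using N by (intro lborel_integral_real_affine) auto
    also have "\<dots> = of_real (sqrt (real N)) * (\<integral>y. T N y \<partial>lborel)"
      by (simp add: T_def bulk_index_def scaleR_conv_of_real mult.commute)
    finally have "of_real (sqrt (real N)) * (\<integral>y. T N y \<partial>lborel) = (\<Sum>l<N. F N l)" ..
    also have "\<dots> = of_real (real N ^ (m - 1) * sqrt (real N)) * (of_real pi * ginibre_kernel m a N (z N) (z' N)) * cis (- (lam * real N * (\<psi> N - \<psi>' N)))"
      unfolding Fl K sum_distrib_left[symmetric] sum_distrib_right[symmetric] ..
    finally show ?thesis using N by (simp add: field_simps)
  qed
  have gz: "(\<lambda>N. g z N (bulk_index lam N y)) \<longlonglongrightarrow> f \<kappa> y" for y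
    unfolding g_def f_def by (rule ginibre_radial_bulk_tendsto[OF m a lam(1) z(1) kappa])
  have gz': "(\<lambda>N. g z' N (bulk_index lam N y)) \<longlonglongrightarrow> f \<kappa>' y" for y
    unfolding g_def f_def by (rule ginibre_radial_bulk_tendsto[OF m a lam(1) z'(1) kappa'])
  from ginibre_radial_bound[where a = a, OF a m lam(1) z(1) kappa] obtain C where C: "\<forall>\<^sub>F N in sequentially. \<forall>y. lam * real N + y * sqrt (real N) \<ge> 0 \<longrightarrow>
     g z N (bulk_index lam N y) \<le> C * exp (- \<bar>y\<bar> / 2)" unfolding g_def by blast
  from ginibre_radial_bound[where a = a, OF a m lam(1) z'(1) kappa'] obtain C' where C': "\<forall>\<^sub>F N in sequentially. \<forall>y. lam * real N + y * sqrt (real N) \<ge> 0 \<longrightarrow>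
     g z' N (bulk_index lam N y) \<le> C' * exp (- \<bar>y\<bar> / 2)" unfolding g_def by blast
  \<comment> \<open>The maximum with 0 makes the bound valid also where the indicator in
    \<open>T\<close> vanishes.\<close>
  define D where "D = max 0 (max C C')"
  have "\<forall>\<^sub>F N in sequentially. N > 0 \<and> (\<forall>y. norm (T N y) \<le> D * exp (- \<bar>y\<bar> / 2))"
    using C C' eventually_gt_at_top[of 0]
  proof eventually_elim
    case (elim N)
    have "norm (T N y) \<le> D * exp (- \<bar>y\<bar> / 2)" for y
    proof (cases "lam * real N + y * sqrt (real N) \<in> {0..<real N}")
      case True
      let ?l = "bulk_index lam N y"
      have "C * exp (- \<bar>y\<bar> / 2) \<le> D * exp (- \<bar>y\<bar> / 2)" "C' * exp (- \<bar>y\<bar> / 2) \<le> D * exp (- \<bar>y\<bar> / 2)"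
        by (auto simp: D_def intro!: mult_right_mono)
      then have *: "g z N ?l \<le> D * exp (- \<bar>y\<bar> / 2)" "g z' N ?l \<le> D * exp (- \<bar>y\<bar> / 2)"
        using elim(1,2)[rule_format, of y] True unfolding atLeastLessThan_iff by (blast intro: order_trans)+
      have "norm (T N y) = sqrt (g z N ?l) * sqrt (g z' N ?l)"
        using True g0[of z N ?l] g0[of z' N ?l] by (simp add: T_def F_def norm_mult abs_mult)
      also have "\<dots> \<le> sqrt (D * exp (- \<bar>y\<bar> / 2)) * sqrt (D * exp (- \<bar>y\<bar> / 2))"
        using * g0 by (intro mult_mono real_sqrt_le_mono) (auto simp: D_def)
      also have "\<dots> = D * exp (- \<bar>y\<bar> / 2)" by (simp add: D_def)
      finally show ?thesis .
    next
      case False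
      then show ?thesis by (simp add: T_def D_def)
    qed
    with elim show ?case by auto
  qed
  then obtain n0 where n0: "\<And>N. N \<ge> n0 \<Longrightarrow> N > 0 \<and> (\<forall>y. norm (T N y) \<le> D * exp (- \<bar>y\<bar> / 2))"
    unfolding eventually_sequentially by blast
  have lim: "(\<lambda>N. T N y) \<longlonglongrightarrow> indicator B y *\<^sub>R (of_real (sqrt (f \<kappa> y) * sqrt (f \<kappa>' y)) * cis (y * \<delta>))" for y
  proof -
    have "\<forall>\<^sub>F N in sequentially. indicator {0..<real N} (lam * real N + y * sqrt (real N)) = (indicator B y :: real)"
    proof (cases "lam < 1")
      case True
      then have "\<forall>\<^sub>F N in sequentially. lam * real N + y * sqrt (real N) < real N" by real_asymp
      with eventually_index_nonneg[OF lam(1), of y] show ?thesis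
        by eventually_elim (use True in \<open>auto simp: B_def\<close>)
    next
      case False
      then have "lam = 1" using lam by simp
      from eventually_index_nonneg[OF lam(1), of y] eventually_gt_at_top[of 0] show ?thesis
        by eventually_elim (use \<open>lam = 1\<close> in \<open>auto simp: B_def mult_less_0_iff split: split_indicator\<close>)
    qed
    then have ind: "(\<lambda>N. indicator {0..<real N} (lam * real N + y * sqrt (real N)) :: real) \<longlonglongrightarrow> indicator B y"
      by (rule tendsto_eventually)
    \<comment> \<open>The index offset is of order sqrt N and the angle of order 1 / sqrt N; writing
      the offset through the ratio in \<open>bulk_index_ratio\<close> exhibits both scaled
      factors.\<close>
    have "(\<lambda>N. lam * (sqrt (real N) * ((0 + real (bulk_index lam N y)) / (lam * real N) - 1)) * (sqrt (real N) * (\<psi> N - \<psi>' N))) \<longlonglongrightarrow> lam * (y / lam) * \<delta>"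
      by (intro tendsto_intros bulk_index_ratio lam delta)
    moreover have "\<forall>\<^sub>F N in sequentially. lam * (sqrt (real N) * ((0 + real (bulk_index lam N y)) / (lam * real N) - 1)) * (sqrt (real N) * (\<psi> N - \<psi>' N)) =
       (real (bulk_index lam N y) - lam * real N) * (\<psi> N - \<psi>' N)"
      using eventually_gt_at_top[of 0]
    proof eventually_elim
      case (elim N)
      define s where "s = sqrt (real N)"
      have s: "s > 0" "real N = s * s" using elim by (auto simp: s_def)
      show ?case unfolding s_def[symmetric] unfolding s(2) using s(1) lam by (simp add: field_simps)
    qed
    ultimately have "(\<lambda>N. (real (bulk_index lam N y) - lam * real N) * (\<psi> N - \<psi>' N)) \<longlonglongrightarrow> lam * (y / lam) * \<delta>"
      by (rule Lim_transform_eventually)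
    then have phase: "(\<lambda>N. (real (bulk_index lam N y) - lam * real N) * (\<psi> N - \<psi>' N)) \<longlonglongrightarrow> y * \<delta>"
      using lam by simp
    have cis: "(\<lambda>N. cis ((real (bulk_index lam N y) - lam * real N) * (\<psi> N - \<psi>' N))) \<longlonglongrightarrow> cis (y * \<delta>)"
      unfolding cis_conv_exp by (rule tendsto_exp[OF tendsto_mult[OF tendsto_const tendsto_of_real[OF phase]]])
    show ?thesis
      unfolding T_def F_def
      by (intro tendsto_scaleR tendsto_mult tendsto_of_real tendsto_real_sqrt ind gz gz' cis)
  qed
  have [measurable]: "bulk_index lam N \<in> measurable borel (count_space UNIV)" for N
    unfolding bulk_index_def by measurable
  have [measurable]: "f \<kappa> \<in> borel_measurable borel" for \<kappa>
    unfolding f_def by measurable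
  have Bm [measurable]: "B \<in> sets borel" by (simp add: B_def)
  have FM [measurable]: "(\<lambda>y. F N (bulk_index lam N y)) \<in> borel_measurable borel" for N
    by (rule measurable_compose[of "bulk_index lam N" _ "count_space UNIV"]) auto
  have cism: "(\<lambda>y. cis (y * \<delta>)) \<in> borel_measurable borel"
    unfolding cis_conv_exp by measurable
  note [measurable] = cism
  have "(\<lambda>n. \<integral>y. T (n + n0) y \<partial>lborel) \<longlonglongrightarrow>
     (\<integral>y. indicator B y *\<^sub>R (of_real (sqrt (f \<kappa> y) * sqrt (f \<kappa>' y)) * cis (y * \<delta>)) \<partial>lborel)"
  proof (rule integral_dominated_convergence[where w = "\<lambda>y. D * exp (- \<bar>y\<bar> / 2)"])
    show "AE y in lborel. norm (T (n + n0) y) \<le> D * exp (- \<bar>y\<bar> / 2)" for n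
      using n0[of "n + n0"] by simp
    show "AE y in lborel. (\<lambda>n. T (n + n0) y) \<longlonglongrightarrow> indicator B y *\<^sub>R (of_real (sqrt (f \<kappa> y) * sqrt (f \<kappa>' y)) * cis (y * \<delta>))"
      by (intro AE_I2 LIMSEQ_ignore_initial_segment lim)
    show "T (n + n0) \<in> borel_measurable lborel" for n
      unfolding T_def by measurable
    show "(\<lambda>y. indicator B y *\<^sub>R (of_real (sqrt (f \<kappa> y) * sqrt (f \<kappa>' y)) * cis (y * \<delta>))) \<in> borel_measurable lborel"
      by measurable
  qed (rule integrable_exp_abs_half)
  then have "(\<lambda>N. \<integral>y. T N y \<partial>lborel) \<longlonglongrightarrow>
     (\<integral>y. indicator B y *\<^sub>R (of_real (sqrt (f \<kappa> y) * sqrt (f \<kappa>' y)) * cis (y * \<delta>)) \<partial>lborel)"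
    by (rule LIMSEQ_offset)
  then have "(\<lambda>N. of_real (1 / pi) * (\<integral>y. T N y \<partial>lborel)) \<longlonglongrightarrow> of_real (1 / pi) *
     (\<integral>y. indicator B y *\<^sub>R (of_real (sqrt (f \<kappa> y) * sqrt (f \<kappa>' y)) * cis (y * \<delta>)) \<partial>lborel)"
    by (rule tendsto_mult_left)
  moreover have "\<forall>\<^sub>F N in sequentially. of_real (1 / pi) * (\<integral>y. T N y \<partial>lborel) =
      of_real (real N ^ (m - 1)) * ginibre_kernel m a N (z N) (z' N) * cis (- (lam * real N * (\<psi> N - \<psi>' N)))"
    using eventually_gt_at_top[of 0] by eventually_elim (simp only: kernel)
  ultimately show ?thesis
    unfolding B_def by (rule Lim_transform_eventually)
qed

section \<open>Closed form of the limit kernel\<close>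

text \<open>The scale \<open>q\<close> normalises the profiles to exp (- (2 \<alpha> - t)^2 / 2),
  and the geometric mean of two of them is exp (- \<alpha>^2 - \<alpha>'^2) exp (- t^2 / 2 + t
  (\<alpha> + \<alpha>')). The phase supplies the imaginary part of the linear coefficient. Here
  \<alpha> and \<beta> stand for the real and imaginary parts of the rotated variable v.\<close>

lemma kernel_limit_integrand:
  fixes lam \<alpha> \<alpha>' \<beta> \<beta>' t :: real
  assumes m: "m \<ge> 1" and lam: "lam > 0"
  defines "q \<equiv> sqrt (real m / lam)"
  defines "f \<equiv> \<lambda>\<kappa> y. lam powr (1 / 2 - real m) * normal_density 0 (sqrt (real m)) (sqrt lam * (\<kappa> - real m * y / lam))"
  shows "of_real (real m * lam powr (real m - 1) / q) *
      (of_real (sqrt (f (2 * q * \<alpha>) (t / q)) * sqrt (f (2 * q * \<alpha>') (t / q))) * cis (t / q * (q * (\<beta> - \<beta>')))) =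
    of_real (exp (- \<alpha>\<^sup>2 - \<alpha>'\<^sup>2) / sqrt (2 * pi)) *
      exp (of_real (- t\<^sup>2 / 2) + of_real t * Complex (\<alpha> + \<alpha>') (\<beta> - \<beta>'))"
proof -
  have q: "q > 0" using m lam by (simp add: q_def)
  have q2: "q\<^sup>2 = real m / lam" using lam by (simp add: q_def)
  have arg: "sqrt lam * (2 * q * x - real m * (t / q) / lam) = sqrt (real m) * (2 * x - t)" for x
  proof -
    have "real m / lam * (t / q) = q * t" using q unfolding q2[symmetric] by (simp add: power2_eq_square)
    then have a1: "real m * (t / q) / lam = q * t" by (simp add: mult.commute)
    have a2: "sqrt lam * q = sqrt (real m)" using lam by (simp add: q_def real_sqrt_divide)
    show ?thesis unfolding a1 a2[symmetric] by (simp add: algebra_simps)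
  qed
  define A where "A = lam powr (1 / 2 - real m) * (1 / sqrt (2 * pi * real m))"
  have A: "A > 0" using m lam by (simp add: A_def)
  have f: "f (2 * q * x) (t / q) = A * exp (- (2 * x - t)\<^sup>2 / 2)" for x
    unfolding f_def arg normal_density_def A_def using m by (simp add: power_mult_distrib)
  have sq: "sqrt (exp x) = exp (x / 2)" for x :: real
    by (rule real_sqrt_unique) (auto simp flip: exp_double)
  have "sqrt (f (2 * q * \<alpha>) (t / q)) * sqrt (f (2 * q * \<alpha>') (t / q)) =
      A * (exp (- (2 * \<alpha> - t)\<^sup>2 / 2 / 2) * exp (- (2 * \<alpha>' - t)\<^sup>2 / 2 / 2))"
    unfolding f real_sqrt_mult sq using A by simp
  also have "exp (- (2 * \<alpha> - t)\<^sup>2 / 2 / 2) * exp (- (2 * \<alpha>' - t)\<^sup>2 / 2 / 2) =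
      exp (- \<alpha>\<^sup>2 - \<alpha>'\<^sup>2) * exp (- t\<^sup>2 / 2 + t * (\<alpha> + \<alpha>'))"
    unfolding exp_add[symmetric] by (simp add: power2_eq_square field_simps)
  finally have 1: "sqrt (f (2 * q * \<alpha>) (t / q)) * sqrt (f (2 * q * \<alpha>') (t / q)) =
      A * (exp (- \<alpha>\<^sup>2 - \<alpha>'\<^sup>2) * exp (- t\<^sup>2 / 2 + t * (\<alpha> + \<alpha>')))" .
  have 2: "real m * lam powr (real m - 1) / q * A = 1 / sqrt (2 * pi)"
  proof -
    have "lam powr (real m - 1) * lam powr (1 / 2 - real m) = lam powr (- 1 / 2)"
      unfolding powr_add[symmetric] by simp
    also have "\<dots> = 1 / sqrt lam"
      using lam by (simp add: powr_minus_divide powr_half_sqrt)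
    finally have l: "lam powr (real m - 1) * lam powr (1 / 2 - real m) = 1 / sqrt lam" .
    have "real m * lam powr (real m - 1) / q * A = (lam powr (real m - 1) * lam powr (1 / 2 - real m)) * (real m / (q * sqrt (2 * pi * real m)))"
      by (simp add: A_def)
    also have "\<dots> = 1 / sqrt (2 * pi)"
      unfolding l q_def using m lam by (simp add: real_sqrt_mult real_sqrt_divide field_simps)
    finally show ?thesis .
  qed
  have 3: "t / q * (q * (\<beta> - \<beta>')) = t * (\<beta> - \<beta>')" using q by simp
  have 4: "of_real (exp (- t\<^sup>2 / 2 + t * (\<alpha> + \<alpha>'))) * cis (t * (\<beta> - \<beta>')) =
      exp (of_real (- t\<^sup>2 / 2) + of_real t * Complex (\<alpha> + \<alpha>') (\<beta> - \<beta>'))"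
    unfolding cis_conv_exp exp_of_real[symmetric] exp_add[symmetric]
    by (rule arg_cong[where f = exp]) (simp add: complex_eq_iff)
  have r: "of_real K * (of_real (A * (E * X)) * w) = of_real (K * A) * of_real E * (of_real X * w)"
    for K E X :: real and w :: complex
    by simp
  show ?thesis
    unfolding 1 3 r 2 4 by (simp add: mult.commute)
qed

lemma kernel_limit_integral:
  fixes lam \<alpha> \<alpha>' \<beta> \<beta>' :: real
  assumes m: "m \<ge> 1" and lam: "lam > 0" and B: "B = UNIV \<or> B = {..<0}"
  defines "q \<equiv> sqrt (real m / lam)"
  defines "f \<equiv> \<lambda>\<kappa> y. lam powr (1 / 2 - real m) * normal_density 0 (sqrt (real m)) (sqrt lam * (\<kappa> - real m * y / lam))"
  shows "of_real (real m * lam powr (real m - 1)) * (\<integral>y. indicator B y *\<^sub>R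
      (of_real (sqrt (f (2 * q * \<alpha>) y) * sqrt (f (2 * q * \<alpha>') y)) * cis (y * (q * (\<beta> - \<beta>')))) \<partial>lborel) =
    of_real (exp (- \<alpha>\<^sup>2 - \<alpha>'\<^sup>2) / sqrt (2 * pi)) * (\<integral>t. indicator B t *\<^sub>R
      exp (of_real (- t\<^sup>2 / 2) + of_real t * Complex (\<alpha> + \<alpha>') (\<beta> - \<beta>')) \<partial>lborel)"
proof -
  have q: "q > 0" using m lam by (simp add: q_def)
  let ?G = "\<lambda>y. of_real (sqrt (f (2 * q * \<alpha>) y) * sqrt (f (2 * q * \<alpha>') y)) * cis (y * (q * (\<beta> - \<beta>')))"
  have "(\<integral>y. indicator B y *\<^sub>R ?G y \<partial>lborel) = \<bar>1 / q\<bar> *\<^sub>R (\<integral>t. indicator B (0 + 1 / q * t) *\<^sub>R ?G (0 + 1 / q * t) \<partial>lborel)"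
    using q by (intro lborel_integral_real_affine) auto
  also have "\<dots> = of_real (1 / q) * (\<integral>t. indicator B t *\<^sub>R ?G (t / q) \<partial>lborel)"
  proof -
    \<comment> \<open>Both the line and the negative half line are invariant under positive
      scaling.\<close>
    have "indicator B (0 + 1 / q * t) = (indicator B t :: real)" for t
      using B q by (auto split: split_indicator simp: divide_less_0_iff)
    then show ?thesis using q by (simp add: scaleR_conv_of_real)
  qed
  finally have "of_real (real m * lam powr (real m - 1)) * (\<integral>y. indicator B y *\<^sub>R ?G y \<partial>lborel) =
     of_real (real m * lam powr (real m - 1) / q) * (\<integral>t. indicator B t *\<^sub>R ?G (t / q) \<partial>lborel)"
    by simp
  also have "\<dots> = (\<integral>t. of_real (real m * lam powr (real m - 1) / q) * (indicator B t *\<^sub>R ?G (t / q)) \<partial>lborel)"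
    by (rule integral_mult_right_zero[symmetric])
  also have "\<dots> = (\<integral>t. of_real (exp (- \<alpha>\<^sup>2 - \<alpha>'\<^sup>2) / sqrt (2 * pi)) * (indicator B t *\<^sub>R
      exp (of_real (- t\<^sup>2 / 2) + of_real t * Complex (\<alpha> + \<alpha>') (\<beta> - \<beta>'))) \<partial>lborel)"
    unfolding mult_scaleR_right f_def q_def kernel_limit_integrand[OF m lam] ..
  also have "\<dots> = of_real (exp (- \<alpha>\<^sup>2 - \<alpha>'\<^sup>2) / sqrt (2 * pi)) * (\<integral>t. indicator B t *\<^sub>R
      exp (of_real (- t\<^sup>2 / 2) + of_real t * Complex (\<alpha> + \<alpha>') (\<beta> - \<beta>')) \<partial>lborel)"
    by (rule integral_mult_right_zero)
  finally show ?thesis .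
qed

text \<open>Here c = \<xi> + cnj \<xi>', so c^2 / 2 contains the product \<xi> cnj \<xi>' and the
  squares \<xi>^2 / 2 and (cnj \<xi>')^2 / 2. Subtracting (Re \<xi>)^2 from the first square leaves
  - |\<xi>|^2 / 2 + i Re \<xi> Im \<xi>, and likewise for the second with the opposite phase; the
  surplus phase is a difference of a row and a column term.\<close>

lemma gaussian_exponent:
  fixes \<xi> \<xi>' :: complex
  defines "c \<equiv> Complex (Re \<xi> + Re \<xi>') (Im \<xi> - Im \<xi>')"
  shows "of_real (exp (- (Re \<xi>)\<^sup>2 - (Re \<xi>')\<^sup>2)) * exp (c\<^sup>2 / 2) =
    exp (- (1 / 2) * (of_real ((cmod \<xi>)\<^sup>2 + (cmod \<xi>')\<^sup>2) - 2 * \<xi> * cnj \<xi>')) *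
    cis (Re \<xi> * Im \<xi> - Re \<xi>' * Im \<xi>')"
  unfolding cis_conv_exp exp_of_real[symmetric] exp_add[symmetric] cmod_power2
proof (rule arg_cong[where f = exp], rule complex_eqI)
  show "Re (of_real (- (Re \<xi>)\<^sup>2 - (Re \<xi>')\<^sup>2) + c\<^sup>2 / 2) =
      Re (- (1 / 2) * (of_real ((Re \<xi>)\<^sup>2 + (Im \<xi>)\<^sup>2 + ((Re \<xi>')\<^sup>2 + (Im \<xi>')\<^sup>2)) - 2 * \<xi> * cnj \<xi>') +
        \<i> * of_real (Re \<xi> * Im \<xi> - Re \<xi>' * Im \<xi>'))"
    by (simp add: c_def power2_eq_square) (simp add: algebra_simps add_divide_distrib diff_divide_distrib)
  show "Im (of_real (- (Re \<xi>)\<^sup>2 - (Re \<xi>')\<^sup>2) + c\<^sup>2 / 2) =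
      Im (- (1 / 2) * (of_real ((Re \<xi>)\<^sup>2 + (Im \<xi>)\<^sup>2 + ((Re \<xi>')\<^sup>2 + (Im \<xi>')\<^sup>2)) - 2 * \<xi> * cnj \<xi>') +
        \<i> * of_real (Re \<xi> * Im \<xi> - Re \<xi>' * Im \<xi>'))"
    by (simp add: c_def power2_eq_square) (simp add: algebra_simps add_divide_distrib diff_divide_distrib)
qed

section \<open>From continuous convergence to uniform limits; invariance of determinants\<close>

text \<open>If uniformity failed, points that violate it along a subsequence of indices would
  accumulate at some l in \<open>K\<close>; continuous convergence and the continuity of
  \<open>g\<close> at l contradict this.\<close>

lemma uniform_limit_sequentiallyI:
  fixes f :: "nat \<Rightarrow> 'a::metric_space \<Rightarrow> 'b::metric_space"
  assumes K: "compact K" and g: "continuous_on K g"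
    and lim: "\<And>x l. \<lbrakk>\<And>n. x n \<in> K; l \<in> K; x \<longlonglongrightarrow> l\<rbrakk> \<Longrightarrow> (\<lambda>n. f n (x n)) \<longlonglongrightarrow> g l"
  shows "uniform_limit K f g sequentially"
proof (rule ccontr)
  assume "\<not> uniform_limit K f g sequentially"
  then obtain e where e1: "e > 0" and ne: "\<not> (\<forall>\<^sub>F n in sequentially. \<forall>x\<in>K. dist (f n x) (g x) < e)"
    unfolding uniform_limit_iff by blast
  have e2: "\<exists>\<^sub>F n in sequentially. \<exists>x\<in>K. dist (f n x) (g x) \<ge> e"
    using ne by (simp add: not_eventually not_less)
  have "\<exists>y n. \<forall>k. y k \<in> K \<and> dist (f (n k) (y k)) (g (y k)) \<ge> e \<and> n k < n (Suc k)"
  proof -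
    have "\<exists>n'>n. \<exists>x\<in>K. dist (f n' x) (g x) \<ge> e" for n
      using e2 unfolding frequently_sequentially by (meson Suc_le_eq)
    then obtain s where s: "\<And>n. s n > n" "\<And>n. \<exists>x\<in>K. dist (f (s n) x) (g x) \<ge> e" by metis
    define n where "n = (\<lambda>k. (s ^^ Suc k) 0)"
    have nS: "n (Suc k) = s (n k)" for k by (simp add: n_def)
    have "\<exists>x\<in>K. dist (f (n k) x) (g x) \<ge> e" for k
      unfolding n_def by (simp add: s(2))
    then obtain y where "\<And>k. y k \<in> K \<and> dist (f (n k) (y k)) (g (y k)) \<ge> e" by metis
    then show ?thesis using nS s(1) by metis
  qed
  then obtain y n where yn: "\<And>k. y k \<in> K \<and> dist (f (n k) (y k)) (g (y k)) \<ge> e \<and> n k < n (Suc k)"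
    by blast
  have y: "y k \<in> K" "dist (f (n k) (y k)) (g (y k)) \<ge> e" for k
    using yn[of k] by simp_all
  have n: "strict_mono n"
    using yn by (simp add: strict_mono_Suc_iff)
  obtain l r where l: "l \<in> K" and r: "strict_mono r" and lr: "(y \<circ> r) \<longlonglongrightarrow> l"
    using K y(1) unfolding compact_def by meson
  define N where "N = n \<circ> r"
  have N: "strict_mono N" unfolding N_def using n r by (rule strict_mono_o)
  \<comment> \<open>The hypothesis speaks about full sequences, so the indices missed by the
    subsequence are padded with the limit point.\<close>
  define x where "x = (\<lambda>i. if i \<in> range N then y (r (inv N i)) else l)"
  have xN: "x (N j) = y (r j)" for j
    using strict_mono_imp_inj_on[OF N] by (simp add: x_def inv_f_f)
  have "x \<longlonglongrightarrow> l"
  proof (rule metric_LIMSEQ_I)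
    fix d :: real assume "d > 0"
    then obtain j0 where j0: "\<And>j. j \<ge> j0 \<Longrightarrow> dist (y (r j)) l < d"
      using metric_LIMSEQ_D[OF lr] by auto
    show "\<exists>n0. \<forall>i\<ge>n0. dist (x i) l < d"
    proof (intro exI allI impI)
      fix i assume i: "i \<ge> N j0"
      show "dist (x i) l < d"
      proof (cases "i \<in> range N")
        case True
        then obtain j where j: "i = N j" by blast
        then have "j \<ge> j0" using i strict_mono_less_eq[OF N] by simp
        then show ?thesis using j0 j xN by simp
      next
        case False
        then show ?thesis using \<open>d > 0\<close> by (simp add: x_def)
      qed
    qed
  qed
  moreover have "x i \<in> K" for i using y(1) l by (auto simp: x_def)
  ultimately have "(\<lambda>i. f i (x i)) \<longlonglongrightarrow> g l" using l by (intro lim)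
  from LIMSEQ_subseq_LIMSEQ[OF this N]
  have 1: "(\<lambda>j. f (N j) (y (r j))) \<longlonglongrightarrow> g l" by (simp add: o_def xN)
  have 2: "(\<lambda>j. g (y (r j))) \<longlonglongrightarrow> g l"
    using g lr y(1) l unfolding continuous_on_sequentially by (auto simp: o_def)
  from tendsto_dist[OF 1 2] have "(\<lambda>j. dist (f (N j) (y (r j))) (g (y (r j)))) \<longlonglongrightarrow> 0" by simp
  then have "\<forall>\<^sub>F j in sequentially. dist (f (N j) (y (r j))) (g (y (r j))) < e"
    using e1 by (rule order_tendstoD)
  moreover have "dist (f (N j) (y (r j))) (g (y (r j))) \<ge> e" for j
    using y(2)[of "r j"] by (simp add: N_def)
  ultimately show False by (simp add: not_less[symmetric])
qed

lemma compact_vec_components: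
  fixes V :: "'a::euclidean_space set"
  assumes "compact V"
  shows "compact {v :: 'a ^ 'n. \<forall>k. v $ k \<in> V}"
proof -
  have "bounded {v :: 'a ^ 'n. \<forall>k. v $ k \<in> V}"
  proof -
    obtain B where B: "\<And>x. x \<in> V \<Longrightarrow> norm x \<le> B"
      using compact_imp_bounded[OF assms] unfolding bounded_iff by blast
    have "norm v \<le> real CARD('n) * B" if "\<forall>k. v $ k \<in> V" for v :: "'a ^ 'n"
    proof -
      have "norm v \<le> (\<Sum>k\<in>UNIV. norm (v $ k))"
        unfolding norm_vec_def by (intro L2_set_le_sum) auto
      also have "\<dots> \<le> (\<Sum>k\<in>(UNIV :: 'n set). B)"
        using that B by (intro sum_mono) auto
      finally show ?thesis by simp
    qed
    then show ?thesis unfolding bounded_iff by blast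
  qed
  moreover have "closed {v :: 'a ^ 'n. \<forall>k. v $ k \<in> V}"
  proof -
    have "{v :: 'a ^ 'n. \<forall>k. v $ k \<in> V} = (\<Inter>k. (\<lambda>v. v $ k) -` V)" by auto
    moreover have "closed ((\<lambda>v :: 'a ^ 'n. v $ k) -` V)" for k
      by (intro continuous_closed_vimage compact_imp_closed assms) (simp add: continuous_component)
    ultimately show ?thesis by auto
  qed
  ultimately show ?thesis by (simp add: compact_eq_bounded_closed)
qed

lemma tendsto_det:
  fixes A :: "'b \<Rightarrow> 'n::finite \<Rightarrow> 'n \<Rightarrow> complex"
  assumes "\<And>j k. ((\<lambda>x. A x j k) \<longlongrightarrow> A' j k) F"
  shows "((\<lambda>x. det (\<chi> j k. A x j k)) \<longlongrightarrow> det (\<chi> j k. A' j k)) F"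
  unfolding det_def vec_lambda_beta
  by (intro tendsto_sum tendsto_mult tendsto_const tendsto_prod assms)

text \<open>Every permutation meets each row and each column once, so all factors pair off. This is
  how phases \<theta>_j - \<theta>_k disappear.\<close>

lemma det_diagonal_conjugation:
  fixes A :: "'n::finite \<Rightarrow> 'n \<Rightarrow> complex"
  assumes "\<And>j. d j * e j = 1"
  shows "det (\<chi> j k. d j * A j k * e k) = det (\<chi> j k. A j k)"
proof -
  have "(\<Prod>i\<in>UNIV. d i * A i (p i) * e (p i)) = (\<Prod>i\<in>UNIV. A i (p i))" if "p permutes UNIV" for p
  proof -
    have "(\<Prod>i\<in>UNIV. e (p i)) = (\<Prod>i\<in>UNIV. e i)"
      using that by (intro prod.permute[symmetric, unfolded o_def]) auto
    then have "(\<Prod>i\<in>UNIV. d i * A i (p i) * e (p i)) = (\<Prod>i\<in>UNIV. A i (p i)) * (\<Prod>i\<in>UNIV. d i * e i)"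
      by (simp add: prod.distrib)
    then show ?thesis using assms by simp
  qed
  then show ?thesis unfolding det_def by simp
qed

lemma det_scale:
  fixes A :: "'n::finite \<Rightarrow> 'n \<Rightarrow> complex"
  shows "det (\<chi> j k. c * A j k) = c ^ CARD('n) * det (\<chi> j k. A j k)"
proof -
  have "(\<Prod>i\<in>UNIV. c * A i (p i)) = c ^ CARD('n) * (\<Prod>i\<in>UNIV. A i (p i))" for p
    by (simp add: prod.distrib)
  then show ?thesis
    unfolding det_def by (simp add: sum_distrib_left mult.left_commute)
qed

subsection \<open>Determinants and uniform convergence\<close>

text \<open>The kernel sum concentrates at the indices \<open>l\<close> near \<open>bulk_density m u * N\<close>.\<close>

definition bulk_density :: "nat \<Rightarrow> complex \<Rightarrow> real" where
  "bulk_density m u = cmod u powr (2 / real m)"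

definition rescaled_point :: "nat \<Rightarrow> complex \<Rightarrow> nat \<Rightarrow> complex \<Rightarrow> complex" where
  "rescaled_point m u N v = of_real (real N powr (real m / 2)) * (u + v / of_real (ginibre_rho m u * sqrt (real N)))"

text \<open>Bulk and edge in one formula, so that the analysis is done once. At the edge
  \<open>sgn u\<close> is the phase e^(i \<phi>), and the factor 1/2 turns 1 / pi into 1 / (2
  pi).\<close>

definition limit_kernel :: "complex \<Rightarrow> complex \<Rightarrow> complex \<Rightarrow> complex" where
  "limit_kernel u v v' = of_real (1 / pi) *
     exp (- (1 / 2) * (of_real ((cmod v)\<^sup>2 + (cmod v')\<^sup>2) - 2 * v * cnj v')) *
     (if cmod u < 1 then 1 else cerfc ((sgn u * cnj v' + cnj (sgn u) * v) / of_real (sqrt 2)) / 2)"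

context
  fixes m :: nat and u :: complex
  assumes m: "m \<ge> 1" and u: "u \<noteq> 0"
begin

lemma bulk_density_pos: "bulk_density m u > 0"
  using u by (simp add: bulk_density_def)

text \<open>In this form the relative displacement v / (u \<rho> sqrt N) becomes q cnj (sgn u) v /
  sqrt N, where q is the scale that normalises the Gaussian profiles in
  \<open>kernel_limit_integrand\<close>.\<close>

lemma inverse_ginibre_rho: "1 / ginibre_rho m u = sqrt (real m / bulk_density m u) * cmod u"
proof -
  have "sqrt (bulk_density m u) = cmod u powr (1 / real m)"
    using u by (simp add: bulk_density_def powr_powr flip: powr_half_sqrt)
  moreover have "cmod u powr (- (real m - 1) / real m) * cmod u = cmod u powr (1 / real m)"
  proof -
    have "cmod u powr (- (real m - 1) / real m) * cmod u powr 1 = cmod u powr (1 / real m)"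
      unfolding powr_add[symmetric] using m by (simp add: field_simps)
    then show ?thesis using u by simp
  qed
  moreover have "cmod u powr (- (real m - 1) / real m) > 0" "cmod u powr (1 / real m) > 0" using u by auto
  ultimately show ?thesis
    using m unfolding ginibre_rho_def real_sqrt_divide by (simp add: field_simps)
qed

text \<open>The factor \<rho>^(-2) of the theorem is thereby identified with the constant in
  \<open>kernel_limit_integral\<close>.\<close>

lemma inverse_ginibre_rho_squared:
  "1 / (ginibre_rho m u)\<^sup>2 = real m * bulk_density m u powr (real m - 1)"
proof -
  have "1 / (ginibre_rho m u)\<^sup>2 = (sqrt (real m / bulk_density m u) * cmod u)\<^sup>2"
    unfolding inverse_ginibre_rho[symmetric] by (simp add: power_divide)
  also have "\<dots> = real m * ((cmod u)\<^sup>2 / bulk_density m u)"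
    using bulk_density_pos by (simp add: power_mult_distrib)
  also have "(cmod u)\<^sup>2 = bulk_density m u powr real m"
    using m u by (simp add: bulk_density_def powr_powr)
  also have "bulk_density m u powr real m / bulk_density m u = bulk_density m u powr (real m - 1)"
    using bulk_density_pos by (simp add: powr_diff)
  finally show ?thesis .
qed

text \<open>Writing the rescaled points as \<open>N\<^bsup>m/2\<^esup> u exp w\<close> gives their moduli and arguments at once;
  the exponential is also harmless for the finitely many \<open>N\<close> at which a rescaled point vanishes.\<close>

lemma rescaled_point_polar:
  fixes v :: "nat \<Rightarrow> complex"
  assumes v: "v \<longlonglongrightarrow> v0"
  defines "q \<equiv> sqrt (real m / bulk_density m u)"
  defines "\<xi> \<equiv> cnj (sgn u) * v0"
  shows "\<exists>z \<psi>. (\<forall>N. z N \<noteq> 0 \<and> z N = rcis (cmod (z N)) (\<psi> N)) \<and>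
    (\<forall>\<^sub>F N in sequentially. z N = rescaled_point m u N (v N)) \<and>
    (\<lambda>N. sqrt (real N) * (ln ((cmod (z N))\<^sup>2) - real m * ln (bulk_density m u * real N))) \<longlonglongrightarrow> 2 * q * Re \<xi> \<and>
    (\<lambda>N. sqrt (real N) * (\<psi> N - Arg u)) \<longlonglongrightarrow> q * Im \<xi>"
proof -
  define h where "h = (\<lambda>N. v N / (u * of_real (ginibre_rho m u * sqrt (real N))))"
  define w where "w = (\<lambda>N. Ln (1 + h N))"
  \<comment> \<open>The maximum with 1 keeps the point nonzero at N = 0.\<close>
  define z where "z = (\<lambda>N. of_real (real (max N 1) powr (real m / 2)) * u * exp (w N))"
  \<comment> \<open>This is a continuous choice of the argument near \<open>Arg u\<close>; the
    principal argument of \<open>z N\<close> could jump by 2 pi when u is a negative real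
    number.\<close>
  define \<psi> where "\<psi> = (\<lambda>N. Arg u + Im (w N))"
  have usgn: "cmod u / u = cnj (sgn u)"
    using u complex_norm_square[of u] by (simp add: sgn_eq field_simps power2_eq_square)
  have "(\<lambda>N. of_real q * (cnj (sgn u) * v N)) \<longlonglongrightarrow> of_real q * \<xi>"
    unfolding \<xi>_def by (intro tendsto_intros v)
  moreover have "\<forall>\<^sub>F N in sequentially. of_real q * (cnj (sgn u) * v N) = of_real (sqrt (real N)) * ((1 + h N) - 1)"
    using eventually_gt_at_top[of 0]
  proof eventually_elim
    case (elim N)
    have "of_real (sqrt (real N)) * h N = v N / u * of_real (1 / ginibre_rho m u)"
      using elim by (simp add: h_def)
    also have "\<dots> = of_real q * (cmod u / u * v N)"
      unfolding inverse_ginibre_rho q_def by simp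
    finally show ?case unfolding usgn by simp
  qed
  ultimately have h: "(\<lambda>N. of_real (sqrt (real N)) * ((1 + h N) - 1)) \<longlonglongrightarrow> of_real q * \<xi>"
    by (rule Lim_transform_eventually)
  then have h1: "(\<lambda>N. 1 + h N) \<longlonglongrightarrow> 1" by (rule LIMSEQ_sqrt_scaled_imp)
  have "(Ln has_field_derivative 1) (at (1::complex))"
    using has_field_derivative_Ln[of 1] by simp
  from scaled_derivative_tendsto[OF this h1 h]
  have w: "(\<lambda>N. of_real (sqrt (real N)) * w N) \<longlonglongrightarrow> of_real q * \<xi>"
    by (simp add: w_def)
  have "z N \<noteq> 0" for N using u by (simp add: z_def)
  moreover have "z N = rcis (cmod (z N)) (\<psi> N)" for N
  proof -
    have "u = of_real (cmod u) * cis (Arg u)"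
      using rcis_cmod_Arg[of u] by (simp add: rcis_def)
    moreover have "exp (w N) = of_real (exp (Re (w N))) * cis (Im (w N))"
      by (simp add: exp_eq_polar)
    ultimately have "z N = of_real (real (max N 1) powr (real m / 2)) * (of_real (cmod u) * cis (Arg u)) * (of_real (exp (Re (w N))) * cis (Im (w N)))"
      unfolding z_def by metis
    moreover have "cmod (z N) = real (max N 1) powr (real m / 2) * cmod u * exp (Re (w N))"
      by (simp add: z_def norm_mult)
    ultimately show ?thesis
      by (simp add: rcis_def \<psi>_def mult_ac flip: cis_mult)
  qed
  moreover have "\<forall>\<^sub>F N in sequentially. z N = rescaled_point m u N (v N)"
  proof -
    have "\<forall>\<^sub>F N in sequentially. 1 + h N \<noteq> 0"
      using tendsto_imp_eventually_ne[OF h1, of 0] by simp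
    with eventually_gt_at_top[of 0] show ?thesis
    proof eventually_elim
      case (elim N)
      then have "max N 1 = N" by simp
      then have "z N = of_real (real N powr (real m / 2)) * (u * (1 + h N))"
        using elim unfolding z_def w_def by simp
      also have "u * (1 + h N) = u + v N / of_real (ginibre_rho m u * sqrt (real N))"
        using u by (simp add: h_def distrib_left)
      finally show ?case by (simp add: rescaled_point_def)
    qed
  qed
  moreover have "(\<lambda>N. sqrt (real N) * (ln ((cmod (z N))\<^sup>2) - real m * ln (bulk_density m u * real N))) \<longlonglongrightarrow> 2 * q * Re \<xi>"
  proof -
    have "(\<lambda>N. 2 * Re (of_real (sqrt (real N)) * w N)) \<longlonglongrightarrow> 2 * Re (of_real q * \<xi>)"
      by (intro tendsto_intros w)
    moreover have "\<forall>\<^sub>F N in sequentially. 2 * Re (of_real (sqrt (real N)) * w N) =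
        sqrt (real N) * (ln ((cmod (z N))\<^sup>2) - real m * ln (bulk_density m u * real N))"
      using eventually_gt_at_top[of 0]
    proof eventually_elim
      case (elim N)
      have "cmod (z N) = real N powr (real m / 2) * cmod u * exp (Re (w N))"
        using elim by (simp add: z_def norm_mult max_absorb1)
      then have "ln (cmod (z N)) = real m / 2 * ln (real N) + ln (cmod u) + Re (w N)"
        using elim u by (simp add: ln_mult)
      moreover have "ln ((cmod (z N))\<^sup>2) = 2 * ln (cmod (z N))"
        using \<open>z N \<noteq> 0\<close> by (simp add: ln_realpow)
      moreover have "ln (bulk_density m u * real N) = 2 / real m * ln (cmod u) + ln (real N)"
        using elim u by (simp add: bulk_density_def ln_mult)
      ultimately have "ln ((cmod (z N))\<^sup>2) - real m * ln (bulk_density m u * real N) = 2 * Re (w N)"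
        using m by (simp add: algebra_simps)
      then show ?case by simp
    qed
    ultimately have "(\<lambda>N. sqrt (real N) * (ln ((cmod (z N))\<^sup>2) - real m * ln (bulk_density m u * real N))) \<longlonglongrightarrow> 2 * Re (of_real q * \<xi>)"
      by (rule Lim_transform_eventually)
    then show ?thesis by (simp add: mult.assoc)
  qed
  moreover have "(\<lambda>N. sqrt (real N) * (\<psi> N - Arg u)) \<longlonglongrightarrow> q * Im \<xi>"
    using tendsto_Im[OF w] by (simp add: \<psi>_def)
  ultimately show ?thesis by blast
qed

text \<open>The direction of u enters through the rotation of v to \<xi> = cnj (sgn u) v, which
  preserves moduli and the products v cnj v'. Hence it drops out of the Gaussian factor and stays
  visible only in the argument of \<open>cerfc\<close>, which comes from \<xi> + cnj \<xi>'.\<close>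

lemma rescaled_kernel_tendsto:
  fixes z z' :: "nat \<Rightarrow> complex" and v v' :: complex and \<psi> \<psi>' :: "nat \<Rightarrow> real"
  assumes a: "\<And>k. k \<in> {1..m} \<Longrightarrow> a k > -1" and u1: "cmod u \<le> 1"
  defines "lam \<equiv> bulk_density m u" and "q \<equiv> sqrt (real m / bulk_density m u)"
  defines "\<xi> \<equiv> cnj (sgn u) * v" and "\<xi>' \<equiv> cnj (sgn u) * v'"
  assumes z: "\<And>N. z N \<noteq> 0" "\<And>N. z N = rcis (cmod (z N)) (\<psi> N)"
    and z': "\<And>N. z' N \<noteq> 0" "\<And>N. z' N = rcis (cmod (z' N)) (\<psi>' N)"
    and kappa: "(\<lambda>N. sqrt (real N) * (ln ((cmod (z N))\<^sup>2) - real m * ln (lam * real N))) \<longlonglongrightarrow> 2 * q * Re \<xi>"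
    and kappa': "(\<lambda>N. sqrt (real N) * (ln ((cmod (z' N))\<^sup>2) - real m * ln (lam * real N))) \<longlonglongrightarrow> 2 * q * Re \<xi>'"
    and psi: "(\<lambda>N. sqrt (real N) * (\<psi> N - Arg u)) \<longlonglongrightarrow> q * Im \<xi>"
    and psi': "(\<lambda>N. sqrt (real N) * (\<psi>' N - Arg u)) \<longlonglongrightarrow> q * Im \<xi>'"
  shows "(\<lambda>N. of_real (real N ^ (m - 1) * (1 / (ginibre_rho m u)\<^sup>2)) * ginibre_kernel m a N (z N) (z' N) *
      cis (- (lam * real N * (\<psi> N - \<psi>' N))))
    \<longlonglongrightarrow> limit_kernel u v v' * cis (Re \<xi> * Im \<xi> - Re \<xi>' * Im \<xi>')"
proof -
  have lam: "lam > 0" "lam \<le> 1" "lam < 1 \<longleftrightarrow> cmod u < 1"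
  proof -
    show "lam > 0" unfolding lam_def by (rule bulk_density_pos)
    show "lam \<le> 1" using u1 u m unfolding lam_def bulk_density_def by (intro powr_le1) auto
    show "lam < 1 \<longleftrightarrow> cmod u < 1"
    proof
      assume "cmod u < 1"
      then show "lam < 1" unfolding lam_def bulk_density_def using m u powr_less_mono2[of "2 / real m" "cmod u" 1] by simp
    next
      assume "lam < 1"
      show "cmod u < 1"
      proof (rule ccontr)
        assume "\<not> cmod u < 1"
        then have "cmod u = 1" using u1 by simp
        then show False using \<open>lam < 1\<close> by (simp add: lam_def bulk_density_def)
      qed
    qed
  qed
  define B :: "real set" where "B = (if lam < 1 then UNIV else {..<0})"
  define c where "c = Complex (Re \<xi> + Re \<xi>') (Im \<xi> - Im \<xi>')"
  have "(\<lambda>N. sqrt (real N) * (\<psi> N - Arg u) - sqrt (real N) * (\<psi>' N - Arg u)) \<longlonglongrightarrow> q * Im \<xi> - q * Im \<xi>'"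
    by (intro tendsto_diff psi psi')
  then have delta: "(\<lambda>N. sqrt (real N) * (\<psi> N - \<psi>' N)) \<longlonglongrightarrow> q * (Im \<xi> - Im \<xi>')"
    by (simp add: algebra_simps)
  note lim = tendsto_mult_left[OF ginibre_kernel_tendsto[where a = a, OF m a lam(1,2) z z' kappa kappa' delta],
      of "of_real (1 / (ginibre_rho m u)\<^sup>2)"]
  have B: "B = UNIV \<or> B = {..<0}" by (simp add: B_def)
  have G: "of_real (real m * lam powr (real m - 1)) * (\<integral>y. indicator B y *\<^sub>R
      (of_real (sqrt (lam powr (1 / 2 - real m) * normal_density 0 (sqrt (real m)) (sqrt lam * (2 * q * Re \<xi> - real m * y / lam))) *
        sqrt (lam powr (1 / 2 - real m) * normal_density 0 (sqrt (real m)) (sqrt lam * (2 * q * Re \<xi>' - real m * y / lam)))) *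
        cis (y * (q * (Im \<xi> - Im \<xi>')))) \<partial>lborel) =
    of_real (exp (- (Re \<xi>)\<^sup>2 - (Re \<xi>')\<^sup>2) / sqrt (2 * pi)) * (\<integral>t. indicator B t *\<^sub>R
      exp (of_real (- t\<^sup>2 / 2) + of_real t * c) \<partial>lborel)"
    unfolding q_def c_def lam_def[symmetric] by (rule kernel_limit_integral[OF m lam(1) B])
  define H where "H = (if cmod u < 1 then 1 else cerfc (c / of_real (sqrt 2)) / 2)"
  have I: "(\<integral>t. indicator B t *\<^sub>R exp (of_real (- t\<^sup>2 / 2) + of_real t * c) \<partial>lborel) = of_real (sqrt (2 * pi)) * exp (c\<^sup>2 / 2) * H"
  proof (cases "cmod u < 1")
    case True
    then show ?thesis using gaussian_line_integral[of c] lam(3) by (simp add: B_def H_def)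
  next
    case False
    \<comment> \<open>The half-line integral carries half of the full Gaussian mass; this is the 1/2
      next to \<open>cerfc\<close> in the limit kernel.\<close>
    have "sqrt (pi / 2) = sqrt (2 * pi) / 2"
      by (simp add: real_sqrt_divide real_sqrt_mult field_simps)
    then have half: "complex_of_real (sqrt (pi / 2)) = of_real (sqrt (2 * pi)) / 2"
      by (simp only: of_real_divide of_real_numeral)
    have BH: "B = {..<0}" "H = cerfc (c / of_real (sqrt 2)) / 2"
      using False lam(3) by (simp_all add: B_def H_def)
    show ?thesis unfolding BH gaussian_half_line_integral half by simp
  qed
  have s1: "cmod (sgn u) = 1" "sgn u * cnj (sgn u) = 1"
    using u by (auto simp: norm_sgn complex_norm_square[symmetric] simp del: sgn_eq_0_iff)
  have c_eq: "c = sgn u * cnj v' + cnj (sgn u) * v"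
  proof -
    have "c = \<xi> + cnj \<xi>'" by (simp add: c_def complex_eq_iff)
    then show ?thesis by (simp add: \<xi>_def \<xi>'_def)
  qed
  have "\<xi> * cnj \<xi>' = (sgn u * cnj (sgn u)) * (v * cnj v')" by (simp add: \<xi>_def \<xi>'_def mult_ac)
  then have xx: "\<xi> * cnj \<xi>' = v * cnj v'" unfolding s1 by simp
  have "cmod \<xi> = cmod v" "cmod \<xi>' = cmod v'"
    by (simp_all add: \<xi>_def \<xi>'_def norm_mult s1)
  then have E: "of_real (exp (- (Re \<xi>)\<^sup>2 - (Re \<xi>')\<^sup>2)) * exp (c\<^sup>2 / 2) =
    exp (- (1 / 2) * (of_real ((cmod v)\<^sup>2 + (cmod v')\<^sup>2) - 2 * v * cnj v')) * cis (Re \<xi> * Im \<xi> - Re \<xi>' * Im \<xi>')"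
    using gaussian_exponent[of \<xi> \<xi>'] xx unfolding c_def by (simp add: mult.assoc)
  have "of_real (1 / (ginibre_rho m u)\<^sup>2) * (of_real (1 / pi) * (\<integral>y. indicator B y *\<^sub>R
      (of_real (sqrt (lam powr (1 / 2 - real m) * normal_density 0 (sqrt (real m)) (sqrt lam * (2 * q * Re \<xi> - real m * y / lam))) *
        sqrt (lam powr (1 / 2 - real m) * normal_density 0 (sqrt (real m)) (sqrt lam * (2 * q * Re \<xi>' - real m * y / lam)))) *
        cis (y * (q * (Im \<xi> - Im \<xi>')))) \<partial>lborel)) =
     of_real (1 / pi) * (of_real (exp (- (Re \<xi>)\<^sup>2 - (Re \<xi>')\<^sup>2) / sqrt (2 * pi)) * (of_real (sqrt (2 * pi)) * exp (c\<^sup>2 / 2) * H))"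
    unfolding I[symmetric] G[symmetric] inverse_ginibre_rho_squared lam_def[symmetric] by (simp only: mult_ac)
  also have "\<dots> = of_real (1 / pi) * (of_real (exp (- (Re \<xi>)\<^sup>2 - (Re \<xi>')\<^sup>2)) * exp (c\<^sup>2 / 2)) * H"
    by simp
  also have "\<dots> = limit_kernel u v v' * cis (Re \<xi> * Im \<xi> - Re \<xi>' * Im \<xi>')"
  proof -
    have "limit_kernel u v v' = of_real (1 / pi) *
        exp (- (1 / 2) * (of_real ((cmod v)\<^sup>2 + (cmod v')\<^sup>2) - 2 * v * cnj v')) * H"
      unfolding limit_kernel_def H_def c_eq ..
    then show ?thesis unfolding E by (simp only: mult_ac)
  qed
  finally show ?thesis
    using lim unfolding B_def[symmetric] by (simp add: mult_ac)
qed

lemma rescaled_corr_tendsto: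
  fixes v :: "nat \<Rightarrow> complex ^ 'n"
  assumes a: "\<And>k. k \<in> {1..m} \<Longrightarrow> a k > -1" and u1: "cmod u \<le> 1" and v: "v \<longlonglongrightarrow> l"
  shows "(\<lambda>N. rescaled_corr m a u N (v N)) \<longlonglongrightarrow> det (\<chi> j k. limit_kernel u (l $ j) (l $ k))"
proof -
  define lam where "lam = bulk_density m u"
  define \<xi> where "\<xi> = (\<lambda>j. cnj (sgn u) * l $ j)"
  define q where "q = sqrt (real m / bulk_density m u)"
  define P where "P = (\<lambda>j z \<psi>. (\<forall>N. z N \<noteq> 0 \<and> z N = rcis (cmod (z N)) (\<psi> N)) \<and>
    (\<forall>\<^sub>F N in sequentially. z N = rescaled_point m u N (v N $ j)) \<and>
    (\<lambda>N. sqrt (real N) * (ln ((cmod (z N))\<^sup>2) - real m * ln (lam * real N))) \<longlonglongrightarrow> 2 * q * Re (\<xi> j) \<and>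
    (\<lambda>N. sqrt (real N) * (\<psi> N - Arg u)) \<longlonglongrightarrow> q * Im (\<xi> j))"
  have "\<exists>z \<psi>. P j z \<psi>" for j
    unfolding P_def lam_def q_def \<xi>_def by (intro rescaled_point_polar tendsto_vec_nth v)
  \<comment> \<open>One argument is fixed per point and used both in its row and in its column;
    otherwise the phases would not be differences and could not be conjugated away.\<close>
  then obtain z \<psi> where "\<And>j. P j (z j) (\<psi> j)" by metis
  then have z0: "\<And>j N. z j N \<noteq> 0" and zr: "\<And>j N. z j N = rcis (cmod (z j N)) (\<psi> j N)"
    and ze: "\<And>j. \<forall>\<^sub>F N in sequentially. z j N = rescaled_point m u N (v N $ j)"
    and zk: "\<And>j. (\<lambda>N. sqrt (real N) * (ln ((cmod (z j N))\<^sup>2) - real m * ln (lam * real N))) \<longlonglongrightarrow> 2 * q * Re (\<xi> j)"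
    and zp: "\<And>j. (\<lambda>N. sqrt (real N) * (\<psi> j N - Arg u)) \<longlonglongrightarrow> q * Im (\<xi> j)"
    unfolding P_def by blast+
  define K where "K = (\<lambda>N j k. of_real (real N ^ (m - 1) * (1 / (ginibre_rho m u)\<^sup>2)) * ginibre_kernel m a N (z j N) (z k N))"
  define s where "s = (\<lambda>j. Re (\<xi> j) * Im (\<xi> j))"
  have "(\<lambda>N. K N j k * cis (- (lam * real N * (\<psi> j N - \<psi> k N)))) \<longlonglongrightarrow> limit_kernel u (l $ j) (l $ k) * cis (s j - s k)" for j k
    unfolding K_def s_def \<xi>_def lam_def
    by (rule rescaled_kernel_tendsto[where a = a, OF a u1 z0 zr z0 zr])
       (use zk zp in \<open>auto simp: \<xi>_def q_def lam_def\<close>)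
  then have lim: "(\<lambda>N. det (\<chi> j k. K N j k * cis (- (lam * real N * (\<psi> j N - \<psi> k N))))) \<longlonglongrightarrow>
      det (\<chi> j k. limit_kernel u (l $ j) (l $ k) * cis (s j - s k))"
    by (rule tendsto_det)
  \<comment> \<open>The phase left by completing the square is removed in the limit, the divergent
    one below for each N.\<close>
  have conj: "det (\<chi> j k. limit_kernel u (l $ j) (l $ k) * cis (s j - s k)) = det (\<chi> j k. limit_kernel u (l $ j) (l $ k))"
  proof -
    have "limit_kernel u (l $ j) (l $ k) * cis (s j - s k) = cis (s j) * limit_kernel u (l $ j) (l $ k) * cis (- s k)" for j k
    proof -
      have "cis (s j - s k) = cis (s j) * cis (- s k)" by (simp add: cis_mult)
      then show ?thesis by (simp only: mult_ac)
    qed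
    then show ?thesis by (simp only:) (rule det_diagonal_conjugation, simp add: cis_mult)
  qed
  have ev: "\<forall>\<^sub>F N in sequentially. det (\<chi> j k. K N j k * cis (- (lam * real N * (\<psi> j N - \<psi> k N)))) = rescaled_corr m a u N (v N)"
  proof -
    have "\<forall>\<^sub>F N in sequentially. \<forall>j\<in>UNIV. z j N = rescaled_point m u N (v N $ j)"
      using ze by (intro eventually_ball_finite) auto
    then show ?thesis
    proof eventually_elim
      case (elim N)
      have "K N j k * cis (- (lam * real N * (\<psi> j N - \<psi> k N))) = cis (- (lam * real N * \<psi> j N)) * K N j k * cis (lam * real N * \<psi> k N)" for j k
      proof -
        have "cis (- (lam * real N * (\<psi> j N - \<psi> k N))) = cis (- (lam * real N * \<psi> j N)) * cis (lam * real N * \<psi> k N)"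
          unfolding cis_mult by (simp add: algebra_simps)
        then show ?thesis by simp
      qed
      then have "det (\<chi> j k. K N j k * cis (- (lam * real N * (\<psi> j N - \<psi> k N)))) = det (\<chi> j k. K N j k)"
        by (simp only:) (rule det_diagonal_conjugation, simp add: cis_mult)
      also have "\<dots> = of_real (real N ^ (m - 1) * (1 / (ginibre_rho m u)\<^sup>2)) ^ CARD('n) *
          det (\<chi> j k. ginibre_kernel m a N (z j N) (z k N) :: complex ^ 'n ^ 'n)"
        unfolding K_def by (rule det_scale)
      also have "\<dots> = rescaled_corr m a u N (v N)"
        using elim unfolding rescaled_corr_def ginibre_corr_def rescaled_point_def
        by (simp add: power_mult_distrib power_divide mult.commute flip: power_mult)
      finally show ?case .
    qed
  qed
  show ?thesis
    using Lim_transform_eventually[OF lim ev] unfolding conj .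
qed

lemma continuous_on_limit_kernel_det:
  "continuous_on S (\<lambda>v :: complex ^ 'n. det (\<chi> j k. limit_kernel u (v $ j) (v $ k)))"
  unfolding continuous_on_def
proof (intro ballI tendsto_det)
  fix v :: "complex ^ 'n" and j k
  have cerfc: "isCont cerfc x" for x
    unfolding cerfc_def using cerf_has_field_derivative[of x] by (intro continuous_intros DERIV_isCont)
  show "((\<lambda>v. limit_kernel u (v $ j) (v $ k)) \<longlongrightarrow> limit_kernel u (v $ j) (v $ k)) (at v within S)"
    unfolding limit_kernel_def
    by (cases "cmod u < 1") (auto intro!: tendsto_intros isCont_tendsto_compose[OF cerfc])
qed

lemma rescaled_corr_uniform_limit:
  assumes a: "\<And>k. k \<in> {1..m} \<Longrightarrow> a k > -1" and u1: "cmod u \<le> 1" and V: "compact V"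
  shows "uniform_limit {v :: complex ^ 'n. \<forall>k. v $ k \<in> V} (\<lambda>N v. rescaled_corr m a u N v)
    (\<lambda>v. det (\<chi> k j. limit_kernel u (v $ k) (v $ j))) sequentially"
  using V a u1
  by (intro uniform_limit_sequentiallyI compact_vec_components continuous_on_limit_kernel_det rescaled_corr_tendsto)

end

theorem theorem1p1:
  fixes m :: nat and a :: "nat \<Rightarrow> real" and u :: complex and V :: "complex set"
  assumes "m \<ge> 1"
    and "\<And>k. k \<in> {1..m} \<Longrightarrow> a k > -1"
    and "compact V"
  shows
    "(0 < cmod u \<and> cmod u < 1 \<longrightarrow>
       uniform_limit {v :: complex ^ 'n. \<forall>k. v $ k \<in> V}
         (\<lambda>N v. rescaled_corr m a u N v)
         (\<lambda>v. det (\<chi> k j. of_real (1 / pi) *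
            exp (- (1 / 2) * (of_real ((cmod (v $ k))\<^sup>2 + (cmod (v $ j))\<^sup>2) - 2 * v $ k * cnj (v $ j)))))
         sequentially) \<and>
     (\<forall>\<phi>::real. 0 \<le> \<phi> \<and> \<phi> < 2 * pi \<and> u = exp (\<i> * of_real \<phi>) \<longrightarrow>
       uniform_limit {v :: complex ^ 'n. \<forall>k. v $ k \<in> V}
         (\<lambda>N v. rescaled_corr m a u N v)
         (\<lambda>v. det (\<chi> k j. of_real (1 / (2 * pi)) *
            exp (- (1 / 2) * (of_real ((cmod (v $ k))\<^sup>2 + (cmod (v $ j))\<^sup>2) - 2 * v $ k * cnj (v $ j))) *
            cerfc ((exp (\<i> * of_real \<phi>) * cnj (v $ j) + exp (- \<i> * of_real \<phi>) * v $ k)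
                     / of_real (sqrt 2))))
         sequentially)"
proof (intro conjI allI impI)
  assume u: "0 < cmod u \<and> cmod u < 1"
  then have kernel: "limit_kernel u v v' = of_real (1 / pi) *
      exp (- (1 / 2) * (of_real ((cmod v)\<^sup>2 + (cmod v')\<^sup>2) - 2 * v * cnj v'))" for v v'
    by (simp add: limit_kernel_def)
  show "uniform_limit {v :: complex ^ 'n. \<forall>k. v $ k \<in> V}
         (\<lambda>N v. rescaled_corr m a u N v)
         (\<lambda>v. det (\<chi> k j. of_real (1 / pi) *
            exp (- (1 / 2) * (of_real ((cmod (v $ k))\<^sup>2 + (cmod (v $ j))\<^sup>2) - 2 * v $ k * cnj (v $ j)))))
         sequentially"
    unfolding kernel[symmetric]
    by (rule rescaled_corr_uniform_limit) (use assms u in auto)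
next
  fix \<phi> :: real
  assume "0 \<le> \<phi> \<and> \<phi> < 2 * pi \<and> u = exp (\<i> * of_real \<phi>)"
  then have u: "u = exp (\<i> * of_real \<phi>)" by simp
  then have u1: "cmod u = 1" by simp
  have "sgn u = exp (\<i> * of_real \<phi>)" "cnj (sgn u) = exp (- \<i> * of_real \<phi>)"
    using u1 by (simp_all add: sgn_eq u exp_cnj)
  then have kernel: "limit_kernel u v v' = of_real (1 / (2 * pi)) *
      exp (- (1 / 2) * (of_real ((cmod v)\<^sup>2 + (cmod v')\<^sup>2) - 2 * v * cnj v')) *
      cerfc ((exp (\<i> * of_real \<phi>) * cnj v' + exp (- \<i> * of_real \<phi>) * v) / of_real (sqrt 2))" for v v'
    using u1 by (simp add: limit_kernel_def)
  show "uniform_limit {v :: complex ^ 'n. \<forall>k. v $ k \<in> V}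
         (\<lambda>N v. rescaled_corr m a u N v)
         (\<lambda>v. det (\<chi> k j. of_real (1 / (2 * pi)) *
            exp (- (1 / 2) * (of_real ((cmod (v $ k))\<^sup>2 + (cmod (v $ j))\<^sup>2) - 2 * v $ k * cnj (v $ j))) *
            cerfc ((exp (\<i> * of_real \<phi>) * cnj (v $ j) + exp (- \<i> * of_real \<phi>) * v $ k)
                     / of_real (sqrt 2))))
         sequentially"
    unfolding kernel[symmetric]
    by (rule rescaled_corr_uniform_limit) (use assms u1 in auto)
qed

end
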